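(* Let $N\ge 2$ be an integer, $\sigma_1,\sigma_2>-2$, $p>1$, $u_0\in L^1_{\mathrm{loc}}(\mathbb{R}^N)$, and let $\mathbf{w}:\mathbb{R}^N\to\mathbb{R}$ be continuous with $\mathbf{w}\in L^1(\mathbb{R}^N)$ and $$\int_{\mathbb{R}^N}\mathbf{w}(x)\,dx>0.$$ Consider the problem $$|x|^{\sigma_1}u_t=\Delta u+|x|^{\sigma_2}|u|^p+t^{\varrho}\,\mathbf{w}(x),\quad (t,x)\in(0,\infty)\times\mathbb{R}^N,\qquad u(0,x)=u_0(x).\tag{P}$$ Then the following assertions hold. (i) If $\varrho>0$, then (P) admits no weak global solution, for any $p>1$. (ii) If $-1<\varrho<0$ and $$p<p^*:=\frac{N+\sigma_2-\varrho(2+\sigma_1)}{N-2-\varrho(2+\sigma_1)},$$ then (P) admits no weak global solution. (iii) If $\varrho=0$ and $$p\le\frac{N+\sigma_2}{(N-2)_+},$$ then (P) admits no weak global solution.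
   Context: Notation: $(N-2)_+=\max\{N-2,0\}$; when $N=2$ the quantity $\frac{N+\sigma_2}{(N-2)_+}$ is understood as $+\infty$, so that the condition in (iii) is satisfied by every $p>1$. Definition (weak global solution). A function $u$ is a weak global solution of (P) with initial data $u_0$ if $u_0\in L^1_{\mathrm{loc}}(\mathbb{R}^N)$; the functions $u$, $|x|^{\sigma_2}|u|^p$ and $|x|^{\sigma_1}u$ all belong to $L^1_{\mathrm{loc}}((0,\infty)\times\mathbb{R}^N)$; and for all $\psi\in C_0^\infty([0,\infty)\times\mathbb{R}^N)$ (smooth functions with compact support in $[0,\infty)\times\mathbb{R}^N$), $$\int_{(0,\infty)\times\mathbb{R}^N}\bigl(-|x|^{\sigma_1}\partial_t\psi-\Delta\psi\bigr)u\,dt\,dx=\int_{\mathbb{R}^N}|x|^{\sigma_1}u_0(x)\psi(0,x)\,dx+\int_{(0,\infty)\times\mathbb{R}^N}\bigl(|x|^{\sigma_2}|u|^p+t^{\varrho}\mathbf{w}(x)\bigr)\psi\,dt\,dx,$$ where the integrals are required to be well defined. *)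

theory Defs
  imports "HOL-Analysis.Analysis"
begin

text \<open>
  \<open>C_k_on k S f\<close>: \<open>f\<close> is \<open>k\<close> times continuously differentiable on \<open>S\<close>, where derivatives are
  taken within \<open>S\<close>. The set \<open>S\<close> need not be open: it is used below for
  \<open>S = [0, \<infinity>) \<times> \<real>\<^sup>N\<close>, on which derivatives within \<open>S\<close> are unique, and are
  one-sided in \<open>t\<close> on the face \<open>t = 0\<close>.
\<close>

primrec C_k_on :: "nat \<Rightarrow> 'a::euclidean_space set \<Rightarrow> ('a \<Rightarrow> real) \<Rightarrow> bool" where
  "C_k_on 0 S f \<longleftrightarrow> continuous_on S f"
| "C_k_on (Suc k) S f \<longleftrightarrow>
     (\<exists>D. (\<forall>z\<in>S. (f has_derivative D z) (at z within S)) \<and>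
          (\<forall>b\<in>Basis. C_k_on k S (\<lambda>z. D z b)))"

definition smooth_on :: "'a::euclidean_space set \<Rightarrow> ('a \<Rightarrow> real) \<Rightarrow> bool" where
  "smooth_on S f \<longleftrightarrow> (\<forall>k. C_k_on k S f)"

definition L1_loc :: "'a::euclidean_space set \<Rightarrow> ('a \<Rightarrow> real) \<Rightarrow> bool" where
  "L1_loc S f \<longleftrightarrow> (\<forall>K. compact K \<and> K \<subseteq> S \<longrightarrow> set_integrable lebesgue K f)"

text \<open>
  Functions of \<open>(t, x)\<close> live on the type \<open>real \<times> (real ^ 'n)\<close>; only their values for \<open>t \<ge> 0\<close>
  (for a solution: \<open>t > 0\<close>) are relevant.
\<close>

definition test_function :: "(real \<times> (real ^ 'n) \<Rightarrow> real) \<Rightarrow> bool" where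
  "test_function \<psi> \<longleftrightarrow>
     smooth_on ({0..} \<times> UNIV) \<psi> \<and>
     (\<exists>K. compact K \<and> K \<subseteq> {0..} \<times> UNIV \<and> (\<forall>z \<in> {0..} \<times> UNIV - K. \<psi> z = 0))"

definition time_deriv :: "(real \<times> (real ^ 'n) \<Rightarrow> real) \<Rightarrow> real \<Rightarrow> real ^ 'n \<Rightarrow> real" where
  "time_deriv \<psi> t x = deriv (\<lambda>s. \<psi> (s, x)) t"

definition laplacian :: "(real ^ 'n \<Rightarrow> real) \<Rightarrow> real ^ 'n \<Rightarrow> real" where
  "laplacian f x = (\<Sum>i\<in>UNIV. (deriv ^^ 2) (\<lambda>s. f (x + s *\<^sub>R axis i 1)) 0)"

text \<open>
  The three integrals of the weak identity are required to exist as (finite) Lebesgue integrals.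
  The convention \<open>0 powr a = 0\<close> affects the weights only on the null set \<open>x = 0\<close>.
\<close>

definition weak_global_solution ::
  "real \<Rightarrow> real \<Rightarrow> real \<Rightarrow> real \<Rightarrow> (real ^ 'n \<Rightarrow> real) \<Rightarrow> (real ^ 'n \<Rightarrow> real) \<Rightarrow>
     (real \<times> (real ^ 'n) \<Rightarrow> real) \<Rightarrow> bool" where
  "weak_global_solution \<sigma>\<^sub>1 \<sigma>\<^sub>2 p \<rho> w u\<^sub>0 u \<longleftrightarrow>
     L1_loc UNIV u\<^sub>0 \<and>
     L1_loc ({0<..} \<times> UNIV) u \<and>
     L1_loc ({0<..} \<times> UNIV) (\<lambda>(t, x). norm x powr \<sigma>\<^sub>2 * \<bar>u (t, x)\<bar> powr p) \<and>
     L1_loc ({0<..} \<times> UNIV) (\<lambda>(t, x). norm x powr \<sigma>\<^sub>1 * u (t, x)) \<and>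
     (\<forall>\<psi>. test_function \<psi> \<longrightarrow>
       (let lhs = (\<lambda>(t, x). (- (norm x powr \<sigma>\<^sub>1) * time_deriv \<psi> t x
                              - laplacian (\<lambda>y. \<psi> (t, y)) x) * u (t, x));
            init = (\<lambda>x. norm x powr \<sigma>\<^sub>1 * u\<^sub>0 x * \<psi> (0, x));
            rhs = (\<lambda>(t, x). (norm x powr \<sigma>\<^sub>2 * \<bar>u (t, x)\<bar> powr p + t powr \<rho> * w x) * \<psi> (t, x))
        in set_integrable lebesgue ({0<..} \<times> UNIV) lhs \<and>
           integrable lebesgue init \<and>
           set_integrable lebesgue ({0<..} \<times> UNIV) rhs \<and>
           (LINT z:{0<..} \<times> UNIV|lebesgue. lhs z) =
             (LINT x|lebesgue. init x) + (LINT z:{0<..} \<times> UNIV|lebesgue. rhs z)))"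

text \<open>The exponent \<open>(N + \<sigma>\<^sub>2) / (N - 2)\<^sub>+\<close>, read as \<open>\<infinity>\<close> for \<open>N = 2\<close>.\<close>

definition stationary_exponent :: "nat \<Rightarrow> real \<Rightarrow> ereal" where
  "stationary_exponent N \<sigma>\<^sub>2 =
     (if N = 2 then \<infinity> else ereal ((real N + \<sigma>\<^sub>2) / max (real N - 2) 0))"

end

theory Submission
  imports Defs
begin

text \<open>
  The proof is the test function method. Let \<open>u\<close> be a solution and \<open>\<psi> \<ge> 0\<close> a test function. Young's
  inequality absorbs the linear term \<open>(\<bar>x\<bar>\<^sup>\<sigma> \<psi>\<^sub>t + \<Delta> \<psi>) u\<close>, where \<open>\<sigma> = \<sigma>\<^sub>1\<close>, into the nonlinear one, and the
  weak identity becomes a bound for \<open>\<integral>\<integral> t\<^sup>\<rho> w \<psi>\<close> that no longer contains \<open>u\<close>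
  (\<open>weak_test_estimate\<close>). With a time cutoff at scale \<open>T\<close> and a spatial cutoff at scale \<open>R\<close>, the
  source term is of order \<open>T\<^sup>\<rho>\<^sup>+\<^sup>1 \<integral> w\<close>, while the Laplacian contributes \<open>T\<close> times \<open>R\<close> to the power
  \<open>N - (2 p + \<sigma>\<^sub>2) / (p - 1)\<close>. Letting first \<open>T\<close> and then \<open>R\<close> tend to infinity, or coupling them by
  \<open>T = R\<close> to the power \<open>2 + \<sigma>\<^sub>1\<close>, contradicts \<open>\<integral> w > 0\<close> under the hypotheses of the three
  assertions. For \<open>\<rho> = 0\<close> the exponent may vanish; a spatial cutoff that decays logarithmically between
  \<open>R\<close> and \<open>R exp n\<close> then still gains a factor \<open>n\<close> to the power \<open>1 - p / (p - 1)\<close>.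

  The obstacle is the origin. The time derivative of the cutoff produces the weight \<open>\<bar>x\<bar>\<close> to the power
  \<open>(\<sigma>\<^sub>1 p - \<sigma>\<^sub>2) / (p - 1)\<close>, which need not be integrable there. Near the origin the time cutoff \<open>\<eta>\<close> is
  therefore replaced by a partial sum of the formal solution \<open>\<Sum> (-1)\<^sup>j \<eta>\<^sup>(\<^sup>j\<^sup>) h\<^sub>j\<close> of the
  backward equation \<open>\<bar>x\<bar>\<^sup>\<sigma> \<psi>\<^sub>t + \<Delta> \<psi> = 0\<close>, in which \<open>h\<^sub>j\<close> is a multiple of \<open>\<bar>x\<bar>\<close> to the power
  \<open>(2 + \<sigma>\<^sub>1) j\<close>. All terms of the residual cancel except the last one, which vanishes to high order at the
  origin (\<open>inner_adj_eq\<close>). For \<open>\<psi>\<close> to be nonnegative the derivatives of \<open>\<eta>\<close> must alternate in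
  sign. The function \<open>exp (-1/s)\<close>, read backwards from the time \<open>T\<close>, has this property, but a cutoff
  that also vanishes at time 0 cannot have it. Hence the test function charges the initial datum, but
  only inside a fixed ball, where the datum contributes a constant; outside this ball it is switched on
  between the times 1 and 2. The price of the switch is the integral of the above weight over the
  annulus between the radii 1 and \<open>R\<close>. It is at most logarithmic in \<open>R\<close> precisely when the weight
  fails to be integrable at the origin. When the weight is integrable, a plain product of cutoffs that vanishes at
  time 0 does the job (\<open>main_inequality\<close>, \<open>bump_inequality\<close>).

  The powers \<open>h\<^sub>j\<close> are not smooth at the origin. The weak identity extends to them by replacing \<open>\<bar>x\<bar>\<^sup>2\<close>
  with \<open>\<bar>x\<bar>\<^sup>2 + d\<close> and letting \<open>d\<close> tend to 0 (\<open>weak_test_radial\<close>). Dominated convergence needs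
  \<open>u\<close> and \<open>\<bar>x\<bar>\<^sup>\<sigma> u\<close> to be integrable up to time 0, which is extracted from the weak
  identity with two special test functions (\<open>integrable_weighted_u\<close>, \<open>integrable_u\<close>).
\<close>


section \<open>Calculus of smooth functions\<close>

lemma C_k_on_continuous: "C_k_on k S f \<Longrightarrow> continuous_on S f"
  by (cases k) (auto simp: has_derivative_continuous continuous_on_eq_continuous_within)

lemma C_k_on_SucE:
  assumes "C_k_on (Suc k) S f"
  obtains D where "\<And>z. z \<in> S \<Longrightarrow> (f has_derivative D z) (at z within S)"
    and "\<And>b. b \<in> Basis \<Longrightarrow> C_k_on k S (\<lambda>z. D z b)"
  using assms by auto

text \<open>
  Needed because the derivative of a product or a composition contains the undifferentiated factors,
  so the induction on the order of differentiability has to step down by one.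
\<close>

lemma C_k_on_Suc_imp: "C_k_on (Suc k) S f \<Longrightarrow> C_k_on k S f"
proof (induction k arbitrary: f)
  case 0
  then show ?case using C_k_on_continuous by fastforce
next
  case (Suc k)
  then show ?case by (metis C_k_on.simps(2))
qed

lemma C_k_on_const: "C_k_on k S (\<lambda>_. c)"
proof (induction k arbitrary: c)
  case (Suc k)
  show ?case unfolding C_k_on.simps
    by (intro exI[of _ "\<lambda>_ _. 0"] conjI ballI has_derivative_const Suc.IH)
qed auto

lemma C_k_on_add: "C_k_on k S f \<Longrightarrow> C_k_on k S g \<Longrightarrow> C_k_on k S (\<lambda>z. f z + g z)"
proof (induction k arbitrary: f g)
  case 0
  then show ?case by (auto intro: continuous_on_add)
next
  case (Suc k)
  from Suc.prems(1) obtain D where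
    D: "\<And>z. z\<in>S \<Longrightarrow> (f has_derivative D z) (at z within S)" "\<And>b. b\<in>Basis \<Longrightarrow> C_k_on k S (\<lambda>z. D z b)"
    by (rule C_k_on_SucE) blast
  from Suc.prems(2) obtain E where
    E: "\<And>z. z\<in>S \<Longrightarrow> (g has_derivative E z) (at z within S)" "\<And>b. b\<in>Basis \<Longrightarrow> C_k_on k S (\<lambda>z. E z b)"
    by (rule C_k_on_SucE) blast
  show ?case unfolding C_k_on.simps
    by (intro exI[of _ "\<lambda>z h. D z h + E z h"] conjI ballI has_derivative_add D(1) E(1) Suc.IH D(2) E(2))
qed

lemma C_k_on_mult: "C_k_on k S f \<Longrightarrow> C_k_on k S g \<Longrightarrow> C_k_on k S (\<lambda>z. f z * g z)"
proof (induction k arbitrary: f g)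
  case 0
  then show ?case by (auto intro: continuous_on_mult)
next
  case (Suc k)
  from Suc.prems(1) obtain D where
    D: "\<And>z. z\<in>S \<Longrightarrow> (f has_derivative D z) (at z within S)" "\<And>b. b\<in>Basis \<Longrightarrow> C_k_on k S (\<lambda>z. D z b)"
    by (rule C_k_on_SucE) blast
  from Suc.prems(2) obtain E where
    E: "\<And>z. z\<in>S \<Longrightarrow> (g has_derivative E z) (at z within S)" "\<And>b. b\<in>Basis \<Longrightarrow> C_k_on k S (\<lambda>z. E z b)"
    by (rule C_k_on_SucE) blast
  have "C_k_on k S f" "C_k_on k S g" using Suc.prems C_k_on_Suc_imp by blast+
  then show ?case unfolding C_k_on.simps
    by (intro exI[of _ "\<lambda>z h. f z * E z h + D z h * g z"] conjI ballI has_derivative_mult D(1) E(1)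
        C_k_on_add Suc.IH D(2) E(2))
qed

lemma C_k_on_sum: "(\<And>i. i \<in> I \<Longrightarrow> C_k_on k S (f i)) \<Longrightarrow> C_k_on k S (\<lambda>z. \<Sum>i\<in>I. f i z)"
  by (induction I rule: infinite_finite_induct) (auto intro: C_k_on_const C_k_on_add)

lemma C_k_on_linear: "bounded_linear f \<Longrightarrow> C_k_on k S f"
proof (cases k)
  case (Suc j)
  assume "bounded_linear f"
  then show ?thesis unfolding Suc C_k_on.simps
    by (intro exI[of _ "\<lambda>_. f"] conjI ballI C_k_on_const bounded_linear_imp_has_derivative)
qed (auto intro: linear_continuous_on)

text \<open>
  By the chain rule the partial derivatives of the composition are products of a partial derivative
  of the inner function with the composed derivative of the outer one, to which the induction
  hypothesis applies. Only real outer functions occur below, so a derivative is a number.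
\<close>

lemma C_k_on_compose_real:
  assumes "open U"
  shows "C_k_on k U F \<Longrightarrow> C_k_on k S g \<Longrightarrow> g ` S \<subseteq> U \<Longrightarrow> C_k_on k S (\<lambda>z. F (g z :: real))"
proof (induction k arbitrary: F)
  case 0
  then show ?case unfolding C_k_on.simps by (metis continuous_on_compose2)
next
  case (Suc k)
  from Suc.prems(1) obtain D where
    D: "\<And>s. s\<in>U \<Longrightarrow> (F has_derivative D s) (at s within U)" "\<And>b. b \<in> Basis \<Longrightarrow> C_k_on k U (\<lambda>s. D s b)"
    by (rule C_k_on_SucE) blast
  have D1: "C_k_on k U (\<lambda>s. D s 1)" by (rule D(2)) simp
  from Suc.prems(2) obtain E where
    E: "\<And>z. z\<in>S \<Longrightarrow> (g has_derivative E z) (at z within S)" "\<And>b. b\<in>Basis \<Longrightarrow> C_k_on k S (\<lambda>z. E z b)"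
    by (rule C_k_on_SucE) blast
  have lin: "D s h = h * D s 1" if "s \<in> U" for s h
  proof -
    have "linear (D s)" using D(1)[OF that] has_derivative_linear by blast
    from linear_cmul[OF this, of h 1] show ?thesis by simp
  qed
  have "((\<lambda>z. F (g z)) has_derivative (\<lambda>h. E z h * D (g z) 1)) (at z within S)" if z: "z \<in> S" for z
  proof -
    have gz: "g z \<in> U" using Suc.prems(3) z by auto
    have 1: "(F has_derivative D (g z)) (at (g z))"
      using D(1)[OF gz] at_within_open[OF gz assms] by simp
    have "((\<lambda>z. F (g z)) has_derivative (\<lambda>h. D (g z) (E z h))) (at z within S)"
      by (rule has_derivative_compose[OF E(1)[OF z] 1])
    then show ?thesis by (subst (asm) lin[OF gz])
  qed
  moreover have "C_k_on k S g" using Suc.prems C_k_on_Suc_imp by blast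
  moreover have "C_k_on k S (\<lambda>z. E z b * D (g z) 1)" if "b \<in> Basis" for b
    using \<open>C_k_on k S g\<close> by (intro C_k_on_mult E(2) that Suc.IH[OF D1] Suc.prems(3))
  ultimately show ?case unfolding C_k_on.simps
    by (intro exI[of _ "\<lambda>z h. E z h * D (g z) 1"] conjI ballI)
qed

lemma C_k_on_compose_fst:
  fixes S :: "('a::euclidean_space \<times> 'b::euclidean_space) set"
  shows "C_k_on k UNIV f \<Longrightarrow> C_k_on k S (\<lambda>z. f (fst z))"
proof (induction k arbitrary: f)
  case 0
  then show ?case by (auto intro!: continuous_on_compose2[of UNIV f] continuous_on_fst continuous_on_id)
next
  case (Suc k)
  from Suc.prems obtain D where
    D: "\<And>s. (f has_derivative D s) (at s)" "\<And>b. b\<in>Basis \<Longrightarrow> C_k_on k UNIV (\<lambda>z. D z b)" by auto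
  have 0: "D s 0 = 0" for s using D(1)[of s] has_derivative_linear linear_0 by blast
  have "((\<lambda>z. f (fst z)) has_derivative (\<lambda>h. D (fst z) (fst h))) (at z within S)" for z
    by (rule has_derivative_compose[OF has_derivative_fst[OF has_derivative_ident] D(1)])
  moreover have "C_k_on k S (\<lambda>z. D (fst z) (fst b))" if "b \<in> Basis" for b :: "'a \<times> 'b"
  proof -
    have "fst b = 0 \<or> fst b \<in> Basis" using that by (auto simp: Basis_prod_def)
    then show ?thesis using Suc.IH[OF D(2)] 0 C_k_on_const by auto
  qed
  ultimately show ?case
    unfolding C_k_on.simps by (intro exI[of _ "\<lambda>z h. D (fst z) (fst h)"] conjI ballI)
qed

lemma C_k_on_compose_snd:
  fixes S :: "('a::euclidean_space \<times> 'b::euclidean_space) set"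
  shows "C_k_on k UNIV f \<Longrightarrow> C_k_on k S (\<lambda>z. f (snd z))"
proof (induction k arbitrary: f)
  case 0
  then show ?case by (auto intro!: continuous_on_compose2[of UNIV f] continuous_on_snd continuous_on_id)
next
  case (Suc k)
  from Suc.prems obtain D where
    D: "\<And>s. (f has_derivative D s) (at s)" "\<And>b. b\<in>Basis \<Longrightarrow> C_k_on k UNIV (\<lambda>z. D z b)" by auto
  have 0: "D s 0 = 0" for s using D(1)[of s] has_derivative_linear linear_0 by blast
  have "((\<lambda>z. f (snd z)) has_derivative (\<lambda>h. D (snd z) (snd h))) (at z within S)" for z
    by (rule has_derivative_compose[OF has_derivative_snd[OF has_derivative_ident] D(1)])
  moreover have "C_k_on k S (\<lambda>z. D (snd z) (snd b))" if "b \<in> Basis" for b :: "'a \<times> 'b"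
  proof -
    have "snd b = 0 \<or> snd b \<in> Basis" using that by (auto simp: Basis_prod_def)
    then show ?thesis using Suc.IH[OF D(2)] 0 C_k_on_const by auto
  qed
  ultimately show ?case
    unfolding C_k_on.simps by (intro exI[of _ "\<lambda>z h. D (snd z) (snd h)"] conjI ballI)
qed

lemma smooth_on_const: "smooth_on S (\<lambda>_. c)"
  unfolding smooth_on_def by (intro allI C_k_on_const)

lemma smooth_on_add: "smooth_on S f \<Longrightarrow> smooth_on S g \<Longrightarrow> smooth_on S (\<lambda>z. f z + g z)"
  unfolding smooth_on_def by (intro allI C_k_on_add; blast)

lemma smooth_on_mult: "smooth_on S f \<Longrightarrow> smooth_on S g \<Longrightarrow> smooth_on S (\<lambda>z. f z * g z)"
  unfolding smooth_on_def by (intro allI C_k_on_mult; blast)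

lemma smooth_on_linear: "bounded_linear h \<Longrightarrow> smooth_on S h"
  unfolding smooth_on_def by (intro allI C_k_on_linear; blast)

lemma smooth_on_compose_real:
  assumes "open U" "smooth_on U F" "smooth_on S g" "g ` S \<subseteq> U"
  shows "smooth_on S (\<lambda>z. F (g z :: real))"
  unfolding smooth_on_def
proof
  fix k
  have "C_k_on k U F" "C_k_on k S g" using assms(2,3) by (simp_all only: smooth_on_def)
  then show "C_k_on k S (\<lambda>z. F (g z))" by (rule C_k_on_compose_real[OF assms(1) _ _ assms(4)])
qed

lemma smooth_on_compose_fst:
  fixes S :: "('a::euclidean_space \<times> 'b::euclidean_space) set"
  shows "smooth_on UNIV a \<Longrightarrow> smooth_on S (\<lambda>z. a (fst z))"
  unfolding smooth_on_def by (intro allI C_k_on_compose_fst; blast)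

lemma smooth_on_compose_snd:
  fixes S :: "('a::euclidean_space \<times> 'b::euclidean_space) set"
  shows "smooth_on UNIV b \<Longrightarrow> smooth_on S (\<lambda>z. b (snd z))"
  unfolding smooth_on_def by (intro allI C_k_on_compose_snd; blast)

lemma smooth_on_sum: "(\<And>i. i \<in> I \<Longrightarrow> smooth_on S (f i)) \<Longrightarrow> smooth_on S (\<lambda>z. \<Sum>i\<in>I. f i z)"
  unfolding smooth_on_def by (intro allI C_k_on_sum) simp

lemma smooth_on_diff:
  assumes "smooth_on S f" "smooth_on S g" shows "smooth_on S (\<lambda>z. f z - g z)"
proof -
  have "smooth_on S (\<lambda>z. f z + (-1) * g z)"
    by (intro smooth_on_add smooth_on_mult smooth_on_const assms)
  then show ?thesis by simp
qed

lemma smooth_on_ident_real: "smooth_on S (\<lambda>s::real. s)"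
  by (rule smooth_on_linear) (rule bounded_linear_ident)

lemma C_k_on_SucI_real:
  assumes "\<And>s. s \<in> S \<Longrightarrow> (F has_real_derivative F' s) (at s)" and "C_k_on k S F'"
  shows "C_k_on (Suc k) S F"
proof -
  have "(F has_derivative (\<lambda>h. F' s * h)) (at s within S)" if "s \<in> S" for s
    using assms(1)[OF that] unfolding has_field_derivative_def by (rule has_derivative_at_withinI)
  moreover have "C_k_on k S (\<lambda>s. F' s * b)" if "b \<in> Basis" for b :: real
    by (intro C_k_on_mult C_k_on_const assms(2))
  ultimately show ?thesis
    unfolding C_k_on.simps by (intro exI[of _ "\<lambda>s h. F' s * h"] conjI ballI)
qed

lemma C_k_on_powr: "C_k_on k {0<..} (\<lambda>s::real. s powr a)"
proof (induction k arbitrary: a)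
  case 0
  show ?case unfolding C_k_on.simps by (rule continuous_on_powr) auto
next
  case (Suc k)
  show ?case
  proof (rule C_k_on_SucI_real)
    show "((\<lambda>s. s powr a) has_real_derivative a * s powr (a - 1)) (at s)" if "s \<in> {0<..}" for s
      using that by (intro has_real_derivative_powr) simp
    show "C_k_on k {0<..} (\<lambda>s. a * s powr (a - 1))" by (intro C_k_on_mult C_k_on_const Suc.IH)
  qed
qed

lemma C_k_on_ln: "C_k_on k {0<..} (ln :: real \<Rightarrow> real)"
proof (cases k)
  case 0
  show ?thesis unfolding 0 C_k_on.simps by (rule continuous_on_ln) auto
next
  case (Suc j)
  show ?thesis unfolding Suc
  proof (rule C_k_on_SucI_real)
    show "(ln has_real_derivative s powr (-1)) (at s)" if "s \<in> {0<..}" for s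
      using DERIV_ln[of s] that by (simp add: powr_minus)
    show "C_k_on j {0<..} (\<lambda>s. s powr (-1))" by (rule C_k_on_powr)
  qed
qed

lemma smooth_on_powr: "smooth_on {0<..} (\<lambda>s::real. s powr a)"
  unfolding smooth_on_def by (intro allI C_k_on_powr)

lemma smooth_on_ln: "smooth_on {0<..} (ln :: real \<Rightarrow> real)"
  unfolding smooth_on_def by (intro allI C_k_on_ln)

lemma smooth_on_deriv_seq:
  assumes "\<And>n s. (F n has_real_derivative F (Suc n) s) (at s)"
  shows "smooth_on UNIV (F n)"
proof -
  have "C_k_on k UNIV (F n)" for k n
  proof (induction k arbitrary: n)
    case 0
    show ?case unfolding C_k_on.simps
      by (intro continuous_at_imp_continuous_on ballI DERIV_isCont[OF assms])
  next
    case (Suc k)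
    show ?case by (rule C_k_on_SucI_real[OF assms Suc.IH])
  qed
  then show ?thesis unfolding smooth_on_def by (intro allI)
qed

section \<open>A flat function and a smooth step\<close>

text \<open>
  Differentiating \<open>P (1/s) exp (-1/s)\<close> gives \<open>P\<^sub>1 (1/s) exp (-1/s)\<close> with
  \<open>P\<^sub>1 y = y\<^sup>2 (P y - P' y)\<close>. Hence \<open>flat n\<close> is the \<open>n\<close>-th derivative of the
  classical flat function \<open>exp (-1/s)\<close>, extended by 0 to \<open>s \<le> 0\<close>.
\<close>

fun flat_poly :: "nat \<Rightarrow> real poly" where
  "flat_poly 0 = 1"
| "flat_poly (Suc n) = [:0, 0, 1:] * (flat_poly n - pderiv (flat_poly n))"

definition flat :: "nat \<Rightarrow> real \<Rightarrow> real" where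
  "flat n s = (if s > 0 then poly (flat_poly n) (1/s) * exp (-(1/s)) else 0)"

lemma poly_le_exp:
  fixes q :: "real poly"
  assumes "c > 0"
  obtains C where "C > 0" "\<And>y. y \<ge> 0 \<Longrightarrow> \<bar>poly q y\<bar> \<le> C * exp (c * y)"
proof -
  have "\<exists>C>0. \<forall>y\<ge>0. \<bar>poly q y\<bar> \<le> C * exp (c * y)" using assms
  proof (induction q arbitrary: c)
    case 0
    then show ?case by (auto intro!: exI[of _ 1])
  next
    case (pCons a q)
    from pCons.IH[of "c/2"] pCons.prems obtain C where
      C: "C > 0" "\<And>y. y \<ge> 0 \<Longrightarrow> \<bar>poly q y\<bar> \<le> C * exp (c/2 * y)" by auto
    have "\<bar>poly (pCons a q) y\<bar> \<le> (\<bar>a\<bar> + 2/c * C + 1) * exp (c * y)" if "y \<ge> 0" for y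
    proof -
      have y: "c/2 * y \<le> exp (c/2 * y)" using exp_ge_add_one_self[of "c/2*y"] by linarith
      have "\<bar>a + y * poly q y\<bar> \<le> \<bar>a\<bar> + y * \<bar>poly q y\<bar>"
        using that by (metis abs_triangle_ineq abs_mult abs_of_nonneg)
      also have "\<dots> \<le> \<bar>a\<bar> + y * (C * exp (c/2 * y))"
        using C(2)[OF that] that by (intro add_left_mono mult_left_mono)
      also have "y * (C * exp (c/2 * y)) = (c/2 * y) * (2/c * C * exp (c/2*y))" using pCons.prems by simp
      also have "\<dots> \<le> exp (c/2 * y) * (2/c * C * exp (c/2*y))"
        using C(1) pCons.prems by (intro mult_right_mono y) auto
      also have "\<dots> = 2/c*C * exp (c * y)" by (simp flip: exp_add)
      also have "\<bar>a\<bar> \<le> (\<bar>a\<bar>+1) * exp (c*y)"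
        using mult_mono[of "\<bar>a\<bar>" "\<bar>a\<bar>+1" 1 "exp (c*y)"] that pCons.prems by simp
      finally show ?thesis by (simp add: algebra_simps)
    qed
    then show ?case using C(1) pCons.prems
      by (intro exI[of _ "\<bar>a\<bar> + 2/c * C + 1"] conjI) (auto intro!: add_nonneg_pos)
  qed
  then show ?thesis using that by blast
qed

lemma flat_0: "flat 0 s = (if s > 0 then exp (-(1/s)) else 0)"
  by (simp add: flat_def)

lemma flat_nonpos [simp]: "s \<le> 0 \<Longrightarrow> flat n s = 0"
  by (simp add: flat_def)

lemma flat_0_bounds: "0 \<le> flat 0 s" "flat 0 s \<le> 1" "s > 0 \<Longrightarrow> 0 < flat 0 s"
  by (auto simp: flat_0)

lemma flat_0_mono: "s \<le> t \<Longrightarrow> flat 0 s \<le> flat 0 t"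
  by (auto simp: flat_0 frac_le)

text \<open>
  The property for which every cutoff below is built from \<open>flat\<close>: a polynomial in \<open>1/s\<close> is
  absorbed by any fraction of the exponential. With \<open>\<theta> = 1/p\<close> this is what makes a residual
  containing derivatives of a cutoff divisible by the \<open>p\<close>-th root of the cutoff itself.
\<close>

lemma flat_le_powr:
  assumes "\<theta> < 1"
  obtains C where "C > 0" "\<And>s. \<bar>flat n s\<bar> \<le> C * flat 0 s powr \<theta>"
proof -
  obtain C where C: "C > 0" "\<And>y. y \<ge> 0 \<Longrightarrow> \<bar>poly (flat_poly n) y\<bar> \<le> C * exp ((1-\<theta>) * y)"
    using poly_le_exp[of "1-\<theta>" "flat_poly n"] assms by auto
  have "\<bar>flat n s\<bar> \<le> C * flat 0 s powr \<theta>" if "s > 0" for s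
  proof -
    have "\<bar>flat n s\<bar> = \<bar>poly (flat_poly n) (1/s)\<bar> * exp (-(1/s))"
      using that by (simp add: flat_def abs_mult)
    also have "\<dots> \<le> C * exp ((1-\<theta>) * (1/s)) * exp (-(1/s))"
      using that by (intro mult_right_mono C(2)) auto
    also have "\<dots> = C * exp (-(\<theta> * (1/s)))"
      by (simp add: mult.assoc diff_divide_distrib left_diff_distrib flip: exp_add)
    also have "\<dots> = C * flat 0 s powr \<theta>" using that by (simp add: flat_0 powr_def)
    finally show ?thesis .
  qed
  then have "\<bar>flat n s\<bar> \<le> C * flat 0 s powr \<theta>" for s by (cases "s > 0") auto
  then show ?thesis using C(1) that by blast
qed

text \<open>
  At \<open>s = 0\<close> the difference quotient is \<open>O(s)\<close>, because \<open>y\<^sup>2 P y\<close> is dominated by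
  \<open>exp y\<close> at \<open>y = 1/s\<close>.
\<close>

lemma flat_deriv: "(flat n has_real_derivative flat (Suc n) s) (at s)"
proof -
  consider "s > 0" | "s < 0" | "s = 0" by linarith
  then show ?thesis
  proof cases
    case 1
    have "((\<lambda>s. poly (flat_poly n) (1/s) * exp (-(1/s))) has_real_derivative flat (Suc n) s) (at s)"
      using 1 by (auto intro!: derivative_eq_intros DERIV_chain2[OF poly_DERIV]
          simp: flat_def power2_eq_square field_simps)
    then show ?thesis
      by (rule has_field_derivative_transform_within_open[of _ _ _ "{0<..}"]) (use 1 in \<open>auto simp: flat_def\<close>)
  next
    case 2
    have "((\<lambda>s. 0) has_real_derivative flat (Suc n) s) (at s)" using 2 by simp
    then show ?thesis
      by (rule has_field_derivative_transform_within_open[of _ _ _ "{..<0}"]) (use 2 in auto)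
  next
    case 3
    define Q where "Q = [:0,0,1:] * flat_poly n"
    obtain C where C: "C > 0" "\<And>y. y \<ge> 0 \<Longrightarrow> \<bar>poly Q y\<bar> \<le> C * exp (1 * y)"
      using poly_le_exp[of 1 Q] by auto
    have b: "norm (flat n h / h) \<le> C * \<bar>h\<bar>" for h
    proof (cases "h > 0")
      case True
      have "poly Q (1/h) = (1/h)\<^sup>2 * poly (flat_poly n) (1/h)"
        by (simp add: Q_def power2_eq_square)
      then have eq: "flat n h / h = (poly Q (1/h) * exp (-(1/h))) * h"
        using True by (simp add: flat_def power2_eq_square)
      have "\<bar>poly Q (1/h)\<bar> * exp (-(1/h)) \<le> C * exp (1 * (1/h)) * exp (-(1/h))"
        using True by (intro mult_right_mono C(2)) auto
      then have "\<bar>poly Q (1/h) * exp (-(1/h))\<bar> \<le> C"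
        by (simp add: abs_mult mult.assoc flip: exp_add)
      then show ?thesis unfolding eq real_norm_def abs_mult
        by (rule mult_right_mono) simp
    next
      case False
      then have "flat n h = 0" by simp
      moreover have "0 \<le> C * \<bar>h\<bar>" using C(1) by simp
      ultimately show ?thesis by simp
    qed
    have "((\<lambda>h. flat n h / h) \<longlongrightarrow> 0) (at 0)"
    proof (rule Lim_null_comparison[OF always_eventually[OF allI[OF b]]])
      show "((\<lambda>h. C * \<bar>h\<bar>) \<longlongrightarrow> 0) (at 0)"
        by (auto intro!: tendsto_eq_intros)
    qed
    then show ?thesis unfolding has_field_derivative_iff 3 by simp
  qed
qed

lemma smooth_on_flat: "smooth_on UNIV (flat n)"
  by (rule smooth_on_deriv_seq) (rule flat_deriv)

lemma flat_poly_monic: "lead_coeff (flat_poly n) = 1"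
proof (induction n)
  case (Suc n)
  define q where "q = flat_poly n"
  have "lead_coeff (q - pderiv q) = 1"
  proof (cases "degree q = 0")
    case True
    then have "pderiv q = 0" by (simp add: pderiv_eq_0_iff)
    then show ?thesis using Suc by (simp add: q_def)
  next
    case False
    then have "degree (- pderiv q) < degree q" by (simp add: degree_pderiv)
    then have "lead_coeff (- pderiv q + q) = lead_coeff q" by (rule lead_coeff_add_le)
    then show ?thesis using Suc by (simp add: q_def)
  qed
  moreover have "lead_coeff [:0, 0, 1::real:] = 1" by simp
  ultimately show ?case unfolding flat_poly.simps lead_coeff_mult q_def by simp
qed simp

text \<open>
  All polynomials \<open>flat_poly n\<close> are monic, so finitely many of them are simultaneously positive for
  large \<open>1/s\<close>. Read backwards from its vanishing time, a time cutoff made of \<open>flat 0\<close> therefore has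
  derivatives of alternating sign, which is the sign that the correction at the origin requires.
\<close>

lemma flat_nonneg_near_0:
  obtains s0 where "0 < s0" "\<And>n s. n \<le> (K::nat) \<Longrightarrow> s \<le> s0 \<Longrightarrow> 0 \<le> flat n s"
proof -
  have "\<forall>\<^sub>F y in at_top. 0 \<le> poly (flat_poly n) y" for n
  proof -
    obtain Y where "\<forall>x\<ge>Y. 1 \<le> poly (flat_poly n) x"
      using poly_pinfty_gt_lc[of "flat_poly n"] flat_poly_monic[of n] by auto
    then have "\<forall>x\<ge>Y. 0 \<le> poly (flat_poly n) x" by force
    then show ?thesis unfolding eventually_at_top_linorder ..
  qed
  then have "\<forall>\<^sub>F y in at_top. \<forall>n\<in>{..K}. 0 \<le> poly (flat_poly n) y"
    by (auto intro!: eventually_ball_finite)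
  then obtain Y where Y: "\<And>y n. y \<ge> Y \<Longrightarrow> n \<le> K \<Longrightarrow> 0 \<le> poly (flat_poly n) y"
    unfolding eventually_at_top_linorder by auto
  have "0 \<le> flat n s" if "n \<le> K" "s \<le> 1 / max Y 1" for n s
  proof (cases "s > 0")
    case True
    then have "max Y 1 \<le> 1/s" using that(2) by (simp add: field_simps del: max.bounded_iff)
    then show ?thesis using Y[of "1/s" n] that(1) by (simp add: flat_def)
  qed simp
  then show ?thesis using that[of "1 / max Y 1"] by auto
qed

text \<open>
  A smooth step from 1 on the left of 0 to 0 on the right of 1. Nesting the flat function in itself
  avoids a quotient, so that \<open>flat_le_powr\<close> transfers directly to the derivatives.
\<close>

definition step :: "real \<Rightarrow> real" where
  "step y = flat 0 (flat 0 1 - flat 0 y) / flat 0 (flat 0 1)"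

definition step1 :: "real \<Rightarrow> real" where
  "step1 y = - (flat 1 (flat 0 1 - flat 0 y) * flat 1 y) / flat 0 (flat 0 1)"

definition step2 :: "real \<Rightarrow> real" where
  "step2 y = (flat 2 (flat 0 1 - flat 0 y) * (flat 1 y)\<^sup>2 - flat 1 (flat 0 1 - flat 0 y) * flat 2 y)
     / flat 0 (flat 0 1)"

lemma flat_0_flat_0_1: "flat 0 (flat 0 1) > 0"
  by (intro flat_0_bounds(3)) auto

lemma flat_deriv_01: "(flat 0 has_real_derivative flat 1 s) (at s)" "(flat 1 has_real_derivative flat 2 s) (at s)"
  using flat_deriv[of 0 s] flat_deriv[of 1 s] by (simp_all add: numeral_2_eq_2)

lemma step_deriv: "(step has_real_derivative step1 y) (at y)"
proof -
  have "((\<lambda>y. flat 0 (flat 0 1 - flat 0 y)) has_real_derivative flat 1 (flat 0 1 - flat 0 y) * (0 - flat 1 y)) (at y)"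
    by (intro DERIV_chain2[OF flat_deriv_01(1)] DERIV_diff DERIV_const flat_deriv_01)
  from DERIV_cdivide[OF this, of "flat 0 (flat 0 1)"] show ?thesis
    unfolding step_def[abs_def] step1_def by simp
qed

lemma step1_deriv: "(step1 has_real_derivative step2 y) (at y)"
proof -
  have "((\<lambda>y. - (flat 1 (flat 0 1 - flat 0 y) * flat 1 y)) has_real_derivative
     - (flat 2 (flat 0 1 - flat 0 y) * (0 - flat 1 y) * flat 1 y + flat 2 y * flat 1 (flat 0 1 - flat 0 y))) (at y)"
    by (intro DERIV_minus DERIV_mult DERIV_chain2[OF flat_deriv_01(2)] DERIV_diff DERIV_const flat_deriv_01)
  from DERIV_cdivide[OF this, of "flat 0 (flat 0 1)"] show ?thesis
    unfolding step1_def[abs_def] step2_def by (simp add: power2_eq_square algebra_simps)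
qed

lemma step_bounds: "0 \<le> step y" "step y \<le> 1"
  using flat_0_flat_0_1 flat_0_bounds(1)[of "flat 0 1 - flat 0 y"]
    flat_0_mono[of "flat 0 1 - flat 0 y" "flat 0 1"] flat_0_bounds(1)[of y]
  by (auto simp: step_def)

lemma step_left: "y \<le> 0 \<Longrightarrow> step y = 1" "y \<le> 0 \<Longrightarrow> step1 y = 0" "y \<le> 0 \<Longrightarrow> step2 y = 0"
  using flat_0_flat_0_1 by (auto simp: step_def step1_def step2_def)

lemma step_right: "1 \<le> y \<Longrightarrow> step y = 0" "1 \<le> y \<Longrightarrow> step1 y = 0" "1 \<le> y \<Longrightarrow> step2 y = 0"
  using flat_0_mono[of 1 y] by (auto simp: step_def step1_def step2_def)

lemma smooth_on_step: "smooth_on UNIV step"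
proof -
  have "smooth_on UNIV (\<lambda>y. flat 0 (flat 0 1 - flat 0 y) * (1 / flat 0 (flat 0 1)))"
    by (intro smooth_on_mult smooth_on_compose_real[OF open_UNIV smooth_on_flat] smooth_on_diff smooth_on_const
        smooth_on_flat subset_UNIV)
  then show ?thesis by (simp add: step_def[abs_def] divide_inverse)
qed

lemma continuous_on_flat [continuous_intros]:
  assumes "continuous_on S g" shows "continuous_on S (\<lambda>x. flat n (g x))"
  by (rule continuous_on_compose2[OF _ assms subset_UNIV])
     (intro continuous_at_imp_continuous_on ballI DERIV_isCont[OF flat_deriv])

lemma continuous_on_step: "continuous_on S step" "continuous_on S step1" "continuous_on S step2"
  unfolding step_def[abs_def] step1_def[abs_def] step2_def[abs_def]
  using flat_0_flat_0_1 by (auto intro!: continuous_intros)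

lemma step_deriv_le_powr:
  assumes "0 \<le> \<theta>" "\<theta> < 1"
  obtains C where "C > 0" "\<And>y. \<bar>step1 y\<bar> \<le> C * step y powr \<theta>" "\<And>y. \<bar>step2 y\<bar> \<le> C * step y powr \<theta>"
proof -
  obtain C1 where C1: "C1 > 0" "\<And>s. \<bar>flat 1 s\<bar> \<le> C1 * flat 0 s powr \<theta>"
    by (rule flat_le_powr[OF assms(2), where n=1]) blast
  obtain C2 where C2: "C2 > 0" "\<And>s. \<bar>flat 2 s\<bar> \<le> C2 * flat 0 s powr \<theta>"
    by (rule flat_le_powr[OF assms(2), where n=2]) blast
  have le1: "flat 0 s powr \<theta> \<le> 1" for s
    using flat_0_bounds(1,2)[of s] assms by (intro powr_le1) auto
  have f1: "\<bar>flat 1 s\<bar> \<le> C1" for s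
    using C1(2)[of s] C1(1) mult_left_mono[OF le1[of s], of C1] by linarith
  have f2: "\<bar>flat 2 s\<bar> \<le> C2" for s
    using C2(2)[of s] C2(1) mult_left_mono[OF le1[of s], of C2] by linarith
  define A where "A = flat 0 (flat 0 1)"
  have A: "A > 0" using flat_0_flat_0_1 by (simp add: A_def)
  define C where "C = (C2 * C1\<^sup>2 + C1 * C2 + C1 * C1) * A powr \<theta> / A"
  define X where "X y = A powr \<theta> * step y powr \<theta>" for y
  have X: "X y \<ge> 0" for y by (simp add: X_def)
  have eq: "flat 0 (flat 0 1 - flat 0 y) powr \<theta> = X y" for y
  proof -
    have "flat 0 (flat 0 1 - flat 0 y) = A * step y" using A by (simp add: step_def A_def)
    then show ?thesis using A step_bounds(1)[of y] by (simp add: X_def powr_mult)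
  qed
  have a1: "\<bar>flat 1 (flat 0 1 - flat 0 y)\<bar> \<le> C1 * X y" and a2: "\<bar>flat 2 (flat 0 1 - flat 0 y)\<bar> \<le> C2 * X y" for y
    using C1(2)[of "flat 0 1 - flat 0 y"] C2(2)[of "flat 0 1 - flat 0 y"] by (simp_all only: eq)
  have Cpos: "0 < C1\<^sup>2" "0 < C1 * C2" "0 < C1 * C1" "0 < C2 * C1\<^sup>2" using C1 C2 by auto
  have "\<bar>step1 y\<bar> \<le> C * step y powr \<theta>" for y
  proof -
    have "\<bar>step1 y\<bar> = \<bar>flat 1 (flat 0 1 - flat 0 y)\<bar> * \<bar>flat 1 y\<bar> / A"
      using A by (simp add: step1_def A_def abs_mult)
    also have "\<dots> \<le> (C1 * X y) * C1 / A"
      using A X C1 by (intro divide_right_mono mult_mono a1 f1) auto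
    also have "\<dots> = (C1 * C1) * X y / A" by simp
    also have "\<dots> \<le> (C2 * C1\<^sup>2 + C1 * C2 + C1 * C1) * X y / A"
      using A X Cpos by (intro divide_right_mono mult_right_mono) auto
    finally show ?thesis by (simp add: C_def X_def)
  qed
  moreover have "\<bar>step2 y\<bar> \<le> C * step y powr \<theta>" for y
  proof -
    have "\<bar>flat 2 (flat 0 1 - flat 0 y) * (flat 1 y)\<^sup>2 - flat 1 (flat 0 1 - flat 0 y) * flat 2 y\<bar>
       \<le> \<bar>flat 2 (flat 0 1 - flat 0 y)\<bar> * \<bar>flat 1 y\<bar>\<^sup>2 + \<bar>flat 1 (flat 0 1 - flat 0 y)\<bar> * \<bar>flat 2 y\<bar>"
      by (rule order_trans[OF abs_triangle_ineq4]) (simp add: abs_mult)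
    also have "\<dots> \<le> (C2 * X y) * C1\<^sup>2 + (C1 * X y) * C2"
      using X C1(1) C2(1) by (intro add_mono mult_mono power_mono a1 a2 f1 f2) auto
    also have "\<dots> = (C2 * C1\<^sup>2 + C1 * C2) * X y" by (simp add: algebra_simps)
    also have "\<dots> \<le> (C2 * C1\<^sup>2 + C1 * C2 + C1 * C1) * X y"
      using X Cpos by (intro mult_right_mono) auto
    finally have "\<bar>step2 y\<bar> \<le> (C2 * C1\<^sup>2 + C1 * C2 + C1 * C1) * X y / A"
      using A unfolding step2_def A_def[symmetric] by (simp add: abs_mult divide_right_mono)
    then show ?thesis by (simp add: C_def X_def)
  qed
  moreover have "C > 0" using A Cpos by (auto simp: C_def intro!: divide_pos_pos mult_pos_pos add_pos_pos)
  ultimately show ?thesis using that by blast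
qed

section \<open>Radial profiles\<close>

text \<open>
  Radial profiles are functions of \<open>s = \<bar>x\<bar>\<^sup>2\<close>. The cutoff depends on \<open>ln \<bar>x\<bar>\<close> and decays between the
  radii \<open>R\<close> and \<open>R exp L\<close>, so its Laplacian is of order \<open>1 / (L \<bar>x\<bar>\<^sup>2)\<close>. The factor \<open>1/L\<close>
  is what settles the equality case of the stationary problem.
\<close>

definition cut :: "real \<Rightarrow> real \<Rightarrow> real \<Rightarrow> real" where
  "cut R L s = step ((ln s / 2 - ln R) / L)"

definition cut1 :: "real \<Rightarrow> real \<Rightarrow> real \<Rightarrow> real" where
  "cut1 R L s = step1 ((ln s / 2 - ln R) / L) / (2 * L * s)"

definition cut2 :: "real \<Rightarrow> real \<Rightarrow> real \<Rightarrow> real" where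
  "cut2 R L s = step2 ((ln s / 2 - ln R) / L) / (2 * L * s)\<^sup>2 - step1 ((ln s / 2 - ln R) / L) / (2 * L * s\<^sup>2)"

text \<open>
  The profile \<open>\<bar>x\<bar>\<^sup>q\<close> times the cutoff, with its first two derivatives with respect to
  \<open>s = \<bar>x\<bar>\<^sup>2\<close>.
\<close>

definition pcut :: "real \<Rightarrow> real \<Rightarrow> real \<Rightarrow> real \<Rightarrow> real" where
  "pcut q R L s = s powr (q/2) * cut R L s"

definition pcut1 :: "real \<Rightarrow> real \<Rightarrow> real \<Rightarrow> real \<Rightarrow> real" where
  "pcut1 q R L s = q/2 * s powr (q/2 - 1) * cut R L s + s powr (q/2) * cut1 R L s"

definition pcut2 :: "real \<Rightarrow> real \<Rightarrow> real \<Rightarrow> real \<Rightarrow> real" where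
  "pcut2 q R L s = q/2 * (q/2 - 1) * s powr (q/2 - 2) * cut R L s
     + q * s powr (q/2 - 1) * cut1 R L s + s powr (q/2) * cut2 R L s"

lemma cut_arg_deriv:
  "s > 0 \<Longrightarrow> L > 0 \<Longrightarrow> ((\<lambda>s. (ln s / 2 - ln R) / L) has_real_derivative 1 / (2 * L * s)) (at s)"
  by (auto intro!: derivative_eq_intros simp: field_simps)

lemma cut_deriv:
  assumes "s > 0" "L > 0" shows "(cut R L has_real_derivative cut1 R L s) (at s)"
  using DERIV_chain2[OF step_deriv cut_arg_deriv[OF assms, of R]]
  unfolding cut_def[abs_def] cut1_def by simp

lemma cut1_deriv:
  assumes "s > 0" "L > 0" shows "(cut1 R L has_real_derivative cut2 R L s) (at s)"
proof -
  let ?y = "(ln s / 2 - ln R) / L"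
  have "((\<lambda>s. 1 / (2 * L * s)) has_real_derivative - (1 / (2 * L * s\<^sup>2))) (at s)"
    using assms by (auto intro!: derivative_eq_intros simp: field_simps power2_eq_square)
  from DERIV_mult[OF DERIV_chain2[OF step1_deriv cut_arg_deriv[OF assms, of R]] this]
  have "((\<lambda>s. step1 ((ln s / 2 - ln R) / L) * (1 / (2 * L * s))) has_real_derivative
    step2 ?y * (1 / (2 * L * s)) * (1 / (2 * L * s)) + - (1 / (2 * L * s\<^sup>2)) * step1 ?y) (at s)" .
  then show ?thesis unfolding cut1_def[abs_def] cut2_def
    by (simp add: power2_eq_square)
qed

lemma powr_deriv: "s > 0 \<Longrightarrow> ((\<lambda>s. s powr a) has_real_derivative a * s powr (a - 1)) (at s)" for s :: real
  by (rule has_real_derivative_powr)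

lemma pcut_deriv:
  assumes "s > 0" "L > 0" shows "(pcut q R L has_real_derivative pcut1 q R L s) (at s)"
  using DERIV_mult[OF powr_deriv[OF assms(1), of "q/2"] cut_deriv[OF assms, of R]]
  unfolding pcut_def[abs_def] pcut1_def by (simp add: mult.commute)

lemma pcut1_deriv:
  assumes "s > 0" "L > 0" shows "(pcut1 q R L has_real_derivative pcut2 q R L s) (at s)"
proof -
  have "((\<lambda>s. q/2 * s powr (q/2 - 1) * cut R L s + s powr (q/2) * cut1 R L s) has_real_derivative
     (q/2 * ((q/2 - 1) * s powr (q/2 - 1 - 1))) * cut R L s + cut1 R L s * (q/2 * s powr (q/2 - 1))
      + ((q/2 * s powr (q/2 - 1)) * cut1 R L s + cut2 R L s * s powr (q/2))) (at s)"
    by (intro DERIV_add DERIV_mult DERIV_cmult powr_deriv cut_deriv cut1_deriv assms)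
  then show ?thesis unfolding pcut1_def[abs_def] pcut2_def
    by (rule DERIV_cong) (simp add: algebra_simps)
qed

lemma smooth_on_cut_arg: "smooth_on {0<..} (\<lambda>s. (ln s / 2 - ln R) / L)"
proof -
  have "smooth_on {0<..} (\<lambda>s. (ln s * (1/2) - ln R) * (1 / L))"
    by (intro smooth_on_mult smooth_on_diff smooth_on_const smooth_on_ln)
  then show ?thesis by simp
qed

lemma smooth_on_pcut: "smooth_on {0<..} (pcut q R L)"
  unfolding pcut_def[abs_def] cut_def[abs_def]
  by (intro smooth_on_mult smooth_on_powr smooth_on_compose_real[OF open_UNIV smooth_on_step]
    smooth_on_cut_arg subset_UNIV)

lemma measurable_step [measurable]: "step \<in> borel_measurable borel" "step1 \<in> borel_measurable borel"
  "step2 \<in> borel_measurable borel"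
  by (intro borel_measurable_continuous_onI continuous_on_step)+

lemma measurable_flat [measurable]: "flat n \<in> borel_measurable borel"
  by (intro borel_measurable_continuous_onI continuous_on_flat continuous_on_id)

lemma measurable_cut [measurable]: "cut R L \<in> borel_measurable borel" "cut1 R L \<in> borel_measurable borel"
  "cut2 R L \<in> borel_measurable borel"
  unfolding cut_def[abs_def] cut1_def[abs_def] cut2_def[abs_def] by measurable

lemma measurable_pcut [measurable]: "pcut q R L \<in> borel_measurable borel"
  "pcut1 q R L \<in> borel_measurable borel" "pcut2 q R L \<in> borel_measurable borel"
  unfolding pcut_def[abs_def] pcut1_def[abs_def] pcut2_def[abs_def] by measurable

lemma cut_bounds: "0 \<le> cut R L s" "cut R L s \<le> 1"
  using step_bounds by (auto simp: cut_def)

lemma cut_arg_sq: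
  fixes r R L :: real
  assumes "r > 0" "R > 0" "L > 0"
  shows "(ln (r\<^sup>2) / 2 - ln R) / L \<le> 0 \<longleftrightarrow> r \<le> R" "1 \<le> (ln (r\<^sup>2) / 2 - ln R) / L \<longleftrightarrow> R * exp L \<le> r"
proof -
  have 1: "ln (r\<^sup>2) / 2 = ln r" using assms by (simp add: ln_realpow)
  have 2: "ln R + L = ln (R * exp L)" using assms by (simp add: ln_mult)
  show "(ln (r\<^sup>2) / 2 - ln R) / L \<le> 0 \<longleftrightarrow> r \<le> R" using assms unfolding 1 by (simp add: field_simps)
  have "1 \<le> (ln (r\<^sup>2) / 2 - ln R) / L \<longleftrightarrow> ln R + L \<le> ln r" using assms unfolding 1 by (simp add: field_simps)
  also have "\<dots> \<longleftrightarrow> R * exp L \<le> r" unfolding 2 using assms by (intro ln_le_cancel_iff) auto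
  finally show "1 \<le> (ln (r\<^sup>2) / 2 - ln R) / L \<longleftrightarrow> R * exp L \<le> r" .
qed

lemma cut_inner:
  assumes "0 < r" "r \<le> R" "L > 0"
  shows "cut R L (r\<^sup>2) = 1" "cut1 R L (r\<^sup>2) = 0" "cut2 R L (r\<^sup>2) = 0"
  using assms cut_arg_sq(1)[of r R L] by (auto simp: cut_def cut1_def cut2_def step_left)

lemma cut_outer:
  assumes "0 < R" "R * exp L \<le> r" "L > 0"
  shows "cut R L (r\<^sup>2) = 0" "cut1 R L (r\<^sup>2) = 0" "cut2 R L (r\<^sup>2) = 0"
proof -
  have "0 < R * exp L" using assms by simp
  then have "r > 0" using assms by linarith
  then show "cut R L (r\<^sup>2) = 0" "cut1 R L (r\<^sup>2) = 0" "cut2 R L (r\<^sup>2) = 0"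
    using assms cut_arg_sq(2)[of r R L] by (auto simp: cut_def cut1_def cut2_def step_right)
qed

lemma pcut_outer:
  assumes "0 < R" "R * exp L \<le> r" "L > 0"
  shows "pcut q R L (r\<^sup>2) = 0" "pcut1 q R L (r\<^sup>2) = 0" "pcut2 q R L (r\<^sup>2) = 0"
  using cut_outer[OF assms] by (auto simp: pcut_def pcut1_def pcut2_def)

text \<open>
  The Laplacian at \<open>x\<close> of \<open>F (\<bar>x\<bar>\<^sup>2 + d)\<close> when \<open>F1\<close> and \<open>F2\<close> are the derivatives of \<open>F\<close>. A positive
  shift \<open>d\<close> makes the function smooth at the origin; \<open>d = 0\<close> is the limit case.
\<close>

definition radial_lap :: "(real \<Rightarrow> real) \<Rightarrow> (real \<Rightarrow> real) \<Rightarrow> real \<Rightarrow> real ^ 'n \<Rightarrow> real" where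
  "radial_lap F1 F2 d x = 4 * (norm x)\<^sup>2 * F2 ((norm x)\<^sup>2 + d) + 2 * real CARD('n) * F1 ((norm x)\<^sup>2 + d)"

text \<open>
  What remains of the Laplacian of \<open>\<bar>x\<bar>\<^sup>q\<close> times the cutoff after removal of
  \<open>q (q + N - 2) \<bar>x\<bar>\<close> to the power \<open>q - 2\<close>, times the cutoff: the terms that contain a derivative
  of the cutoff, as a function of \<open>r = \<bar>x\<bar>\<close>.
\<close>

definition pcut_err :: "nat \<Rightarrow> real \<Rightarrow> real \<Rightarrow> real \<Rightarrow> real \<Rightarrow> real" where
  "pcut_err N q R L r = r powr (q - 2) *
     ((2 * q + real N - 2) * step1 ((ln r - ln R) / L) / L + step2 ((ln r - ln R) / L) / L\<^sup>2)"

lemma radial_lap_pcut: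
  fixes x :: "real ^ 'n"
  assumes "x \<noteq> 0" "L > 0"
  shows "radial_lap (pcut1 q R L) (pcut2 q R L) 0 x
    = q * (q + real CARD('n) - 2) * norm x powr (q - 2) * cut R L ((norm x)\<^sup>2) + pcut_err CARD('n) q R L (norm x)"
proof -
  define r where "r = norm x"
  have r: "r > 0" using assms by (simp add: r_def)
  have p: "(r\<^sup>2) powr a = r powr (2 * a)" for a using r by (simp add: powr_powr flip: powr_numeral)
  have l: "ln (r\<^sup>2) / 2 = ln r" using r by (simp add: ln_realpow)
  define Y where "Y = r powr q"
  have e1: "r powr (q - 2) = Y / r^2" using r by (simp add: Y_def powr_diff)
  have e2: "r powr (2 * (q/2 - 2)) = Y / r^4"
  proof -
    have "2 * (q/2 - 2) = q - 4" by simp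
    then show ?thesis using r by (simp add: Y_def powr_diff)
  qed
  have e3: "r powr (2 * (q/2 - 1)) = Y / r^2"
  proof -
    have "2 * (q/2 - 1) = q - 2" by simp
    then show ?thesis using e1 by simp
  qed
  have e4: "r powr (2 * (q/2)) = Y" by (simp add: Y_def)
  define S1 where "S1 = step1 ((ln r - ln R) / L)"
  define S2 where "S2 = step2 ((ln r - ln R) / L)"
  define c where "c = cut R L (r\<^sup>2)"
  define N where "N = real CARD('n)"
  show ?thesis
    unfolding radial_lap_def pcut1_def pcut2_def pcut_err_def cut1_def cut2_def r_def[symmetric] add_0_right p l e1 e2 e3 e4
      S1_def[symmetric] S2_def[symmetric] c_def[symmetric] N_def[symmetric]
    using r assms(2) by (simp add: field_simps power2_eq_square power4_eq_xxxx)
qed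

lemma pcut_err_bound:
  assumes "0 \<le> \<theta>" "\<theta> < 1"
  obtains C where "C > 0" "\<And>R L r. R > 0 \<Longrightarrow> L \<ge> 1 \<Longrightarrow> r > 0 \<Longrightarrow>
    \<bar>pcut_err N q R L r\<bar> \<le> C / L * indicator {R..R * exp L} r * r powr (q - 2) * cut R L (r\<^sup>2) powr \<theta>"
proof -
  obtain C where C: "C > 0" "\<And>y. \<bar>step1 y\<bar> \<le> C * step y powr \<theta>" "\<And>y. \<bar>step2 y\<bar> \<le> C * step y powr \<theta>"
    by (rule step_deriv_le_powr[OF assms]) blast
  define D where "D = (\<bar>2 * q + real N - 2\<bar> + 1) * C"
  have "\<bar>pcut_err N q R L r\<bar> \<le> D / L * indicator {R..R * exp L} r * r powr (q - 2) * cut R L (r\<^sup>2) powr \<theta>"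
    if "R > 0" "L \<ge> 1" "r > 0" for R L r
  proof -
    define y where "y = (ln r - ln R) / L"
    have y: "y = (ln (r\<^sup>2) / 2 - ln R) / L" using that by (simp add: y_def ln_realpow)
    show ?thesis
    proof (cases "r \<in> {R..R * exp L}")
      case False
      then have "y \<le> 0 \<or> y \<ge> 1" unfolding y using that cut_arg_sq[of r R L] by auto
      then have "step1 y = 0" "step2 y = 0" using step_left step_right by auto
      then have "pcut_err N q R L r = 0"
        unfolding pcut_err_def y_def[symmetric] by simp
      then show ?thesis using False by simp
    next
      case True
      define K where "K = 2 * q + real N - 2"
      have "\<bar>K * step1 y / L + step2 y / L\<^sup>2\<bar> \<le> \<bar>K\<bar> * \<bar>step1 y\<bar> / L + \<bar>step2 y\<bar> / L\<^sup>2"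
        using that by (intro order_trans[OF abs_triangle_ineq]) (simp add: abs_mult)
      also have "\<dots> \<le> \<bar>K\<bar> * (C * step y powr \<theta>) / L + (C * step y powr \<theta>) / L"
        using that C(1) self_le_power[of L 2]
        by (intro add_mono divide_right_mono mult_left_mono C frac_le) auto
      also have "\<dots> = D / L * cut R L (r\<^sup>2) powr \<theta>"
        unfolding D_def cut_def y[symmetric] K_def[symmetric] by (simp add: algebra_simps add_divide_distrib)
      finally have *: "\<bar>K * step1 y / L + step2 y / L\<^sup>2\<bar> \<le> D / L * cut R L (r\<^sup>2) powr \<theta>" .
      have "\<bar>pcut_err N q R L r\<bar> = r powr (q-2) * \<bar>K * step1 y / L + step2 y / L\<^sup>2\<bar>"
        unfolding pcut_err_def y_def K_def by (simp add: abs_mult)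
      also have "\<dots> \<le> r powr (q-2) * (D / L * cut R L (r\<^sup>2) powr \<theta>)" by (intro mult_left_mono *) simp
      finally show ?thesis using True by (simp add: mult_ac)
    qed
  qed
  moreover have "D > 0" using C(1) by (simp add: D_def add_nonneg_pos)
  ultimately show ?thesis using that by blast
qed

section \<open>Integrals of products\<close>

lemma lborel_integral_product:
  fixes f :: "real \<Rightarrow> real" and g :: "'a::euclidean_space \<Rightarrow> real"
  assumes f: "integrable lborel f" and g: "integrable lborel g"
  shows "integrable lborel (\<lambda>z. f (fst z) * g (snd z))"
    and "(LINT z|lborel. f (fst z) * g (snd z)) = (LINT t|lborel. f t) * (LINT x|lborel. g x)"
proof -
  have [measurable]: "f \<in> borel_measurable borel" "g \<in> borel_measurable borel"
    using borel_measurable_integrable[OF f] borel_measurable_integrable[OF g] by simp_all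
  have "integrable (lborel \<Otimes>\<^sub>M lborel) (\<lambda>z. f (fst z) * g (snd z))"
  proof (rule lborel_pair.Fubini_integrable)
    show "(\<lambda>z. f (fst z) * g (snd z)) \<in> borel_measurable (lborel \<Otimes>\<^sub>M lborel)" by measurable
    have "(\<lambda>t. LINT x|lborel. norm (f (fst (t, x)) * g (snd (t, x)))) = (\<lambda>t. \<bar>f t\<bar> * (LINT x|lborel. \<bar>g x\<bar>))"
      by (simp add: abs_mult)
    then show "integrable lborel (\<lambda>t. LINT x|lborel. norm (f (fst (t, x)) * g (snd (t, x))))"
      using f by simp
    show "AE t in lborel. integrable lborel (\<lambda>x. f (fst (t, x)) * g (snd (t, x)))"
      using g by simp
  qed
  then show i: "integrable lborel (\<lambda>z. f (fst z) * g (snd z))" by (simp add: lborel_prod)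
  have "(LINT t|lborel. (LINT x|lborel. f t * g x)) = integral\<^sup>L (lborel \<Otimes>\<^sub>M lborel) (\<lambda>z. f (fst z) * g (snd z))"
    using lborel_pair.integral_fst'[of "\<lambda>z. f (fst z) * g (snd z)"] i by (simp add: lborel_prod)
  then show "(LINT z|lborel. f (fst z) * g (snd z)) = (LINT t|lborel. f t) * (LINT x|lborel. g x)"
    by (simp add: lborel_prod)
qed

lemma lebesgue_lborel_integral:
  fixes f :: "'a::euclidean_space \<Rightarrow> real"
  assumes "f \<in> borel_measurable borel"
  shows "integrable lebesgue f \<longleftrightarrow> integrable lborel f" "(LINT x|lebesgue. f x) = (LINT x|lborel. f x)"
  using assms by (simp_all add: integrable_completion integral_completion)

lemma borel_imp_lebesgue_measurable:
  fixes f :: "'a::euclidean_space \<Rightarrow> real"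
  shows "f \<in> borel_measurable borel \<Longrightarrow> f \<in> borel_measurable lebesgue"
  by (rule measurable_completion) simp

lemma integrable_powr_from_0:
  assumes "a > -1"
  shows "integrable lborel (\<lambda>t. indicator {0<..<c} t * t powr a :: real)"
proof (cases "c \<ge> 0")
  case True
  have "(\<lambda>t. t powr a) absolutely_integrable_on {0..c}"
    using True assms by (intro nonnegative_absolutely_integrable_1 integrable_on_powr_from_0) auto
  then have "set_integrable lebesgue {0<..<c} (\<lambda>t. t powr a)"
    by (rule set_integrable_subset) auto
  then have "integrable lebesgue (\<lambda>t. indicator {0<..<c} t * t powr a)"
    by (simp add: set_integrable_def)
  then show ?thesis by (subst (asm) lebesgue_lborel_integral) auto
next
  case False
  then have "(\<lambda>t. indicator {0<..<c} t * t powr a) = (\<lambda>t. 0)" by (auto simp: indicator_def)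
  then show ?thesis by simp
qed

lemma set_integrable_eqI:
  "set_integrable M A g \<Longrightarrow> (\<And>x. x \<in> A \<Longrightarrow> f x = g x) \<Longrightarrow> set_integrable M A f"
  by (subst set_integrable_cong[OF refl refl]) auto

lemma open_imp_lebesgue_set: "open S \<Longrightarrow> S \<in> sets lebesgue" for S :: "'a::euclidean_space set"
  using sets_completionI_sets[of S lborel] by (simp add: borel_open)

lemma set_integrable_mult_bounded:
  fixes g h :: "'a::euclidean_space \<Rightarrow> real"
  assumes g: "set_integrable lebesgue Q g" and h: "h \<in> borel_measurable borel"
    and B: "\<And>z. z \<in> Q \<Longrightarrow> \<bar>h z\<bar> \<le> B"
  shows "set_integrable lebesgue Q (\<lambda>z. h z * g z)"
  unfolding set_integrable_def
proof (rule Bochner_Integration.integrable_bound)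
  show "integrable lebesgue (\<lambda>z. B * (indicator Q z *\<^sub>R g z))"
    using g unfolding set_integrable_def by (rule integrable_mult_right)
  have "(\<lambda>z. indicator Q z *\<^sub>R g z) \<in> borel_measurable lebesgue"
    using g unfolding set_integrable_def by (rule borel_measurable_integrable)
  then have "(\<lambda>z. h z * (indicator Q z *\<^sub>R g z)) \<in> borel_measurable lebesgue"
    using borel_imp_lebesgue_measurable[OF h] by (intro borel_measurable_times)
  moreover have "(\<lambda>z. h z * (indicator Q z *\<^sub>R g z)) = (\<lambda>z. indicator Q z *\<^sub>R (h z * g z))" by auto
  ultimately show "(\<lambda>z. indicator Q z *\<^sub>R (h z * g z)) \<in> borel_measurable lebesgue" by simp
  show "AE z in lebesgue. norm (indicator Q z *\<^sub>R (h z * g z)) \<le> norm (B * (indicator Q z *\<^sub>R g z))"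
  proof (rule AE_I2)
    fix z
    show "norm (indicator Q z *\<^sub>R (h z * g z)) \<le> norm (B * (indicator Q z *\<^sub>R g z))"
    proof (cases "z \<in> Q")
      case True
      then show ?thesis using B[OF True] by (auto simp: abs_mult intro!: mult_right_mono)
    qed simp
  qed
qed

text \<open>
  The weights and the singular profiles are controlled only off the axis \<open>x = 0\<close>, which lies in a
  hyperplane.
\<close>

lemma AE_snd_nonzero: "AE z in lebesgue. snd (z :: real \<times> (real ^ 'n)) \<noteq> 0"
proof -
  define i where "i = (undefined :: 'n)"
  have "negligible {z :: real \<times> (real ^ 'n). (0, axis i 1) \<bullet> z = 0}"
    by (rule negligible_hyperplane) (simp add: prod_eq_iff)
  then have "{z :: real \<times> (real ^ 'n). (0, axis i 1) \<bullet> z = 0} \<in> null_sets lebesgue"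
    by (simp add: negligible_iff_null_sets)
  then show ?thesis
    by (rule AE_I') (auto simp: inner_prod_def)
qed

section \<open>Smooth radial test functions\<close>

lemma norm_sq_line:
  fixes x :: "real ^ 'n"
  shows "(norm (x + s *\<^sub>R axis i 1))\<^sup>2 = (norm x)\<^sup>2 + 2 * s * x $ i + s\<^sup>2"
  unfolding power2_norm_eq_inner
  by (simp add: inner_add_left inner_add_right inner_axis inner_axis' power2_eq_square algebra_simps)

lemma laplacian_radial:
  fixes x :: "real ^ 'n"
  assumes d: "d > 0"
    and F1: "\<And>s. s > 0 \<Longrightarrow> (F has_real_derivative F1 s) (at s)"
    and F2: "\<And>s. s > 0 \<Longrightarrow> (F1 has_real_derivative F2 s) (at s)"
  shows "laplacian (\<lambda>y. c * F ((norm y)\<^sup>2 + d)) x = c * radial_lap F1 F2 d x"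
proof -
  define S where "S = (norm x)\<^sup>2 + d"
  have 2: "(deriv ^^ 2) (\<lambda>s. c * F ((norm (x + s *\<^sub>R axis i 1))\<^sup>2 + d)) 0
     = c * (F2 S * (2 * x $ i) * (2 * x $ i) + 2 * F1 S)" for i
  proof -
    define g where "g s = (norm x)\<^sup>2 + 2 * s * x $ i + s\<^sup>2 + d" for s
    have gpos: "g s > 0" for s
      unfolding g_def norm_sq_line[symmetric] using d by (intro add_nonneg_pos) auto
    have g': "(g has_real_derivative (2 * x $ i + 2 * s)) (at s)" for s
      unfolding g_def[abs_def] by (auto intro!: derivative_eq_intros)
    have d1: "((\<lambda>s. c * F (g s)) has_real_derivative c * (F1 (g s) * (2 * x $ i + 2 * s))) (at s)" for s
      by (intro DERIV_cmult DERIV_chain2[OF F1[OF gpos] g'])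
    have e1: "deriv (\<lambda>s. c * F (g s)) = (\<lambda>s. c * (F1 (g s) * (2 * x $ i + 2 * s)))"
      by (rule ext) (rule DERIV_imp_deriv[OF d1])
    have "((\<lambda>s. 2 * x $ i + 2 * s) has_real_derivative 2) (at 0)"
      by (auto intro!: derivative_eq_intros)
    from DERIV_cmult[OF DERIV_mult[OF DERIV_chain2[OF F2[OF gpos] g'] this], of c]
    have d2: "((\<lambda>s. c * (F1 (g s) * (2 * x $ i + 2 * s))) has_real_derivative
       c * (F2 (g 0) * (2 * x $ i + 2 * 0) * (2 * x $ i + 2 * 0) + 2 * F1 (g 0))) (at 0)" .
    have "(\<lambda>s. c * F ((norm (x + s *\<^sub>R axis i 1))\<^sup>2 + d)) = (\<lambda>s. c * F (g s))"
      by (simp add: g_def norm_sq_line)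
    moreover have "g 0 = S" by (simp add: g_def S_def)
    ultimately show ?thesis using DERIV_imp_deriv[OF d2] by (simp add: numeral_2_eq_2 e1)
  qed
  have "laplacian (\<lambda>y. c * F ((norm y)\<^sup>2 + d)) x = (\<Sum>i\<in>UNIV. c * (F2 S * (2 * x $ i) * (2 * x $ i) + 2 * F1 S))"
    unfolding laplacian_def by (intro sum.cong refl 2)
  also have "\<dots> = c * (4 * F2 S * (\<Sum>i\<in>UNIV. x $ i * x $ i) + 2 * real CARD('n) * F1 S)"
    by (simp add: sum_distrib_left sum.distrib algebra_simps)
  also have "(\<Sum>i\<in>UNIV. x $ i * x $ i) = (norm x)\<^sup>2"
    unfolding power2_norm_eq_inner inner_vec_def by simp
  finally show ?thesis by (simp add: radial_lap_def S_def mult_ac)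
qed

lemma smooth_on_norm_sq: "smooth_on UNIV (\<lambda>x :: real ^ 'n. (norm x)\<^sup>2 + d)"
proof -
  have "smooth_on UNIV (\<lambda>x :: real ^ 'n. (\<Sum>i\<in>UNIV. x $ i * x $ i) + d)"
    by (intro smooth_on_add smooth_on_sum smooth_on_mult smooth_on_const smooth_on_linear
        bounded_linear_vec_nth)
  then show ?thesis
    unfolding power2_norm_eq_inner inner_vec_def by simp
qed

text \<open>
  The time factors of the test functions, smooth on the whole line. A factor need not vanish at time 0,
  since test functions are allowed to charge the initial datum.
\<close>

definition time_profile :: "(real \<Rightarrow> real) \<Rightarrow> (real \<Rightarrow> real) \<Rightarrow> real \<Rightarrow> bool" where
  "time_profile a a' T \<longleftrightarrow> T > 0 \<and> smooth_on UNIV a \<and> (\<forall>t. (a has_real_derivative a' t) (at t)) \<and>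
     continuous_on UNIV a' \<and> (\<forall>t\<ge>T. a t = 0 \<and> a' t = 0)"

lemma test_function_radial:
  assumes a: "smooth_on UNIV a" "\<And>t. t \<ge> T \<Longrightarrow> a t = 0"
    and F: "smooth_on {0<..} F" "\<And>s. s \<ge> S \<Longrightarrow> F s = 0" and d: "d > 0"
  shows "test_function (\<lambda>z. a (fst z) * F ((norm (snd z :: real ^ 'n))\<^sup>2 + d))"
  unfolding test_function_def
proof
  have "smooth_on UNIV (\<lambda>x :: real ^ 'n. F ((norm x)\<^sup>2 + d))"
    by (rule smooth_on_compose_real[OF open_greaterThan F(1) smooth_on_norm_sq])
       (use d in \<open>auto intro!: add_nonneg_pos\<close>)
  from smooth_on_compose_snd[OF this]
  show "smooth_on ({0..} \<times> UNIV) (\<lambda>z. a (fst z) * F ((norm (snd z :: real ^ 'n))\<^sup>2 + d))"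
    by (intro smooth_on_mult smooth_on_compose_fst[OF a(1)])
  define K where "K = {0..T} \<times> cball (0 :: real ^ 'n) (sqrt \<bar>S\<bar>)"
  have "compact K" unfolding K_def by (intro compact_Times) auto
  moreover have "K \<subseteq> {0..} \<times> UNIV" by (auto simp: K_def)
  moreover have "a (fst z) * F ((norm (snd z))\<^sup>2 + d) = 0" if "z \<in> {0..} \<times> UNIV - K" for z
  proof -
    from that have "T \<le> fst z \<or> sqrt \<bar>S\<bar> \<le> norm (snd z)" by (auto simp: K_def)
    then show ?thesis
    proof
      assume "sqrt \<bar>S\<bar> \<le> norm (snd z)"
      then have "(sqrt \<bar>S\<bar>)\<^sup>2 \<le> (norm (snd z))\<^sup>2" by (intro power_mono) auto
      then have "S \<le> (norm (snd z))\<^sup>2 + d" using d by simp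
      then show ?thesis using F(2) by simp
    qed (use a(2) in simp)
  qed
  ultimately show "\<exists>K. compact K \<and> K \<subseteq> {0..} \<times> (UNIV :: (real ^ 'n) set) \<and>
     (\<forall>z\<in>{0..} \<times> UNIV - K. a (fst z) * F ((norm (snd z))\<^sup>2 + d) = 0)" by blast
qed

section \<open>Integrability up to the initial time\<close>

text \<open>
  A fixed solution, whose existence is to be refuted. The parameter \<open>dimn\<close> is the space dimension as a
  real number, since it only enters through exponents.
\<close>

locale weak_solution =
  fixes \<sigma>\<^sub>1 \<sigma>\<^sub>2 p \<rho> :: real and w u\<^sub>0 :: "real ^ 'n \<Rightarrow> real" and u :: "real \<times> (real ^ 'n) \<Rightarrow> real"
    and dimn :: real
  assumes dimn: "dimn = real CARD('n)" and sol: "weak_global_solution \<sigma>\<^sub>1 \<sigma>\<^sub>2 p \<rho> w u\<^sub>0 u"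
    and \<sigma>\<^sub>1: "\<sigma>\<^sub>1 > -2" and p: "p > 1" and \<rho>: "\<rho> > -1" and dim: "CARD('n) \<ge> 2"
    and w_cont: "continuous_on UNIV w" and w_int: "integrable lebesgue w"
begin

abbreviation half_space :: "(real \<times> (real ^ 'n)) set" where
  "half_space \<equiv> {0<..} \<times> UNIV"

abbreviation source :: "real \<times> (real ^ 'n) \<Rightarrow> real" where
  "source z \<equiv> norm (snd z) powr \<sigma>\<^sub>2 * \<bar>u z\<bar> powr p + fst z powr \<rho> * w (snd z)"

text \<open>
  The weak identity for a pair of a test function \<open>\<psi>\<close> and its image \<open>L\<close> under the formal adjoint
  \<open>- \<bar>x\<bar>\<^sup>\<sigma> \<partial>\<^sub>t - \<Delta>\<close>, \<open>\<sigma> = \<sigma>\<^sub>1\<close>. Keeping \<open>L\<close> as a separate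
  argument allows pairs that are only limits of smooth ones, and makes linear combinations immediate.
\<close>

definition weak_test :: "(real \<times> (real ^ 'n) \<Rightarrow> real) \<Rightarrow> (real \<times> (real ^ 'n) \<Rightarrow> real) \<Rightarrow> bool" where
  "weak_test \<psi> L \<longleftrightarrow>
     set_integrable lebesgue half_space (\<lambda>z. L z * u z) \<and>
     integrable lebesgue (\<lambda>x. norm x powr \<sigma>\<^sub>1 * u\<^sub>0 x * \<psi> (0, x)) \<and>
     set_integrable lebesgue half_space (\<lambda>z. source z * \<psi> z) \<and>
     (LINT z:half_space|lebesgue. L z * u z) =
       (LINT x|lebesgue. norm x powr \<sigma>\<^sub>1 * u\<^sub>0 x * \<psi> (0, x)) + (LINT z:half_space|lebesgue. source z * \<psi> z)"

abbreviation adjoint :: "(real \<Rightarrow> real) \<Rightarrow> (real \<Rightarrow> real) \<Rightarrow> (real \<Rightarrow> real) \<Rightarrow> (real \<Rightarrow> real) \<Rightarrow> (real \<Rightarrow> real) \<Rightarrow> real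
    \<Rightarrow> real \<times> (real ^ 'n) \<Rightarrow> real" where
  "adjoint a a' F F1 F2 d z \<equiv> - (norm (snd z) powr \<sigma>\<^sub>1) * (a' (fst z) * F ((norm (snd z))\<^sup>2 + d))
     - a (fst z) * radial_lap F1 F2 d (snd z)"

lemma half_space_sets [measurable, simp]: "half_space \<in> sets lebesgue"
  by (intro open_imp_lebesgue_set open_Times) auto

lemma weak_test_smooth:
  assumes a: "time_profile a a' T"
    and F: "smooth_on {0<..} F" "\<And>s. s \<ge> S \<Longrightarrow> F s = 0" and d: "d > 0"
    and F1: "\<And>s. s > 0 \<Longrightarrow> (F has_real_derivative F1 s) (at s)"
    and F2: "\<And>s. s > 0 \<Longrightarrow> (F1 has_real_derivative F2 s) (at s)"
  shows "weak_test (\<lambda>z. a (fst z) * F ((norm (snd z))\<^sup>2 + d)) (adjoint a a' F F1 F2 d)"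
proof -
  let ?\<psi> = "\<lambda>z :: real \<times> (real ^ 'n). a (fst z) * F ((norm (snd z))\<^sup>2 + d)"
  have "test_function ?\<psi>"
    using a by (intro test_function_radial[of a T F S] F d) (auto simp: time_profile_def)
  note * = sol[unfolded weak_global_solution_def Let_def, THEN conjunct2, THEN conjunct2, THEN conjunct2,
      THEN conjunct2, rule_format, OF this]
  have td: "time_deriv ?\<psi> t x = a' t * F ((norm x)\<^sup>2 + d)" for t x
  proof -
    have "((\<lambda>s. a s * F ((norm x)\<^sup>2 + d)) has_real_derivative a' t * F ((norm x)\<^sup>2 + d)) (at t)"
      using a by (intro DERIV_cmult_right) (simp add: time_profile_def)
    then show ?thesis unfolding time_deriv_def by (simp add: DERIV_imp_deriv)
  qed
  have lp: "laplacian (\<lambda>y. ?\<psi> (t, y)) x = a t * radial_lap F1 F2 d x" for t x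
    using laplacian_radial[OF d F1 F2, of "a t" x] by simp
  have 1: "(\<lambda>(t, x). (- (norm x powr \<sigma>\<^sub>1) * time_deriv ?\<psi> t x - laplacian (\<lambda>y. ?\<psi> (t, y)) x) * u (t, x))
    = (\<lambda>z. adjoint a a' F F1 F2 d z * u z)"
    unfolding td lp by (auto simp: fun_eq_iff)
  have 2: "(\<lambda>(t, x). (norm x powr \<sigma>\<^sub>2 * \<bar>u (t, x)\<bar> powr p + t powr \<rho> * w x) * ?\<psi> (t, x))
    = (\<lambda>z. source z * ?\<psi> z)" by (auto simp: fun_eq_iff)
  show ?thesis
    unfolding weak_test_def using *[unfolded 1 2] by blast
qed

lemma w_borel [measurable]: "w \<in> borel_measurable borel"
  using w_cont by (rule borel_measurable_continuous_onI)

lemma w_lborel: "integrable lborel w"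
  using w_int w_borel lebesgue_lborel_integral(1) by blast

definition cylinder :: "real \<Rightarrow> real \<Rightarrow> (real \<times> (real ^ 'n)) set" where
  "cylinder \<tau> r = {0<..<\<tau>} \<times> ball 0 r"

lemma cylinder_sets [measurable, simp]: "cylinder \<tau> r \<in> sets lebesgue"
  unfolding cylinder_def by (intro open_imp_lebesgue_set open_Times) auto

lemma cylinder_subset: "cylinder \<tau> r \<subseteq> half_space"
  unfolding cylinder_def by auto

lemma time_profile_flat:
  assumes "T > 0"
  shows "time_profile (\<lambda>t. flat 0 (1 - t / T)) (\<lambda>t. - (flat 1 (1 - t / T) / T)) T"
proof -
  have 1: "smooth_on UNIV (\<lambda>t. flat 0 (1 - t * (1 / T)))"
    by (intro smooth_on_compose_real[OF open_UNIV smooth_on_flat] smooth_on_diff smooth_on_mult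
        smooth_on_const smooth_on_ident_real subset_UNIV)
  have 2: "((\<lambda>t. 1 - t / T) has_real_derivative - (1 / T)) (at t)" for t
    using assms by (auto intro!: derivative_eq_intros)
  have 3: "((\<lambda>t. flat 0 (1 - t / T)) has_real_derivative flat 1 (1 - t / T) * - (1 / T)) (at t)" for t
    by (rule DERIV_chain2[OF flat_deriv_01(1) 2])
  have 4: "continuous_on UNIV (\<lambda>t. - (flat 1 (1 - t / T) / T))"
    using assms by (intro continuous_intros) auto
  show ?thesis
    unfolding time_profile_def using assms 1 3 4 by (auto simp: field_simps)
qed

text \<open>
  The time weight is integrable at 0 because \<open>\<rho> > -1\<close>.
\<close>

lemma integrable_time_source: "set_integrable lebesgue (cylinder \<tau> r) (\<lambda>z. fst z powr \<rho> * w (snd z))"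
proof -
  have "integrable lborel (\<lambda>z. (indicator {0<..<\<tau>} (fst z) * fst z powr \<rho>) * w (snd z))"
    by (intro lborel_integral_product integrable_powr_from_0 \<rho> w_lborel)
  then have "integrable lebesgue (\<lambda>z. (indicator {0<..<\<tau>} (fst z) * fst z powr \<rho>) * w (snd z))"
    by (subst lebesgue_lborel_integral) (auto simp: w_borel)
  then have "set_integrable lebesgue UNIV (\<lambda>z. (indicator {0<..<\<tau>} (fst z) * fst z powr \<rho>) * w (snd z))"
    by (simp add: set_integrable_def)
  then have "set_integrable lebesgue (cylinder \<tau> r) (\<lambda>z. (indicator {0<..<\<tau>} (fst z) * fst z powr \<rho>) * w (snd z))"
    by (rule set_integrable_subset) auto
  then show ?thesis
    by (rule set_integrable_eqI) (auto simp: cylinder_def)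
qed

context
  fixes \<tau> r :: real
  assumes \<tau>: "\<tau> > 0" and r: "r > 0"
begin

private abbreviation "a \<equiv> (\<lambda>t. flat 0 (1 - t / (2 * \<tau>)))"
private abbreviation "a' \<equiv> (\<lambda>t. - (flat 1 (1 - t / (2 * \<tau>)) / (2 * \<tau>)))"
private abbreviation "S \<equiv> ((r + 1) * exp 1)\<^sup>2"

lemma time_profile_a: "time_profile a a' (2 * \<tau>)"
  using time_profile_flat[of "2 * \<tau>"] \<tau> by simp

lemma pcut_vanishes: "s \<ge> S \<Longrightarrow> pcut q (r + 1) 1 s = 0"
  using pcut_outer(1)[of "r + 1" 1 "sqrt s" q] r
  by (metis (no_types, lifting) add_pos_pos less_numeral_extra(1) order_trans real_sqrt_pow2
      real_le_rsqrt zero_le_power2)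

lemma cut_on_ball:
  assumes "norm (x :: real ^ 'n) < r"
  shows "cut (r + 1) 1 ((norm x)\<^sup>2 + 1) = 1" "cut1 (r + 1) 1 ((norm x)\<^sup>2 + 1) = 0"
    "cut2 (r + 1) 1 ((norm x)\<^sup>2 + 1) = 0"
proof -
  define y where "y = sqrt ((norm x)\<^sup>2 + 1)"
  have pos: "(norm x)\<^sup>2 + 1 > 0" by (intro add_nonneg_pos) auto
  have y2: "y\<^sup>2 = (norm x)\<^sup>2 + 1" using pos by (simp add: y_def)
  have y0: "y > 0" using pos by (simp add: y_def)
  have "y\<^sup>2 \<le> (norm x + 1)\<^sup>2" unfolding y2 by (simp add: power2_eq_square algebra_simps)
  then have "y \<le> norm x + 1" by (rule power2_le_imp_le) simp
  then have "y \<le> r + 1" using assms by simp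
  from cut_inner[OF y0 this] show "cut (r + 1) 1 ((norm x)\<^sup>2 + 1) = 1"
    "cut1 (r + 1) 1 ((norm x)\<^sup>2 + 1) = 0" "cut2 (r + 1) 1 ((norm x)\<^sup>2 + 1) = 0"
    unfolding y2 by simp_all
qed

lemma flat_lower:
  assumes "1/2 \<le> s" "s \<le> 1"
  shows "exp (-2) \<le> flat 0 s" "exp (-2) \<le> flat 1 s"
proof -
  have "1 / s \<le> 2" "1 \<le> 1 / s" using assms by (auto simp: field_simps)
  then have "exp (-2) \<le> exp (-(1/s))" by simp
  moreover from \<open>1 \<le> 1 / s\<close> have "1 * exp (-(1/s)) \<le> (1/s)\<^sup>2 * exp (-(1/s))"
    by (intro mult_right_mono one_le_power) auto
  moreover have "flat 0 s = exp (-(1/s))" and f1: "flat 1 s = (1/s)\<^sup>2 * exp (-(1/s))"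
    using assms by (auto simp: flat_def pderiv_1 power2_eq_square)
  ultimately show "exp (-2) \<le> flat 0 s" "exp (-2) \<le> flat 1 s" unfolding f1 by linarith+
qed

lemma a_lower:
  assumes "z \<in> cylinder \<tau> r"
  shows "exp (-2) \<le> a (fst z)" "exp (-2) \<le> flat 1 (1 - fst z / (2 * \<tau>))"
proof -
  have "0 < fst z" "fst z < \<tau>" using assms by (auto simp: cylinder_def)
  then have "1/2 \<le> 1 - fst z / (2 * \<tau>)" "1 - fst z / (2 * \<tau>) \<le> 1" using \<tau> by (auto simp: field_simps)
  then show "exp (-2) \<le> a (fst z)" "exp (-2) \<le> flat 1 (1 - fst z / (2 * \<tau>))" using flat_lower by blast+
qed

lemma weak_test_pcut:
  "weak_test (\<lambda>z. a (fst z) * pcut q (r + 1) 1 ((norm (snd z))\<^sup>2 + 1))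
     (adjoint a a' (pcut q (r + 1) 1) (pcut1 q (r + 1) 1) (pcut2 q (r + 1) 1) 1)"
  by (rule weak_test_smooth[OF time_profile_a smooth_on_pcut pcut_vanishes _ pcut_deriv pcut1_deriv]) auto

lemma pcut_0_on_ball:
  assumes "norm (x :: real ^ 'n) < r"
  shows "pcut 0 (r + 1) 1 ((norm x)\<^sup>2 + 1) = 1"
    "radial_lap (pcut1 0 (r + 1) 1) (pcut2 0 (r + 1) 1) 1 x = 0"
proof -
  have pos: "(norm x)\<^sup>2 + 1 \<noteq> 0" using zero_le_power2[of "norm x"] by linarith
  then show "pcut 0 (r + 1) 1 ((norm x)\<^sup>2 + 1) = 1"
    "radial_lap (pcut1 0 (r + 1) 1) (pcut2 0 (r + 1) 1) 1 x = 0"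
    using cut_on_ball[OF assms] by (simp_all add: pcut_def radial_lap_def pcut1_def pcut2_def)
qed

lemma pcut_2_on_ball:
  assumes "norm (x :: real ^ 'n) < r"
  shows "pcut 2 (r + 1) 1 ((norm x)\<^sup>2 + 1) = (norm x)\<^sup>2 + 1"
    "radial_lap (pcut1 2 (r + 1) 1) (pcut2 2 (r + 1) 1) 1 x = 2 * real CARD('n)"
proof -
  have pos: "(norm x)\<^sup>2 + 1 > 0" by (intro add_nonneg_pos) auto
  then show "pcut 2 (r + 1) 1 ((norm x)\<^sup>2 + 1) = (norm x)\<^sup>2 + 1"
    "radial_lap (pcut1 2 (r + 1) 1) (pcut2 2 (r + 1) 1) 1 x = 2 * real CARD('n)"
    using cut_on_ball[OF assms] by (simp_all add: pcut_def radial_lap_def pcut1_def pcut2_def)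
qed

text \<open>
  The definition of a solution asks for local integrability at positive times only. Up to time 0 it is
  recovered from the integrability that the weak identity includes: on the cylinder the test function
  depends on time alone, so its adjoint is \<open>- \<bar>x\<bar>\<^sup>\<sigma> a'\<close> with \<open>\<sigma> = \<sigma>\<^sub>1\<close>, and \<open>a'\<close> is
  bounded away from 0.
\<close>

lemma integrable_weighted_u: "set_integrable lebesgue (cylinder \<tau> r) (\<lambda>z. norm (snd z) powr \<sigma>\<^sub>1 * u z)"
proof -
  let ?L = "adjoint a a' (pcut 0 (r + 1) 1) (pcut1 0 (r + 1) 1) (pcut2 0 (r + 1) 1) 1"
  define h where "h z = 2 * \<tau> / flat 1 (1 - fst z / (2 * \<tau>))" for z :: "real \<times> (real ^ 'n)"
  have "set_integrable lebesgue half_space (\<lambda>z. ?L z * u z)"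
    using weak_test_pcut[of 0] unfolding weak_test_def by blast
  then have "set_integrable lebesgue (cylinder \<tau> r) (\<lambda>z. ?L z * u z)"
    by (rule set_integrable_subset) (auto simp: cylinder_subset)
  then have "set_integrable lebesgue (cylinder \<tau> r) (\<lambda>z. h z * (?L z * u z))"
  proof (rule set_integrable_mult_bounded)
    show "h \<in> borel_measurable borel" unfolding h_def[abs_def] borel_prod[symmetric] by measurable
    show "\<bar>h z\<bar> \<le> 2 * \<tau> / exp (-2)" if "z \<in> cylinder \<tau> r" for z
    proof -
      have "0 < flat 1 (1 - fst z / (2 * \<tau>))" using a_lower(2)[OF that] by (rule less_le_trans[rotated]) simp
      then show ?thesis using a_lower(2)[OF that] \<tau> unfolding h_def abs_divide
        by (intro frac_le) auto
    qed
  qed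
  then show ?thesis
  proof (rule set_integrable_eqI)
    fix z assume z: "z \<in> cylinder \<tau> r"
    then have "norm (snd z) < r" by (auto simp: cylinder_def)
    then show "norm (snd z) powr \<sigma>\<^sub>1 * u z = h z * (?L z * u z)"
      using \<tau> less_le_trans[OF exp_gt_zero a_lower(2)[OF z]] by (simp add: pcut_0_on_ball h_def)
  qed
qed

text \<open>
  Here the spatial factor is \<open>\<bar>x\<bar>\<^sup>2 + 1\<close> on the cylinder, whose Laplacian is the constant \<open>2 N\<close>; the
  time derivative contributes a bounded multiple of the weighted solution, which is already known to be
  integrable.
\<close>

lemma integrable_u: "set_integrable lebesgue (cylinder \<tau> r) u"
proof -
  let ?L = "adjoint a a' (pcut 2 (r + 1) 1) (pcut1 2 (r + 1) 1) (pcut2 2 (r + 1) 1) 1"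
  define N where "N = 2 * real CARD('n)"
  have N: "N > 0" using dim by (simp add: N_def)
  define h where "h z = - (1 / (N * a (fst z)))" for z :: "real \<times> (real ^ 'n)"
  define k where "k z = flat 1 (1 - fst z / (2 * \<tau>)) / (2 * \<tau>) * ((norm (snd z))\<^sup>2 + 1) / (N * a (fst z))"
    for z :: "real \<times> (real ^ 'n)"
  have [measurable]: "h \<in> borel_measurable borel" "k \<in> borel_measurable borel"
    unfolding h_def[abs_def] k_def[abs_def] borel_prod[symmetric] by measurable
  have apos: "a (fst z) > 0" if "z \<in> cylinder \<tau> r" for z
    using less_le_trans[OF exp_gt_zero a_lower(1)[OF that]] .
  obtain C where C: "C > 0" "\<And>s. \<bar>flat 1 s\<bar> \<le> C * flat 0 s powr 0"
    by (rule flat_le_powr[of 0 1]) auto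
  have f1: "\<bar>flat 1 s\<bar> \<le> C" for s
    using C(2)[of s] C(1) by (cases "flat 0 s = 0") auto
  have "set_integrable lebesgue half_space (\<lambda>z. ?L z * u z)"
    using weak_test_pcut[of 2] unfolding weak_test_def by blast
  then have "set_integrable lebesgue (cylinder \<tau> r) (\<lambda>z. ?L z * u z)"
    by (rule set_integrable_subset) (auto simp: cylinder_subset)
  then have 1: "set_integrable lebesgue (cylinder \<tau> r) (\<lambda>z. h z * (?L z * u z))"
  proof (rule set_integrable_mult_bounded)
    show "\<bar>h z\<bar> \<le> 1 / (N * exp (-2))" if "z \<in> cylinder \<tau> r" for z
      using a_lower(1)[OF that] N apos[OF that] unfolding h_def
      by (simp add: abs_mult) (intro frac_le mult_left_mono; auto)
  qed measurable
  have 2: "set_integrable lebesgue (cylinder \<tau> r) (\<lambda>z. k z * (norm (snd z) powr \<sigma>\<^sub>1 * u z))"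
  proof (rule set_integrable_mult_bounded[OF integrable_weighted_u])
    show "\<bar>k z\<bar> \<le> C / (2 * \<tau>) * (r\<^sup>2 + 1) / (N * exp (-2))" if "z \<in> cylinder \<tau> r" for z
    proof -
      have nr: "(norm (snd z))\<^sup>2 \<le> r\<^sup>2" using that by (intro power_mono) (auto simp: cylinder_def)
      have "\<bar>k z\<bar> = \<bar>flat 1 (1 - fst z / (2 * \<tau>))\<bar> / (2 * \<tau>) * ((norm (snd z))\<^sup>2 + 1) / (N * a (fst z))"
        using \<tau> N apos[OF that] by (simp add: k_def abs_mult)
      also have "\<dots> \<le> C / (2 * \<tau>) * (r\<^sup>2 + 1) / (N * exp (-2))"
        using \<tau> N C(1) nr by (intro frac_le mult_mono divide_right_mono f1 mult_left_mono a_lower(1)[OF that]) auto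
      finally show ?thesis .
    qed
  qed measurable
  have "u z = h z * (?L z * u z) + k z * (norm (snd z) powr \<sigma>\<^sub>1 * u z)" if z: "z \<in> cylinder \<tau> r" for z
  proof -
    define A where "A = a (fst z)"
    define X where "X = norm (snd z) powr \<sigma>\<^sub>1"
    define b where "b = flat 1 (1 - fst z / (2 * \<tau>)) / (2 * \<tau>)"
    define y where "y = (norm (snd z))\<^sup>2 + 1"
    have n: "norm (snd z) < r" using z by (auto simp: cylinder_def)
    have L: "?L z = X * b * y - A * N"
      by (simp add: pcut_2_on_ball[OF n] N_def A_def X_def b_def y_def)
    have hk: "h z = - (1 / (N * A))" "k z = b * y / (N * A)"
      by (simp_all add: h_def k_def A_def b_def y_def)
    have "A > 0" using apos[OF z] by (simp add: A_def)
    then show ?thesis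
      unfolding L hk using N by (simp add: X_def[symmetric] field_simps)
  qed
  moreover have "set_integrable lebesgue (cylinder \<tau> r)
     (\<lambda>z. h z * (?L z * u z) + k z * (norm (snd z) powr \<sigma>\<^sub>1 * u z))"
    by (intro set_integral_add(1) 1 2)
  ultimately show ?thesis by (rule set_integrable_eqI[rotated])
qed

text \<open>
  The weak identity only gives integrability of the whole source; the given part \<open>t\<^sup>\<rho> w\<close> is integrable
  by itself and is subtracted.
\<close>

lemma integrable_nonlinearity:
  "set_integrable lebesgue (cylinder \<tau> r) (\<lambda>z. norm (snd z) powr \<sigma>\<^sub>2 * \<bar>u z\<bar> powr p)"
proof -
  define h where "h z = 1 / a (fst z)" for z :: "real \<times> (real ^ 'n)"
  let ?\<psi> = "\<lambda>z. a (fst z) * pcut 0 (r + 1) 1 ((norm (snd z))\<^sup>2 + 1)"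
  have apos: "a (fst z) > 0" if "z \<in> cylinder \<tau> r" for z
    using less_le_trans[OF exp_gt_zero a_lower(1)[OF that]] .
  have "set_integrable lebesgue half_space (\<lambda>z. source z * ?\<psi> z)"
    using weak_test_pcut[of 0] unfolding weak_test_def by blast
  then have "set_integrable lebesgue (cylinder \<tau> r) (\<lambda>z. source z * ?\<psi> z)"
    by (rule set_integrable_subset) (auto simp: cylinder_subset)
  then have "set_integrable lebesgue (cylinder \<tau> r) (\<lambda>z. h z * (source z * ?\<psi> z))"
  proof (rule set_integrable_mult_bounded)
    show "h \<in> borel_measurable borel" unfolding h_def[abs_def] borel_prod[symmetric] by measurable
    show "\<bar>h z\<bar> \<le> 1 / exp (-2)" if "z \<in> cylinder \<tau> r" for z
      using a_lower(1)[OF that] apos[OF that] unfolding h_def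
      by (simp only: abs_divide) (intro frac_le; auto)
  qed
  then have "set_integrable lebesgue (cylinder \<tau> r)
    (\<lambda>z. h z * (source z * ?\<psi> z) + (- 1) * (fst z powr \<rho> * w (snd z)))"
    by (intro set_integral_add(1) set_integrable_mult_right integrable_time_source)
  moreover have "norm (snd z) powr \<sigma>\<^sub>2 * \<bar>u z\<bar> powr p
      = h z * (source z * ?\<psi> z) + (- 1) * (fst z powr \<rho> * w (snd z))" if z: "z \<in> cylinder \<tau> r" for z
  proof -
    have n: "norm (snd z) < r" using z by (auto simp: cylinder_def)
    show ?thesis using apos[OF z] by (simp add: pcut_0_on_ball[OF n] h_def)
  qed
  ultimately show ?thesis by (rule set_integrable_eqI)
qed

lemma integrable_initial: "set_integrable lebesgue (ball 0 r) (\<lambda>x. norm x powr \<sigma>\<^sub>1 * u\<^sub>0 x)"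
proof -
  let ?\<psi> = "\<lambda>z. a (fst z) * pcut 0 (r + 1) 1 ((norm (snd z))\<^sup>2 + 1)"
  have "integrable lebesgue (\<lambda>x. norm x powr \<sigma>\<^sub>1 * u\<^sub>0 x * ?\<psi> (0, x))"
    using weak_test_pcut[of 0] unfolding weak_test_def by blast
  then have "set_integrable lebesgue UNIV (\<lambda>x. norm x powr \<sigma>\<^sub>1 * u\<^sub>0 x * ?\<psi> (0, x))"
    by (simp add: set_integrable_def)
  then have "set_integrable lebesgue (ball 0 r) (\<lambda>x. norm x powr \<sigma>\<^sub>1 * u\<^sub>0 x * ?\<psi> (0, x))"
    by (rule set_integrable_subset) auto
  then have "set_integrable lebesgue (ball 0 r) (\<lambda>x. exp 1 * (norm x powr \<sigma>\<^sub>1 * u\<^sub>0 x * ?\<psi> (0, x)))"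
    by (intro set_integrable_mult_right)
  moreover have "norm x powr \<sigma>\<^sub>1 * u\<^sub>0 x = exp 1 * (norm x powr \<sigma>\<^sub>1 * u\<^sub>0 x * ?\<psi> (0, x))"
    if "x \<in> ball 0 r" for x
    using that by (simp add: pcut_0_on_ball flat_0 exp_minus)
  ultimately show ?thesis by (rule set_integrable_eqI)
qed

end

end

section \<open>The weak identity for singular radial profiles\<close>

text \<open>
  The bounds say that \<open>F (\<bar>x\<bar>\<^sup>2 + d)\<close> has a Laplacian of order \<open>1 + \<bar>x\<bar>\<^sup>\<sigma>\<close> uniformly in \<open>d\<close>.
  That is exactly the weight against which a solution is known to be integrable.
\<close>

definition radial_profile :: "real \<Rightarrow> (real \<Rightarrow> real) \<Rightarrow> (real \<Rightarrow> real) \<Rightarrow> (real \<Rightarrow> real) \<Rightarrow> bool" where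
  "radial_profile \<sigma> F F1 F2 \<longleftrightarrow>
     smooth_on {0<..} F \<and> F \<in> borel_measurable borel \<and> F1 \<in> borel_measurable borel \<and> F2 \<in> borel_measurable borel \<and>
     (\<forall>s>0. (F has_real_derivative F1 s) (at s) \<and> (F1 has_real_derivative F2 s) (at s)) \<and>
     continuous_on {0<..} F2 \<and>
     (\<exists>S>0. \<forall>s\<ge>S. F s = 0 \<and> F1 s = 0 \<and> F2 s = 0) \<and>
     (\<exists>C. \<forall>s>0. \<bar>F s\<bar> \<le> C \<and> \<bar>F1 s\<bar> \<le> C * (1 + s powr (\<sigma>/2)) \<and> \<bar>s * F2 s\<bar> \<le> C * (1 + s powr (\<sigma>/2)))"

lemma continuous_on_pcut2:
  assumes "L > 0" shows "continuous_on {0<..} (pcut2 q R L)"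
proof -
  have a: "continuous_on {0<..} (\<lambda>s. (ln s / 2 - ln R) / L)" using assms by (intro continuous_intros) auto
  have s: "continuous_on {0<..} (\<lambda>s. step ((ln s / 2 - ln R) / L))"
    "continuous_on {0<..} (\<lambda>s. step1 ((ln s / 2 - ln R) / L))"
    "continuous_on {0<..} (\<lambda>s. step2 ((ln s / 2 - ln R) / L))"
    by (rule continuous_on_compose2[OF continuous_on_step(1)[of UNIV] a subset_UNIV]
        continuous_on_compose2[OF continuous_on_step(2)[of UNIV] a subset_UNIV]
        continuous_on_compose2[OF continuous_on_step(3)[of UNIV] a subset_UNIV])+
  have p: "continuous_on {0<..} (\<lambda>s::real. s powr b)" for b by (intro continuous_intros) auto
  show ?thesis
    unfolding pcut2_def[abs_def] cut_def cut1_def cut2_def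
    using assms by (intro continuous_on_add continuous_on_mult continuous_on_diff continuous_on_divide s p
        continuous_on_const continuous_on_power continuous_on_id) auto
qed

lemma cut_deriv_bounds:
  assumes "R > 0" "L > 0"
  obtains K where "K > 0" "\<And>s. s > 0 \<Longrightarrow> \<bar>cut1 R L s\<bar> \<le> K" "\<And>s. s > 0 \<Longrightarrow> \<bar>s * cut2 R L s\<bar> \<le> K"
proof -
  \<comment> \<open>Exponent 0 turns the fractional bound into boundedness.\<close>
  obtain C where C: "C > 0" "\<And>y. \<bar>step1 y\<bar> \<le> C * step y powr 0" "\<And>y. \<bar>step2 y\<bar> \<le> C * step y powr 0"
    by (rule step_deriv_le_powr[of 0]) auto
  have b1: "\<bar>step1 y\<bar> \<le> C" and b2: "\<bar>step2 y\<bar> \<le> C" for y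
    using C(2)[of y] C(3)[of y] C(1) by (cases "step y = 0"; simp)+
  define K where "K = C / (2 * L * R\<^sup>2) + C / ((2 * L)\<^sup>2 * R\<^sup>2)"
  have Kpos: "C / (2 * L * R\<^sup>2) > 0" "C / ((2 * L)\<^sup>2 * R\<^sup>2) > 0" using C(1) assms by auto
  have "\<bar>cut1 R L s\<bar> \<le> K \<and> \<bar>s * cut2 R L s\<bar> \<le> K" if s: "s > 0" for s
  proof (cases "s \<le> R\<^sup>2")
    case True
    have "sqrt s \<le> R" using True assms by (simp add: real_le_lsqrt)
    then have "cut1 R L s = 0" "cut2 R L s = 0"
      using cut_inner[of "sqrt s" R L] s assms by simp_all
    then show ?thesis using Kpos by (simp add: K_def)
  next
    case False
    define y where "y = (ln s / 2 - ln R) / L"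
    have 1: "\<bar>step1 y / (2 * L * s)\<bar> \<le> C / (2 * L * R\<^sup>2)"
      unfolding abs_divide using False s assms C(1) b1 by (intro frac_le) (auto simp: abs_mult)
    have 2: "\<bar>step2 y / ((2 * L)\<^sup>2 * s)\<bar> \<le> C / ((2 * L)\<^sup>2 * R\<^sup>2)"
      unfolding abs_divide using False s assms C(1) b2 by (intro frac_le) (auto simp: abs_mult)
    have "cut1 R L s = step1 y / (2 * L * s)" by (simp add: cut1_def y_def)
    moreover have "s * cut2 R L s = step2 y / ((2 * L)\<^sup>2 * s) - step1 y / (2 * L * s)"
      using s assms unfolding cut2_def y_def[symmetric] by (simp add: field_simps power2_eq_square)
    ultimately show ?thesis
      using 1 2 abs_triangle_ineq4[of "step2 y / ((2 * L)\<^sup>2 * s)" "step1 y / (2 * L * s)"] Kpos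
      unfolding K_def by simp
  qed
  moreover have "K > 0" using Kpos by (simp add: K_def)
  ultimately show ?thesis using that by blast
qed

text \<open>
  For \<open>q \<ge> \<sigma> + 2\<close> the singular factor \<open>\<bar>x\<bar>\<close> to the power \<open>q - 2\<close> of the Laplacian is bounded by a
  multiple of \<open>\<bar>x\<bar>\<^sup>\<sigma>\<close> near the origin; for \<open>q = 0\<close> the profile is constant there.
\<close>

lemma radial_profile_pcut:
  assumes "R > 0" "L > 0" "\<sigma> > -2" and q: "q = 0 \<or> q \<ge> \<sigma> + 2"
  shows "radial_profile \<sigma> (pcut q R L) (pcut1 q R L) (pcut2 q R L)"
proof -
  obtain K where K: "K > 0" "\<And>s. s > 0 \<Longrightarrow> \<bar>cut1 R L s\<bar> \<le> K" "\<And>s. s > 0 \<Longrightarrow> \<bar>s * cut2 R L s\<bar> \<le> K"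
    using cut_deriv_bounds[OF assms(1,2)] by blast
  have q0: "q \<ge> 0" using q assms(3) by auto
  define S where "S = (R * exp L)\<^sup>2"
  have S: "S > 0" using assms by (simp add: S_def)
  have sup: "pcut q R L s = 0 \<and> pcut1 q R L s = 0 \<and> pcut2 q R L s = 0" if "s \<ge> S" for s
  proof -
    have "R * exp L \<le> sqrt s" using that assms unfolding S_def by (simp add: real_le_rsqrt)
    moreover have "s = (sqrt s)\<^sup>2" using that S by simp
    ultimately show ?thesis using pcut_outer[of R L "sqrt s" q] assms by simp
  qed
  define M where "M = S powr ((q - 2 - \<sigma>) / 2)"
  define P where "P = S powr (q/2)"
  have M: "M \<ge> 0" and P: "P \<ge> 0" by (auto simp: M_def P_def)
  define C where "C = P + (q/2) * M + P * K + \<bar>q/2 * (q/2 - 1)\<bar> * M + q * P * K"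
  have parts: "0 \<le> (q/2) * M" "0 \<le> P * K" "0 \<le> \<bar>q/2 * (q/2 - 1)\<bar> * M" "0 \<le> q * P * K"
    using q0 M P K(1) by auto
  have C: "C \<ge> 0" using parts P by (simp add: C_def)
  have bd: "\<bar>pcut q R L s\<bar> \<le> C \<and> \<bar>pcut1 q R L s\<bar> \<le> C * (1 + s powr (\<sigma>/2)) \<and> \<bar>s * pcut2 q R L s\<bar> \<le> C * (1 + s powr (\<sigma>/2))"
    if s: "s > 0" for s
  proof (cases "s \<ge> S")
    case True
    then show ?thesis using sup[OF True] C by simp
  next
    case False
    define E where "E = s powr (\<sigma>/2)"
    have E: "E \<ge> 0" by (simp add: E_def)
    have c: "0 \<le> cut R L s" "cut R L s \<le> 1" by (rule cut_bounds)+
    have sq: "s powr (q/2) \<le> P" using False s q0 unfolding P_def by (intro powr_mono2) auto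
    have key: "B * s powr (q/2 - 1) \<le> B * (M * E)" if "B = 0 \<or> q \<ge> \<sigma> + 2" "B \<ge> 0" for B
      using that(1)
    proof
      assume "q \<ge> \<sigma> + 2"
      have e: "q/2 - 1 = (q - 2 - \<sigma>)/2 + \<sigma>/2" by (simp add: field_simps)
      have "s powr (q/2 - 1) = s powr ((q - 2 - \<sigma>)/2) * E" unfolding E_def e powr_add ..
      also have "\<dots> \<le> M * E" using False s \<open>q \<ge> \<sigma> + 2\<close> E unfolding M_def
        by (intro mult_right_mono powr_mono2) auto
      finally show ?thesis using that(2) by (rule mult_left_mono)
    qed simp
    have "\<bar>pcut q R L s\<bar> \<le> P * 1"
      unfolding pcut_def abs_mult using c sq P by (intro mult_mono) auto
    then have 0: "\<bar>pcut q R L s\<bar> \<le> C" using parts by (simp add: C_def)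
    have c1: "\<bar>cut1 R L s\<bar> \<le> K" "\<bar>s * cut2 R L s\<bar> \<le> K" using K s by auto
    have a1: "\<bar>s powr (q/2) * cut1 R L s\<bar> \<le> P * K"
      unfolding abs_mult using c1 sq P by (intro mult_mono) auto
    have a2: "\<bar>s powr (q/2) * (s * cut2 R L s)\<bar> \<le> P * K"
      unfolding abs_mult[of "s powr (q/2)"] using c1 sq P by (intro mult_mono) auto
    have a3: "\<bar>q/2 * s powr (q/2 - 1) * cut R L s\<bar> \<le> (q/2) * (M * E)"
    proof -
      have "\<bar>q/2 * s powr (q/2 - 1) * cut R L s\<bar> \<le> q/2 * s powr (q/2 - 1) * 1"
        unfolding abs_mult using c q0 by (intro mult_mono) auto
      also have "\<dots> \<le> (q/2) * (M * E)" using key[of "q/2"] q q0 by auto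
      finally show ?thesis .
    qed
    have a4: "\<bar>q/2 * (q/2 - 1) * s powr (q/2 - 1) * cut R L s\<bar> \<le> \<bar>q/2 * (q/2 - 1)\<bar> * (M * E)"
    proof -
      have "\<bar>q/2 * (q/2 - 1) * s powr (q/2 - 1) * cut R L s\<bar> = \<bar>q/2 * (q/2 - 1)\<bar> * s powr (q/2 - 1) * cut R L s"
        using c(1) by (simp only: abs_mult) simp
      also have "\<dots> \<le> \<bar>q/2 * (q/2 - 1)\<bar> * s powr (q/2 - 1) * 1"
        using c by (intro mult_left_mono) auto
      also have "\<dots> \<le> \<bar>q/2 * (q/2 - 1)\<bar> * (M * E)" using key[of "\<bar>q/2 * (q/2 - 1)\<bar>"] q by auto
      finally show ?thesis .
    qed
    have s1: "s * s powr (q/2 - 2) = s powr (q/2 - 1)" "s * s powr (q/2 - 1) = s powr (q/2)"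
    proof -
      have 1: "s powr (b + 1) = s * s powr b" for b using s by (simp add: powr_add mult.commute)
      show "s * s powr (q/2 - 2) = s powr (q/2 - 1)" "s * s powr (q/2 - 1) = s powr (q/2)"
        using 1[of "q/2 - 2"] 1[of "q/2 - 1"] by (simp_all add: algebra_simps)
    qed
    have e2: "s * pcut2 q R L s = q/2 * (q/2 - 1) * s powr (q/2 - 1) * cut R L s
        + q * (s powr (q/2) * cut1 R L s) + s powr (q/2) * (s * cut2 R L s)"
      unfolding pcut2_def s1[symmetric] by (simp add: algebra_simps)
    have a5: "\<bar>q * (s powr (q/2) * cut1 R L s)\<bar> \<le> q * (P * K)"
      unfolding abs_mult[of q] using a1 q0 by (simp add: mult_left_mono)
    have CE: "C * (1 + E) = C + (P + P * K + q * P * K) * E + (q/2) * (M * E) + \<bar>q/2 * (q/2 - 1)\<bar> * (M * E)"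
      unfolding C_def by (simp add: algebra_simps)
    have pe: "0 \<le> (P + P * K + q * P * K) * E" "0 \<le> (q/2) * (M * E)" "0 \<le> \<bar>q/2 * (q/2 - 1)\<bar> * (M * E)"
      using parts P E M q0 by auto
    have CPK: "P * K \<le> C" "q * (P * K) + P * K \<le> C" using parts P unfolding C_def by (auto simp: mult.assoc)
    have 1: "\<bar>pcut1 q R L s\<bar> \<le> C * (1 + E)"
      unfolding pcut1_def CE using a1 a3 CPK pe by linarith
    have 2: "\<bar>s * pcut2 q R L s\<bar> \<le> C * (1 + E)"
      unfolding e2 CE using a2 a4 a5 CPK pe by linarith
    show ?thesis using 0 1 2 unfolding E_def by blast
  qed
  show ?thesis unfolding radial_profile_def
  proof (intro conjI allI impI)
    show "\<exists>S>0. \<forall>s\<ge>S. pcut q R L s = 0 \<and> pcut1 q R L s = 0 \<and> pcut2 q R L s = 0" using sup S by blast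
    show "\<exists>C. \<forall>s>0. \<bar>pcut q R L s\<bar> \<le> C \<and> \<bar>pcut1 q R L s\<bar> \<le> C * (1 + s powr (\<sigma>/2)) \<and>
        \<bar>s * pcut2 q R L s\<bar> \<le> C * (1 + s powr (\<sigma>/2))" using bd by blast
  qed (use assms in \<open>auto intro: smooth_on_pcut pcut_deriv pcut1_deriv continuous_on_pcut2\<close>)
qed

lemma dominated_factor:
  fixes h :: "'a::euclidean_space \<Rightarrow> real"
  assumes G: "G \<in> borel_measurable lebesgue" and B: "integrable lebesgue B"
    and [measurable]: "\<And>n. hn n \<in> borel_measurable borel" "h \<in> borel_measurable borel"
    and bd: "AE z in lebesgue. \<forall>n. \<bar>hn n z * G z\<bar> \<le> B z"
    and lim: "AE z in lebesgue. (\<lambda>n. hn n z) \<longlonglongrightarrow> h z"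
  shows "integrable lebesgue (\<lambda>z. h z * G z) \<and>
    (\<lambda>n. LINT z|lebesgue. hn n z * G z) \<longlonglongrightarrow> (LINT z|lebesgue. h z * G z)"
proof
  have m: "(\<lambda>z. h z * G z) \<in> borel_measurable lebesgue" "(\<lambda>z. hn n z * G z) \<in> borel_measurable lebesgue" for n
    by (rule borel_measurable_times[OF borel_imp_lebesgue_measurable[OF assms(4)] G]
        borel_measurable_times[OF borel_imp_lebesgue_measurable[OF assms(3)] G])+
  have l: "AE z in lebesgue. (\<lambda>n. hn n z * G z) \<longlonglongrightarrow> h z * G z"
    using lim by eventually_elim (intro tendsto_intros)
  have b: "AE z in lebesgue. norm (hn n z * G z) \<le> B z" for n
    using bd by eventually_elim simp
  show "integrable lebesgue (\<lambda>z. h z * G z)"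
    by (rule integrable_dominated_convergence[OF m B l b])
  show "(\<lambda>n. LINT z|lebesgue. hn n z * G z) \<longlonglongrightarrow> (LINT z|lebesgue. h z * G z)"
    by (rule integral_dominated_convergence[OF m B l b])
qed

lemma AE_lebesgue_nonzero: "AE x in lebesgue. (x :: real ^ 'n) \<noteq> 0"
  using AE_completion[OF AE_lborel_singleton[of 0]] by simp

lemma time_profile_continuous:
  assumes "time_profile a a' T"
  shows "continuous_on S a" "continuous_on S a'"
proof -
  have "isCont a t" for t
    using assms DERIV_isCont unfolding time_profile_def by metis
  then show "continuous_on S a" by (intro continuous_at_imp_continuous_on ballI)
  have "continuous_on UNIV a'" using assms unfolding time_profile_def by blast
  then show "continuous_on S a'" by (rule continuous_on_subset) simp
qed

lemma time_profile_bounded: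
  assumes "time_profile a a' T"
  obtains A where "A \<ge> 0" "\<And>t. t \<ge> 0 \<Longrightarrow> \<bar>a t\<bar> \<le> A" "\<And>t. t \<ge> 0 \<Longrightarrow> \<bar>a' t\<bar> \<le> A"
proof -
  obtain A where A: "A \<ge> 0" "\<And>t. t \<in> {0..T} \<Longrightarrow> norm (a t) \<le> A"
    by (rule continuous_on_compact_bound[OF compact_Icc time_profile_continuous(1)[OF assms]]) blast
  obtain B where B: "B \<ge> 0" "\<And>t. t \<in> {0..T} \<Longrightarrow> norm (a' t) \<le> B"
    by (rule continuous_on_compact_bound[OF compact_Icc time_profile_continuous(2)[OF assms]]) blast
  have "\<bar>a t\<bar> \<le> A + B \<and> \<bar>a' t\<bar> \<le> A + B" if "t \<ge> 0" for t
  proof (cases "t \<le> T")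
    case True
    then show ?thesis using A(1) A(2)[of t] B(1) B(2)[of t] that by auto
  next
    case False
    then have "a t = 0 \<and> a' t = 0" using assms by (simp add: time_profile_def)
    then show ?thesis using A(1) B(1) by simp
  qed
  then show ?thesis using that[of "A + B"] A(1) B(1) by auto
qed

lemma time_profile_borel:
  assumes "time_profile a a' T"
  shows "a \<in> borel_measurable borel" "a' \<in> borel_measurable borel"
  by (intro borel_measurable_continuous_onI time_profile_continuous[OF assms])+

context weak_solution
begin

lemma set_integral_support:
  fixes L g :: "real \<times> (real ^ 'n) \<Rightarrow> real"
  assumes "\<And>z. z \<in> half_space - cylinder T r \<Longrightarrow> L z = 0"
  shows "set_integrable lebesgue half_space (\<lambda>z. L z * g z) \<longleftrightarrow>
      integrable lebesgue (\<lambda>z. L z * (indicator (cylinder T r) z * g z))"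
    and "(LINT z:half_space|lebesgue. L z * g z) = (LINT z|lebesgue. L z * (indicator (cylinder T r) z * g z))"
proof -
  have "(\<lambda>z. indicator half_space z *\<^sub>R (L z * g z)) = (\<lambda>z. L z * (indicator (cylinder T r) z * g z))"
  proof
    fix z
    show "indicator half_space z *\<^sub>R (L z * g z) = L z * (indicator (cylinder T r) z * g z)"
      using assms[of z] cylinder_subset[of T r] by (auto simp: indicator_def)
  qed
  then show "set_integrable lebesgue half_space (\<lambda>z. L z * g z) \<longleftrightarrow>
      integrable lebesgue (\<lambda>z. L z * (indicator (cylinder T r) z * g z))"
    "(LINT z:half_space|lebesgue. L z * g z) = (LINT z|lebesgue. L z * (indicator (cylinder T r) z * g z))"
    by (simp_all only: set_integrable_def set_lebesgue_integral_def)
qed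

lemma norm_snd_borel [measurable]: "(\<lambda>z :: real \<times> (real ^ 'n). norm (snd z)) \<in> borel_measurable borel"
  unfolding borel_prod[symmetric] by measurable

lemma fst_borel [measurable]: "(fst :: real \<times> (real ^ 'n) \<Rightarrow> real) \<in> borel_measurable borel"
  unfolding borel_prod[symmetric] by measurable

text \<open>
  A profile such as \<open>\<bar>x\<bar>\<^sup>q\<close> is not smooth at the origin, but \<open>F (\<bar>x\<bar>\<^sup>2 + d)\<close> is for \<open>d > 0\<close>. As
  \<open>d\<close> tends to 0 all three integrals converge by dominated convergence, the first one because
  \<open>u\<close> and \<open>\<bar>x\<bar>\<^sup>\<sigma> u\<close>, \<open>\<sigma> = \<sigma>\<^sub>1\<close>, are integrable near the origin and up to time 0.
\<close>

lemma weak_test_radial: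
  assumes a: "time_profile a a' T" and F: "radial_profile \<sigma>\<^sub>1 F F1 F2"
  shows "weak_test (\<lambda>z. a (fst z) * F ((norm (snd z))\<^sup>2)) (adjoint a a' F F1 F2 0)"
proof -
  have Fs: "smooth_on {0<..} F" and F1: "\<And>s. s > 0 \<Longrightarrow> (F has_real_derivative F1 s) (at s)"
    and F2: "\<And>s. s > 0 \<Longrightarrow> (F1 has_real_derivative F2 s) (at s)"
    and F2c: "continuous_on {0<..} F2"
    and [measurable]: "F \<in> borel_measurable borel" "F1 \<in> borel_measurable borel" "F2 \<in> borel_measurable borel"
    using F unfolding radial_profile_def by auto
  obtain S where S: "S > 0" "\<And>s. s \<ge> S \<Longrightarrow> F s = 0 \<and> F1 s = 0 \<and> F2 s = 0"
    using F unfolding radial_profile_def by auto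
  obtain C where C: "\<And>s. s > 0 \<Longrightarrow> \<bar>F s\<bar> \<le> C \<and> \<bar>F1 s\<bar> \<le> C * (1 + s powr (\<sigma>\<^sub>1/2)) \<and> \<bar>s * F2 s\<bar> \<le> C * (1 + s powr (\<sigma>\<^sub>1/2))"
    using F unfolding radial_profile_def by auto
  have C0: "C \<ge> 0" using C[of 1] by linarith
  obtain A where A: "A \<ge> 0" "\<And>t. t \<ge> 0 \<Longrightarrow> \<bar>a t\<bar> \<le> A" "\<And>t. t \<ge> 0 \<Longrightarrow> \<bar>a' t\<bar> \<le> A"
    by (rule time_profile_bounded[OF a]) blast
  have T: "T > 0" "\<And>t. t \<ge> T \<Longrightarrow> a t = 0 \<and> a' t = 0" using a by (auto simp: time_profile_def)
  note [measurable] = time_profile_borel[OF a]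
  define r where "r = sqrt S"
  have r: "r > 0" "r\<^sup>2 = S" using S(1) by (auto simp: r_def)
  define Q where "Q = cylinder T r"
  define d where "d n = inverse (real (Suc n))" for n
  have d: "d n > 0" for n by (simp add: d_def)
  have dlim: "d \<longlonglongrightarrow> 0" unfolding d_def[abs_def] by (rule LIMSEQ_inverse_real_of_nat)
  define \<psi> where "\<psi> d z = a (fst z) * F ((norm (snd z))\<^sup>2 + d)" for d and z :: "real \<times> (real ^ 'n)"
  define L where "L d z = adjoint a a' F F1 F2 d z" for d and z :: "real \<times> (real ^ 'n)"
  have wt: "weak_test (\<psi> (d n)) (L (d n))" for n
    using weak_test_smooth[OF a Fs _ d[of n] F1 F2, of S] S(2)
    unfolding \<psi>_def[abs_def] L_def[abs_def] by blast
  have [measurable]: "\<psi> e \<in> borel_measurable borel" "L e \<in> borel_measurable borel" for e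
    unfolding \<psi>_def[abs_def] L_def[abs_def] radial_lap_def[abs_def] by measurable
  have zero: "\<psi> e z = 0 \<and> L e z = 0" if z: "z \<in> half_space - Q" and e: "e \<ge> 0" for e z
  proof -
    have "T \<le> fst z \<or> r \<le> norm (snd z)" using z by (auto simp: Q_def cylinder_def mem_Times_iff)
    then show ?thesis
    proof
      assume "T \<le> fst z" then show ?thesis using T(2)[of "fst z"] by (simp add: \<psi>_def L_def)
    next
      assume "r \<le> norm (snd z)"
      then have "r\<^sup>2 \<le> (norm (snd z))\<^sup>2" using r(1) by (intro power_mono) auto
      then have "S \<le> (norm (snd z))\<^sup>2 + e" using r(2) e by simp
      then show ?thesis using S(2) by (simp add: \<psi>_def L_def radial_lap_def)
    qed
  qed
  have zero0: "F ((norm x)\<^sup>2 + e) = 0" if "x \<notin> ball 0 r" "e \<ge> 0" for x :: "real ^ 'n" and e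
  proof -
    have "r\<^sup>2 \<le> (norm x)\<^sup>2" using that r(1) by (intro power_mono) auto
    then show ?thesis using S(2) r(2) that(2) by simp
  qed
  have Flim: "(\<lambda>n. F ((norm x)\<^sup>2 + d n)) \<longlonglongrightarrow> F ((norm x)\<^sup>2 + 0)"
    "(\<lambda>n. F1 ((norm x)\<^sup>2 + d n)) \<longlonglongrightarrow> F1 ((norm x)\<^sup>2 + 0)"
    "(\<lambda>n. F2 ((norm x)\<^sup>2 + d n)) \<longlonglongrightarrow> F2 ((norm x)\<^sup>2 + 0)" if "x \<noteq> 0" for x :: "real ^ 'n"
  proof -
    have pos: "(norm x)\<^sup>2 + 0 > 0" using that by simp
    have l: "(\<lambda>n. (norm x)\<^sup>2 + d n) \<longlonglongrightarrow> (norm x)\<^sup>2 + 0" by (intro tendsto_intros dlim)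
    have "isCont F2 ((norm x)\<^sup>2 + 0)"
      using F2c pos continuous_on_eq_continuous_at[OF open_greaterThan] by (metis greaterThan_iff)
    then show "(\<lambda>n. F2 ((norm x)\<^sup>2 + d n)) \<longlonglongrightarrow> F2 ((norm x)\<^sup>2 + 0)"
      using l by (rule isCont_tendsto_compose)
    show "(\<lambda>n. F ((norm x)\<^sup>2 + d n)) \<longlonglongrightarrow> F ((norm x)\<^sup>2 + 0)"
      by (rule isCont_tendsto_compose[OF DERIV_isCont[OF F1[OF pos]] l])
    show "(\<lambda>n. F1 ((norm x)\<^sup>2 + d n)) \<longlonglongrightarrow> F1 ((norm x)\<^sup>2 + 0)"
      by (rule isCont_tendsto_compose[OF DERIV_isCont[OF F2[OF pos]] l])
  qed
  have \<psi>lim: "(\<lambda>n. \<psi> (d n) z) \<longlonglongrightarrow> \<psi> 0 z" and Llim: "(\<lambda>n. L (d n) z) \<longlonglongrightarrow> L 0 z" if "snd z \<noteq> 0" for z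
    unfolding \<psi>_def L_def radial_lap_def by (intro tendsto_intros Flim[OF that])+
  have \<psi>bd: "\<bar>\<psi> (d n) z\<bar> \<le> A * C" if "z \<in> Q" for n z
  proof -
    have "(norm (snd z))\<^sup>2 + d n > 0" using d[of n] by (intro add_nonneg_pos) auto
    then show ?thesis unfolding \<psi>_def abs_mult
      using A C that by (intro mult_mono) (auto simp: Q_def cylinder_def)
  qed
  define S1 where "S1 = S powr (\<sigma>\<^sub>1/2)"
  have S1: "S1 \<ge> 0" by (simp add: S1_def)
  define N where "N = real CARD('n)"
  have N: "N \<ge> 0" by (simp add: N_def)
  \<comment> \<open>One constant for both parts of the adjoint: \<open>S1\<close> bounds the weight where \<open>\<sigma>\<^sub>1 \<ge> 0\<close>, and for
    \<open>\<sigma>\<^sub>1 < 0\<close> the shift by \<open>d\<close> only decreases the weight.\<close>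
  define M where "M = A * C + A * ((4 + 2 * N) * (C * (1 + S1)))"
  have M: "M \<ge> 0" using A(1) C0 N S1 by (simp add: M_def)
  have Lbd: "\<bar>L (d n) z\<bar> \<le> M * (1 + norm (snd z) powr \<sigma>\<^sub>1)" if z: "z \<in> Q" "snd z \<noteq> 0" for n z
  proof -
    define X where "X = norm (snd z) powr \<sigma>\<^sub>1"
    define s where "s = (norm (snd z))\<^sup>2 + d n"
    have X: "X \<ge> 0" by (simp add: X_def)
    have spos: "s > 0" unfolding s_def using d[of n] by (intro add_nonneg_pos) auto
    have xs: "(norm (snd z))\<^sup>2 \<le> s" unfolding s_def using d[of n] by simp
    have t: "fst z \<ge> 0" using z by (auto simp: Q_def cylinder_def)
    define Y where "Y = C * (1 + (S1 + X))"
    have Y: "Y \<ge> 0" using C0 S1 X by (simp add: Y_def)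
    have FY: "\<bar>F1 s\<bar> \<le> Y \<and> \<bar>s * F2 s\<bar> \<le> Y"
    proof (cases "s \<ge> S")
      case True then show ?thesis using S(2)[OF True] Y by simp
    next
      case False
      have "s powr (\<sigma>\<^sub>1/2) \<le> S1 + X"
      proof (cases "\<sigma>\<^sub>1 \<ge> 0")
        case True
        then have "s powr (\<sigma>\<^sub>1/2) \<le> S1" unfolding S1_def using False spos by (intro powr_mono2) auto
        then show ?thesis using X by simp
      next
        case neg: False
        have "s powr (\<sigma>\<^sub>1/2) \<le> ((norm (snd z))\<^sup>2) powr (\<sigma>\<^sub>1/2)"
          using neg xs z by (intro powr_mono2') auto
        also have "\<dots> = X" unfolding X_def using z by (simp add: powr_powr flip: powr_numeral)
        finally show ?thesis using S1 by simp
      qed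
      then have "C * (1 + s powr (\<sigma>\<^sub>1/2)) \<le> Y" unfolding Y_def using C0 by (intro mult_left_mono) auto
      then show ?thesis using C[OF spos] by auto
    qed
    have lap: "\<bar>radial_lap F1 F2 (d n) (snd z)\<bar> \<le> (4 + 2 * N) * Y"
    proof -
      have "\<bar>4 * (norm (snd z))\<^sup>2 * F2 s\<bar> = 4 * ((norm (snd z))\<^sup>2 * \<bar>F2 s\<bar>)" by (simp add: abs_mult)
      also have "\<dots> \<le> 4 * (s * \<bar>F2 s\<bar>)" using xs by (intro mult_left_mono mult_right_mono) auto
      also have "\<dots> \<le> 4 * Y" using FY spos by (simp add: abs_mult)
      finally have 1: "\<bar>4 * (norm (snd z))\<^sup>2 * F2 s\<bar> \<le> 4 * Y" .
      have 2: "\<bar>2 * N * F1 s\<bar> \<le> 2 * N * Y"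
        using FY N by (simp add: abs_mult mult_left_mono)
      show ?thesis unfolding radial_lap_def s_def[symmetric] N_def[symmetric]
        using 1 2 by (simp add: algebra_simps)
    qed
    have "\<bar>L (d n) z\<bar> \<le> X * (\<bar>a' (fst z)\<bar> * \<bar>F s\<bar>) + \<bar>a (fst z)\<bar> * \<bar>radial_lap F1 F2 (d n) (snd z)\<bar>"
      unfolding L_def X_def[symmetric] s_def[symmetric]
      by (rule order_trans[OF abs_triangle_ineq4]) (use X in \<open>simp add: abs_mult\<close>)
    also have "\<dots> \<le> X * (A * C) + A * ((4 + 2 * N) * Y)"
      using A t C[OF spos] X lap by (intro add_mono mult_left_mono mult_mono) auto
    also have "\<dots> \<le> M * (1 + X)"
    proof -
      have "Y \<le> C * (1 + S1) * (1 + X)" unfolding Y_def using C0 S1 X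
        by (simp add: mult_left_mono algebra_simps)
      then have "A * ((4 + 2 * N) * Y) \<le> A * ((4 + 2 * N) * (C * (1 + S1) * (1 + X)))"
        using A(1) N by (intro mult_left_mono) auto
      moreover have "X * (A * C) \<le> A * C * (1 + X)" using A(1) C0 by (simp add: algebra_simps)
      ultimately show ?thesis unfolding M_def by (simp add: algebra_simps)
    qed
    finally show ?thesis unfolding X_def .
  qed
  have u_int: "integrable lebesgue (\<lambda>z. indicator Q z * u z)"
    "integrable lebesgue (\<lambda>z. indicator Q z * (norm (snd z) powr \<sigma>\<^sub>1 * u z))"
    using integrable_u[OF T(1) r(1)] integrable_weighted_u[OF T(1) r(1)]
    unfolding set_integrable_def Q_def by simp_all
  have source_int: "integrable lebesgue (\<lambda>z. indicator Q z * source z)"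
    using set_integral_add(1)[OF integrable_nonlinearity[OF T(1) r(1)] integrable_time_source[of T r]]
    unfolding set_integrable_def Q_def by simp
  have init_int: "integrable lebesgue (\<lambda>x. indicator (ball 0 r) x * (norm x powr \<sigma>\<^sub>1 * u\<^sub>0 x))"
    using integrable_initial[OF T(1) r(1)] unfolding set_integrable_def by simp
  have I1': "integrable lebesgue (\<lambda>z. L 0 z * (indicator Q z * u z)) \<and>
    (\<lambda>n. LINT z|lebesgue. L (d n) z * (indicator Q z * u z)) \<longlonglongrightarrow> (LINT z|lebesgue. L 0 z * (indicator Q z * u z))"
  proof (rule dominated_factor[where B="\<lambda>z. M * (\<bar>indicator Q z * u z\<bar> + \<bar>indicator Q z * (norm (snd z) powr \<sigma>\<^sub>1 * u z)\<bar>)"])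
    show "(\<lambda>z. indicator Q z * u z) \<in> borel_measurable lebesgue" using u_int(1) by (rule borel_measurable_integrable)
    show "integrable lebesgue (\<lambda>z. M * (\<bar>indicator Q z * u z\<bar> + \<bar>indicator Q z * (norm (snd z) powr \<sigma>\<^sub>1 * u z)\<bar>))"
      by (intro integrable_mult_right Bochner_Integration.integrable_add integrable_abs u_int)
    show "AE z in lebesgue. (\<lambda>n. L (d n) z) \<longlonglongrightarrow> L 0 z"
      using AE_snd_nonzero by eventually_elim (rule Llim)
    show "AE z in lebesgue. \<forall>n. \<bar>L (d n) z * (indicator Q z * u z)\<bar>
        \<le> M * (\<bar>indicator Q z * u z\<bar> + \<bar>indicator Q z * (norm (snd z) powr \<sigma>\<^sub>1 * u z)\<bar>)"
      using AE_snd_nonzero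
    proof eventually_elim
      case (elim z)
      show ?case
      proof (cases "z \<in> Q")
        case True
        have "\<bar>L (d n) z\<bar> * \<bar>u z\<bar> \<le> M * (1 + norm (snd z) powr \<sigma>\<^sub>1) * \<bar>u z\<bar>" for n
          using Lbd[OF True elim] by (rule mult_right_mono) simp
        then show ?thesis using True by (simp add: abs_mult algebra_simps)
      qed simp
    qed
  qed measurable
  have I2': "integrable lebesgue (\<lambda>x. \<psi> 0 (0, x) * (indicator (ball 0 r) x * (norm x powr \<sigma>\<^sub>1 * u\<^sub>0 x))) \<and>
    (\<lambda>n. LINT x|lebesgue. \<psi> (d n) (0, x) * (indicator (ball 0 r) x * (norm x powr \<sigma>\<^sub>1 * u\<^sub>0 x)))
      \<longlonglongrightarrow> (LINT x|lebesgue. \<psi> 0 (0, x) * (indicator (ball 0 r) x * (norm x powr \<sigma>\<^sub>1 * u\<^sub>0 x)))"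
  proof (rule dominated_factor[where B="\<lambda>x. (A * C) * \<bar>indicator (ball 0 r) x * (norm x powr \<sigma>\<^sub>1 * u\<^sub>0 x)\<bar>"])
    show "(\<lambda>x. indicator (ball 0 r) x * (norm x powr \<sigma>\<^sub>1 * u\<^sub>0 x)) \<in> borel_measurable lebesgue"
      using init_int by (rule borel_measurable_integrable)
    show "integrable lebesgue (\<lambda>x. (A * C) * \<bar>indicator (ball 0 r) x * (norm x powr \<sigma>\<^sub>1 * u\<^sub>0 x)\<bar>)"
      by (intro integrable_mult_right integrable_abs init_int)
    show "AE x in lebesgue. (\<lambda>n. \<psi> (d n) (0, x)) \<longlonglongrightarrow> \<psi> 0 (0, x)"
      using AE_lebesgue_nonzero by eventually_elim (simp add: \<psi>lim)
    show "AE x in lebesgue. \<forall>n. \<bar>\<psi> (d n) (0, x) * (indicator (ball 0 r) x * (norm x powr \<sigma>\<^sub>1 * u\<^sub>0 x))\<bar>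
       \<le> (A * C) * \<bar>indicator (ball 0 r) x * (norm x powr \<sigma>\<^sub>1 * u\<^sub>0 x)\<bar>"
    proof (rule AE_I2, rule allI)
      fix x :: "real ^ 'n" and n
      have "(norm x)\<^sup>2 + d n > 0" using d[of n] by (intro add_nonneg_pos) auto
      then have "\<bar>\<psi> (d n) (0, x)\<bar> \<le> A * C" unfolding \<psi>_def abs_mult
        using A C by (intro mult_mono) auto
      then show "\<bar>\<psi> (d n) (0, x) * (indicator (ball 0 r) x * (norm x powr \<sigma>\<^sub>1 * u\<^sub>0 x))\<bar>
         \<le> (A * C) * \<bar>indicator (ball 0 r) x * (norm x powr \<sigma>\<^sub>1 * u\<^sub>0 x)\<bar>"
        unfolding abs_mult[of "\<psi> (d n) (0, x)"] by (rule mult_right_mono) simp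
    qed
  qed (unfold \<psi>_def, measurable)
  have I3': "integrable lebesgue (\<lambda>z. \<psi> 0 z * (indicator Q z * source z)) \<and>
    (\<lambda>n. LINT z|lebesgue. \<psi> (d n) z * (indicator Q z * source z)) \<longlonglongrightarrow> (LINT z|lebesgue. \<psi> 0 z * (indicator Q z * source z))"
  proof (rule dominated_factor[where B="\<lambda>z. (A * C) * \<bar>indicator Q z * source z\<bar>"])
    show "(\<lambda>z. indicator Q z * source z) \<in> borel_measurable lebesgue"
      using source_int by (rule borel_measurable_integrable)
    show "integrable lebesgue (\<lambda>z. (A * C) * \<bar>indicator Q z * source z\<bar>)"
      by (intro integrable_mult_right integrable_abs source_int)
    show "AE z in lebesgue. (\<lambda>n. \<psi> (d n) z) \<longlonglongrightarrow> \<psi> 0 z"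
      using AE_snd_nonzero by eventually_elim (rule \<psi>lim)
    show "AE z in lebesgue. \<forall>n. \<bar>\<psi> (d n) z * (indicator Q z * source z)\<bar> \<le> (A * C) * \<bar>indicator Q z * source z\<bar>"
    proof (rule AE_I2, rule allI)
      fix z n
      show "\<bar>\<psi> (d n) z * (indicator Q z * source z)\<bar> \<le> (A * C) * \<bar>indicator Q z * source z\<bar>"
      proof (cases "z \<in> Q")
        case True
        then show ?thesis unfolding abs_mult[of "\<psi> (d n) z"]
          by (intro mult_right_mono \<psi>bd) auto
      qed simp
    qed
  qed measurable
  note I1 = conjunct1[OF I1'] conjunct2[OF I1'] and I2 = conjunct1[OF I2'] conjunct2[OF I2']
    and I3 = conjunct1[OF I3'] conjunct2[OF I3']
  have sup: "(LINT z:half_space|lebesgue. L e z * u z) = (LINT z|lebesgue. L e z * (indicator Q z * u z))"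
    "set_integrable lebesgue half_space (\<lambda>z. L e z * u z) \<longleftrightarrow> integrable lebesgue (\<lambda>z. L e z * (indicator Q z * u z))"
    "(LINT z:half_space|lebesgue. source z * \<psi> e z) = (LINT z|lebesgue. \<psi> e z * (indicator Q z * source z))"
    "set_integrable lebesgue half_space (\<lambda>z. source z * \<psi> e z) \<longleftrightarrow> integrable lebesgue (\<lambda>z. \<psi> e z * (indicator Q z * source z))"
    if "e \<ge> 0" for e
    using zero[OF _ that] set_integral_support[of T r "L e" u] set_integral_support[of T r "\<psi> e" source]
    unfolding Q_def[symmetric] by (simp_all only: mult.commute[of "source _"])
  have sup0: "(\<lambda>x. norm x powr \<sigma>\<^sub>1 * u\<^sub>0 x * \<psi> e (0, x)) = (\<lambda>x. \<psi> e (0, x) * (indicator (ball 0 r) x * (norm x powr \<sigma>\<^sub>1 * u\<^sub>0 x)))"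
    if "e \<ge> 0" for e
  proof
    fix x
    show "norm x powr \<sigma>\<^sub>1 * u\<^sub>0 x * \<psi> e (0, x) = \<psi> e (0, x) * (indicator (ball 0 r) x * (norm x powr \<sigma>\<^sub>1 * u\<^sub>0 x))"
    proof (cases "x \<in> ball 0 r")
      case False
      then show ?thesis using zero0[OF False that] by (simp add: \<psi>_def)
    qed simp
  qed
  have eq: "(LINT z|lebesgue. L (d n) z * (indicator Q z * u z)) =
      (LINT x|lebesgue. \<psi> (d n) (0, x) * (indicator (ball 0 r) x * (norm x powr \<sigma>\<^sub>1 * u\<^sub>0 x)))
      + (LINT z|lebesgue. \<psi> (d n) z * (indicator Q z * source z))" for n
    using wt[of n] sup[OF less_imp_le[OF d[of n]]] sup0[OF less_imp_le[OF d[of n]]] unfolding weak_test_def by simp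
  have "(LINT z|lebesgue. L 0 z * (indicator Q z * u z)) =
      (LINT x|lebesgue. \<psi> 0 (0, x) * (indicator (ball 0 r) x * (norm x powr \<sigma>\<^sub>1 * u\<^sub>0 x)))
      + (LINT z|lebesgue. \<psi> 0 z * (indicator Q z * source z))"
    by (rule LIMSEQ_unique[OF I1(2)]) (unfold eq, intro tendsto_add I2(2) I3(2))
  then have "weak_test (\<psi> 0) (L 0)"
    unfolding weak_test_def using sup[OF order_refl] sup0[OF order_refl] I1(1) I2(1) I3(1) by simp
  then show ?thesis unfolding \<psi>_def[abs_def] L_def[abs_def] by simp
qed

lemma weak_test_add:
  assumes "weak_test \<psi>\<^sub>1 L\<^sub>1" "weak_test \<psi>\<^sub>2 L\<^sub>2"
  shows "weak_test (\<lambda>z. \<psi>\<^sub>1 z + \<psi>\<^sub>2 z) (\<lambda>z. L\<^sub>1 z + L\<^sub>2 z)"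
proof -
  note 1 = assms(1)[unfolded weak_test_def] and 2 = assms(2)[unfolded weak_test_def]
  note a = set_integral_add[of lebesgue half_space "\<lambda>z. L\<^sub>1 z * u z" "\<lambda>z. L\<^sub>2 z * u z"]
  note b = set_integral_add[of lebesgue half_space "\<lambda>z. source z * \<psi>\<^sub>1 z" "\<lambda>z. source z * \<psi>\<^sub>2 z"]
  note c = Bochner_Integration.integrable_add[of lebesgue "\<lambda>x. norm x powr \<sigma>\<^sub>1 * u\<^sub>0 x * \<psi>\<^sub>1 (0, x)" "\<lambda>x. norm x powr \<sigma>\<^sub>1 * u\<^sub>0 x * \<psi>\<^sub>2 (0, x)"]
    Bochner_Integration.integral_add[of lebesgue "\<lambda>x. norm x powr \<sigma>\<^sub>1 * u\<^sub>0 x * \<psi>\<^sub>1 (0, x)" "\<lambda>x. norm x powr \<sigma>\<^sub>1 * u\<^sub>0 x * \<psi>\<^sub>2 (0, x)"]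
  show ?thesis
    unfolding weak_test_def distrib_left[of "source _"] distrib_right[of "L\<^sub>1 _"] distrib_left[of "_ * u\<^sub>0 _"]
    using 1 2 a b c by simp
qed

lemma weak_test_cmult:
  assumes "weak_test \<psi> L"
  shows "weak_test (\<lambda>z. c * \<psi> z) (\<lambda>z. c * L z)"
proof (cases "c = 0")
  case True
  then show ?thesis by (simp add: weak_test_def set_integrable_def set_lebesgue_integral_def)
next
  case False
  note 1 = assms(1)[unfolded weak_test_def]
  have e: "(\<lambda>z. c * L z * u z) = (\<lambda>z. c * (L z * u z))" "(\<lambda>z. source z * (c * \<psi> z)) = (\<lambda>z. c * (source z * \<psi> z))"
    "(\<lambda>x. norm x powr \<sigma>\<^sub>1 * u\<^sub>0 x * (c * \<psi> (0, x))) = (\<lambda>x. c * (norm x powr \<sigma>\<^sub>1 * u\<^sub>0 x * \<psi> (0, x)))"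
    by (auto simp: algebra_simps)
  show ?thesis unfolding weak_test_def e using 1 by (auto simp: distrib_left)
qed

lemma weak_test_sum:
  assumes "\<And>i. i \<in> I \<Longrightarrow> weak_test (\<psi> i) (L i)" "finite I"
  shows "weak_test (\<lambda>z. \<Sum>i\<in>I. \<psi> i z) (\<lambda>z. \<Sum>i\<in>I. L i z)"
  using assms(2,1)
proof (induction I)
  case empty
  then show ?case by (simp add: weak_test_def set_integrable_def set_lebesgue_integral_def)
next
  case (insert i I)
  have "weak_test (\<lambda>z. \<psi> i z + (\<Sum>i\<in>I. \<psi> i z)) (\<lambda>z. L i z + (\<Sum>i\<in>I. L i z))"
    by (intro weak_test_add insert) auto
  then show ?case using insert.hyps by simp
qed

end

section \<open>Integrals of powers of the norm\<close>

lemma measure_cball_powr: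
  "r > 0 \<Longrightarrow> measure lborel (cball (0 :: real ^ 'n) r) = unit_ball_vol (real CARD('n)) * r powr real CARD('n)"
  by (simp add: content_cball powr_realpow)

lemma emeasure_cball_finite: "emeasure lborel (cball (0 :: real ^ 'n) r) < \<infinity>"
  using emeasure_bounded_finite[OF bounded_cball] .

lemma integrable_indicator_cball: "integrable lborel (\<lambda>x. c * indicator (cball (0 :: real ^ 'n) r) x :: real)"
  by (intro integrable_mult_right integrable_real_indicator emeasure_cball_finite) auto

lemma powr_on_shell:
  fixes y b g :: real
  assumes "b > 0" "b \<le> y" "y \<le> b * exp 1"
  shows "y powr g \<le> exp \<bar>g\<bar> * b powr g"
proof -
  have y: "y > 0" using assms by linarith
  have "ln b \<le> ln y" "ln y \<le> ln (b * exp 1)" using assms y by auto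
  then have l: "ln b \<le> ln y" "ln y \<le> ln b + 1" using assms by (auto simp: ln_mult)
  have "g * (ln y - ln b) \<le> \<bar>g\<bar> * (ln y - ln b)" using l by (intro mult_right_mono) auto
  also have "\<dots> \<le> \<bar>g\<bar> * 1" using l by (intro mult_left_mono) auto
  finally have "g * ln y \<le> \<bar>g\<bar> + g * ln b" by (simp add: algebra_simps)
  then have "exp (g * ln y) \<le> exp \<bar>g\<bar> * exp (g * ln b)" by (simp flip: exp_add)
  then show ?thesis using assms(1) y by (simp add: powr_def)
qed

lemma exp_shell:
  fixes y :: real
  assumes "y \<ge> 1"
  obtains j where "exp (real j) \<le> y" "y \<le> exp (real j + 1)" "real j \<le> ln y"
proof -
  define j where "j = nat \<lfloor>ln y\<rfloor>"
  have "real j \<le> ln y" "ln y \<le> real j + 1" using assms unfolding j_def by (auto simp: of_nat_nat)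
  moreover have "exp (ln y) = y" using assms by simp
  ultimately show ?thesis using that[of j] by (metis exp_le_cancel_iff)
qed

text \<open>
  The ball is covered by the shells between the radii \<open>r exp (-j-1)\<close> and \<open>r exp (-j)\<close>. On each of them
  the power is comparable to a constant, and the volumes produce a geometric series with ratio
  \<open>exp (- (N + g))\<close>.
\<close>

lemma integral_powr_ball:
  assumes "g > - real CARD('n)"
  obtains C where "C > 0"
    "\<And>r. r > 0 \<Longrightarrow> integrable lborel (\<lambda>x :: real ^ 'n. indicator (cball 0 r) x * norm x powr g)"
    "\<And>r. r > 0 \<Longrightarrow> (LINT x|lborel. indicator (cball (0 :: real ^ 'n) r) x * norm x powr g) \<le> C * r powr (real CARD('n) + g)"
proof -
  define N where "N = real CARD('n)"
  define V where "V = unit_ball_vol N"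
  define q where "q = exp (- (N + g))"
  define C where "C = V * exp (\<bar>g\<bar> + \<bar>g\<bar>) * (1 / (1 - q))"
  have V: "V > 0" unfolding V_def by (intro unit_ball_vol_pos) (simp add: N_def)
  have q: "0 < q" "q < 1" using assms by (auto simp: q_def N_def)
  have C: "C > 0" using V q by (simp add: C_def)
  have *: "integrable lborel (\<lambda>x :: real ^ 'n. indicator (cball 0 r) x * norm x powr g) \<and>
     (LINT x|lborel. indicator (cball (0 :: real ^ 'n) r) x * norm x powr g) \<le> C * r powr (N + g)" if r: "r > 0" for r
  proof -
    define f where "f x = indicator (cball 0 r) x * norm x powr g" for x :: "real ^ 'n"
    define b where "b j = r * exp (- real j)" for j :: nat
    define B where "B j = exp (\<bar>g\<bar> + \<bar>g\<bar>) * b j powr g" for j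
    have b: "b j > 0" for j using r by (simp add: b_def)
    have [measurable]: "cball (0 :: real ^ 'n) s \<in> sets borel" for s by simp
    have [measurable]: "f \<in> borel_measurable borel" unfolding f_def[abs_def] by measurable
    have f0: "f x \<ge> 0" for x by (simp add: f_def)
    have pt: "ennreal (f x) \<le> (\<Sum>j. ennreal (B j * indicator (cball 0 (b j)) x))" for x :: "real ^ 'n"
    proof (cases "x \<noteq> 0 \<and> norm x \<le> r")
      case False
      then have "f x = 0" by (auto simp: f_def)
      then show ?thesis by simp
    next
      case True
      then have "1 \<le> r / norm x" by simp
      then obtain j where j: "exp (real j) \<le> r / norm x" "r / norm x \<le> exp (real j + 1)" by (rule exp_shell)
      have 1: "norm x \<le> b j" using j(1) True by (simp add: b_def exp_minus field_simps)
      have 2: "b j * exp (-1) \<le> norm x" using j(2) True by (simp add: b_def exp_minus exp_add field_simps)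
      have "norm x powr g \<le> exp \<bar>g\<bar> * (b j * exp (-1)) powr g"
        using 1 2 b[of j] by (intro powr_on_shell) (auto simp: mult.assoc simp flip: exp_add)
      also have "(b j * exp (-1)) powr g = b j powr g * exp (- g)"
        using b[of j] by (simp add: powr_mult) (simp add: powr_def)
      also have "exp \<bar>g\<bar> * (b j powr g * exp (- g)) \<le> exp \<bar>g\<bar> * (b j powr g * exp \<bar>g\<bar>)"
        by (intro mult_left_mono) auto
      also have "exp \<bar>g\<bar> * (b j powr g * exp \<bar>g\<bar>) = B j" unfolding B_def exp_add by simp
      finally have "norm x powr g \<le> B j" .
      then have "f x \<le> B j * indicator (cball 0 (b j)) x" using 1 True by (simp add: f_def)
      then have "ennreal (f x) \<le> ennreal (B j * indicator (cball 0 (b j)) x)" by (rule ennreal_leI)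
      also have "\<dots> \<le> (\<Sum>j. ennreal (B j * indicator (cball 0 (b j)) x))"
        using sum_le_suminf[of "\<lambda>j. ennreal (B j * indicator (cball 0 (b j)) x)" "{j}"] by simp
      finally show ?thesis .
    qed
    have shell: "(\<integral>\<^sup>+x. ennreal (B j * indicator (cball (0 :: real ^ 'n) (b j)) x) \<partial>lborel)
        = ennreal (V * exp (\<bar>g\<bar> + \<bar>g\<bar>) * r powr (N + g) * q ^ j)" for j
    proof -
      have "(\<integral>\<^sup>+x. ennreal (B j * indicator (cball (0 :: real ^ 'n) (b j)) x) \<partial>lborel)
          = ennreal (B j * measure lborel (cball (0 :: real ^ 'n) (b j)))"
        using integrable_indicator_cball[of "B j" "b j"]
        by (subst nn_integral_eq_integral) (auto simp: B_def)
      also have "B j * measure lborel (cball (0 :: real ^ 'n) (b j)) = V * exp (\<bar>g\<bar> + \<bar>g\<bar>) * b j powr (N + g)"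
        using b[of j] by (simp add: measure_cball_powr V_def N_def B_def powr_add mult_ac)
      also have "b j powr (N + g) = r powr (N + g) * q ^ j"
      proof -
        have "(exp (- real j)) powr (N + g) = q ^ j"
          unfolding q_def exp_of_nat_mult[symmetric] by (simp add: powr_def algebra_simps)
        then show ?thesis using r by (simp add: b_def powr_mult)
      qed
      finally show ?thesis by (simp add: mult_ac)
    qed
    have "(\<integral>\<^sup>+x. ennreal (f x) \<partial>lborel) \<le> (\<integral>\<^sup>+x. (\<Sum>j. ennreal (B j * indicator (cball (0 :: real ^ 'n) (b j)) x)) \<partial>lborel)"
      by (intro nn_integral_mono pt)
    also have "\<dots> = (\<Sum>j. ennreal (V * exp (\<bar>g\<bar> + \<bar>g\<bar>) * r powr (N + g) * q ^ j))"
      unfolding shell[symmetric] by (intro nn_integral_suminf) measurable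
    also have "\<dots> = ennreal (V * exp (\<bar>g\<bar> + \<bar>g\<bar>) * r powr (N + g) * (1 / (1 - q)))"
      using q V by (intro suminf_ennreal_eq sums_mult geometric_sums) auto
    also have "\<dots> = ennreal (C * r powr (N + g))" by (simp add: C_def mult_ac)
    finally have le: "(\<integral>\<^sup>+x. ennreal (f x) \<partial>lborel) \<le> ennreal (C * r powr (N + g))" .
    have i: "integrable lborel f"
      by (rule integrableI_nonneg) (use le f0 in \<open>auto simp: le_less_trans\<close>)
    have "ennreal (integral\<^sup>L lborel f) \<le> ennreal (C * r powr (N + g))"
      using le nn_integral_eq_integral[OF i] f0 by simp
    then have "integral\<^sup>L lborel f \<le> C * r powr (N + g)" using C by (simp add: ennreal_le_iff)
    then show ?thesis using i unfolding f_def[abs_def] by simp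
  qed
  show ?thesis by (rule that[OF C]) (use * in \<open>auto simp: N_def\<close>)
qed

text \<open>
  Radii are restricted to powers of \<open>e\<close>, so that an annulus is a union of \<open>l - k\<close> shells of comparable
  shape and its integrals are finite sums of exponentials.
\<close>

definition annulus :: "nat \<Rightarrow> nat \<Rightarrow> (real ^ 'n) set" where
  "annulus k l = {x. exp (real k) \<le> norm x \<and> norm x \<le> exp (real l)}"

lemma annulus_borel [measurable]: "annulus k l \<in> sets borel"
  unfolding annulus_def by measurable

lemma integral_powr_annulus:
  obtains C where "C > 0"
    "\<And>k l. k < l \<Longrightarrow> integrable lborel (\<lambda>x :: real ^ 'n. indicator (annulus k l) x * norm x powr g)"
    "\<And>k l. k < l \<Longrightarrow> (LINT x|lborel. indicator (annulus k l) x * norm (x :: real ^ 'n) powr g)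
       \<le> C * (\<Sum>j\<in>{k..<l}. exp (real j * (real CARD('n) + g)))"
proof -
  define N where "N = real CARD('n)"
  define V where "V = unit_ball_vol N"
  define C where "C = V * exp (\<bar>g\<bar> + N)"
  have V: "V > 0" unfolding V_def by (intro unit_ball_vol_pos) (simp add: N_def)
  have C: "C > 0" using V by (simp add: C_def)
  have *: "integrable lborel (\<lambda>x :: real ^ 'n. indicator (annulus k l) x * norm x powr g) \<and>
     (LINT x|lborel. indicator (annulus k l) x * norm (x :: real ^ 'n) powr g)
       \<le> C * (\<Sum>j\<in>{k..<l}. exp (real j * (N + g)))" if kl: "k < l" for k l
  proof -
    define f where "f x = indicator (annulus k l) x * norm x powr g" for x :: "real ^ 'n"
    define B where "B j = exp \<bar>g\<bar> * exp (real j) powr g" for j :: nat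
    define h where "h x = (\<Sum>j\<in>{k..<l}. B j * indicator (cball 0 (exp (real j + 1))) x)" for x :: "real ^ 'n"
    have [measurable]: "f \<in> borel_measurable borel" unfolding f_def[abs_def] by measurable
    have h0: "h x \<ge> 0" for x unfolding h_def by (intro sum_nonneg) (simp add: B_def)
    have pt: "f x \<le> h x" for x
    proof (cases "x \<in> annulus k l")
      case False
      then show ?thesis using h0 by (simp add: f_def)
    next
      case True
      then have x: "exp (real k) \<le> norm x" "norm x \<le> exp (real l)" by (auto simp: annulus_def)
      then have "1 \<le> norm x" using one_le_exp_iff[of "real k"] by linarith
      obtain j where j: "j \<in> {k..<l}" "exp (real j) \<le> norm x" "norm x \<le> exp (real j + 1)"
      proof (cases "norm x = exp (real l)")
        case True
        show ?thesis
          by (rule that[of "l - 1"]) (use True kl in \<open>auto simp: of_nat_diff\<close>)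
      next
        case False
        obtain j where j: "exp (real j) \<le> norm x" "norm x \<le> exp (real j + 1)" "real j \<le> ln (norm x)"
          using exp_shell[OF \<open>1 \<le> norm x\<close>] by blast
        have "exp (real j) < exp (real l)" using j x False by linarith
        then have jl: "j < l" by simp
        show ?thesis
        proof (cases "k \<le> j")
          case True then show ?thesis using that[of j] j jl by simp
        next
          case False
          then have "real j + 1 \<le> real k" by simp
          then have "exp (real j + 1) \<le> exp (real k)" by simp
          then have "norm x = exp (real k)" using j x by linarith
          then show ?thesis using that[of k] kl by simp
        qed
      qed
      have "norm x powr g \<le> B j" unfolding B_def using j by (intro powr_on_shell) (auto simp: exp_add)
      then have "f x \<le> B j * indicator (cball 0 (exp (real j + 1))) x" using j True by (simp add: f_def)
      also have "\<dots> \<le> h x" unfolding h_def using j(1)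
        by (intro member_le_sum[of j "{k..<l}" "\<lambda>j. B j * indicator (cball 0 (exp (real j + 1))) x"]) (auto simp: B_def)
      finally show ?thesis .
    qed
    have hi: "integrable lborel h" unfolding h_def[abs_def]
      by (intro Bochner_Integration.integrable_sum integrable_indicator_cball)
    have fi: "integrable lborel f"
      by (rule Bochner_Integration.integrable_bound[OF hi]) (use pt h0 in \<open>auto simp: f_def\<close>)
    have "integral\<^sup>L lborel f \<le> integral\<^sup>L lborel h" by (intro integral_mono fi hi pt)
    also have "\<dots> = (\<Sum>j\<in>{k..<l}. B j * measure lborel (cball (0 :: real ^ 'n) (exp (real j + 1))))"
      unfolding h_def[abs_def] using integrable_indicator_cball
      by (subst Bochner_Integration.integral_sum) auto
    also have "\<dots> = (\<Sum>j\<in>{k..<l}. C * exp (real j * (N + g)))"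
    proof (intro sum.cong refl)
      fix j
      have "B j * measure lborel (cball (0 :: real ^ 'n) (exp (real j + 1))) = B j * (V * exp (real j + 1) powr N)"
        by (simp add: measure_cball_powr V_def N_def)
      also have "\<dots> = C * exp (real j * (N + g))"
      proof -
        have "exp (real j + 1) powr N = exp (real j * N) * exp N" by (simp add: powr_def algebra_simps flip: exp_add)
        moreover have "exp (real j) powr g = exp (real j * g)" by (simp add: powr_def mult.commute)
        ultimately show ?thesis unfolding B_def C_def by (simp add: distrib_left exp_add)
      qed
      finally show "B j * measure lborel (cball (0 :: real ^ 'n) (exp (real j + 1))) = C * exp (real j * (N + g))" .
    qed
    finally show ?thesis using fi unfolding f_def[abs_def] by (simp add: sum_distrib_left)
  qed
  show ?thesis by (rule that[OF C]) (use * in \<open>auto simp: N_def\<close>)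
qed

section \<open>The integral inequality\<close>

text \<open>
  Young's inequality for the factors \<open>X\<close> to the power \<open>s/p\<close> times \<open>y\<^sup>1\<^sup>/\<^sup>p v\<close>, and \<open>X\<close> to the power
  \<open>- s/p\<close> times \<open>g\<close>. It absorbs the linear term of the weak identity into the nonlinear one.
\<close>

lemma young_absorb:
  fixes v y g X s p :: real
  assumes p: "p > 1" and "v \<ge> 0" "y \<ge> 0" "g \<ge> 0" "X > 0"
  shows "g * y powr (1/p) * v \<le> X powr s * v powr p * y + X powr (- (s / (p - 1))) * g powr (p / (p - 1))"
proof -
  define q where "q = p / (p - 1)"
  have q: "q > 1" "1/p + 1/q = 1" using p by (auto simp: q_def field_simps)
  define A where "A = X powr (s/p) * y powr (1/p) * v"
  define B where "B = X powr (- (s/p)) * g"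
  have AB: "A \<ge> 0" "B \<ge> 0" using assms by (auto simp: A_def B_def)
  have "g * y powr (1/p) * v = (X powr (s/p) * X powr (- (s/p))) * (g * y powr (1/p) * v)"
    using assms by (simp flip: powr_add)
  also have "\<dots> = A * B" by (simp add: A_def B_def)
  also have "\<dots> \<le> A powr p / p + B powr q / q"
    using AB p q by (intro Youngs_inequality) auto
  also have "\<dots> \<le> A powr p + B powr q"
    using p q AB by (intro add_mono) (auto simp: divide_le_eq mult_le_cancel_left1)
  also have "A powr p = X powr s * v powr p * y"
    using assms by (simp add: A_def powr_mult powr_powr)
  also have "B powr q = X powr (- (s / (p - 1))) * g powr (p / (p - 1))"
  proof -
    have "- (s/p) * q = - (s / (p - 1))" using p by (simp add: q_def)
    then show ?thesis using assms by (simp add: B_def powr_mult powr_powr q_def)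
  qed
  finally show ?thesis .
qed

context weak_solution
begin

text \<open>
  The test function method: if the adjoint of \<open>\<psi>\<close> is at most \<open>G\<close> times the \<open>p\<close>-th root of \<open>\<psi>\<close>, the
  nonlinear term absorbs the left side of the weak identity, and the data are bounded by an integral
  that no longer involves the solution.
\<close>

lemma weak_test_estimate:
  assumes wt: "weak_test \<psi> L"
    and pos: "\<And>z. z \<in> half_space \<Longrightarrow> snd z \<noteq> 0 \<Longrightarrow> 0 \<le> \<psi> z"
    and G0: "\<And>z. 0 \<le> G z"
    and L: "\<And>z. z \<in> half_space \<Longrightarrow> snd z \<noteq> 0 \<Longrightarrow> \<bar>L z\<bar> \<le> G z * \<psi> z powr (1/p)"
    and W: "integrable lborel W" "\<And>z. 0 \<le> W z"
      "\<And>z. z \<in> half_space \<Longrightarrow> snd z \<noteq> 0 \<Longrightarrow>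
         norm (snd z) powr (- (\<sigma>\<^sub>2 / (p - 1))) * G z powr (p / (p - 1)) \<le> W z"
    and w\<psi>: "set_integrable lebesgue half_space (\<lambda>z. fst z powr \<rho> * w (snd z) * \<psi> z)"
  shows "(LINT z:half_space|lebesgue. fst z powr \<rho> * w (snd z) * \<psi> z)
     + (LINT x|lebesgue. norm x powr \<sigma>\<^sub>1 * u\<^sub>0 x * \<psi> (0, x)) \<le> (LINT z|lborel. W z)"
proof -
  define P where "P z = norm (snd z) powr \<sigma>\<^sub>2 * \<bar>u z\<bar> powr p * \<psi> z" for z
  note wt = wt[unfolded weak_test_def]
  have Pe: "P z = source z * \<psi> z - fst z powr \<rho> * w (snd z) * \<psi> z" for z
    by (simp add: P_def algebra_simps)
  have Pi: "set_integrable lebesgue half_space P"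
    unfolding Pe[abs_def] using wt w\<psi> by (intro set_integral_diff(1)) blast+
  have Wi: "integrable lebesgue W"
    using W(1) borel_measurable_integrable[OF W(1)] by (subst lebesgue_lborel_integral) auto
  have WH: "set_integrable lebesgue half_space W"
    by (rule set_integrable_subset[of _ UNIV]) (use Wi in \<open>auto simp: set_integrable_def\<close>)
  have "(LINT z:half_space|lebesgue. L z * u z) \<le> (LINT z:half_space|lebesgue. P z + W z)"
  proof (rule set_integral_mono_AE)
    show "set_integrable lebesgue half_space (\<lambda>z. L z * u z)" using wt by blast
    show "set_integrable lebesgue half_space (\<lambda>z. P z + W z)" by (intro set_integral_add(1) Pi WH)
    show "AE z \<in> half_space in lebesgue. L z * u z \<le> P z + W z"
      using AE_snd_nonzero
    proof (eventually_elim, intro impI)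
      case (elim z)
      assume z: "z \<in> half_space"
      have "L z * u z \<le> \<bar>L z\<bar> * \<bar>u z\<bar>" by (metis abs_ge_self abs_mult)
      also have "\<dots> \<le> G z * \<psi> z powr (1/p) * \<bar>u z\<bar>"
        by (intro mult_right_mono L z elim) simp
      also have "\<dots> \<le> norm (snd z) powr \<sigma>\<^sub>2 * \<bar>u z\<bar> powr p * \<psi> z
          + norm (snd z) powr (- (\<sigma>\<^sub>2 / (p - 1))) * G z powr (p / (p - 1))"
        using elim pos[OF z elim] G0 p by (intro young_absorb) auto
      also have "\<dots> \<le> P z + W z" unfolding P_def by (intro add_left_mono W(3) z elim)
      finally show "L z * u z \<le> P z + W z" .
    qed
  qed
  also have "\<dots> = (LINT z:half_space|lebesgue. P z) + (LINT z:half_space|lebesgue. W z)"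
    by (intro set_integral_add(2) Pi WH)
  also have "(LINT z:half_space|lebesgue. W z) \<le> (LINT z|lebesgue. W z)"
    unfolding set_lebesgue_integral_def using WH Wi W(2)
    by (intro integral_mono) (auto simp: set_integrable_def indicator_def)
  also have "\<dots> = (LINT z|lborel. W z)"
    using borel_measurable_integrable[OF W(1)] by (subst lebesgue_lborel_integral) auto
  finally have 1: "(LINT z:half_space|lebesgue. L z * u z) \<le> (LINT z:half_space|lebesgue. P z) + (LINT z|lborel. W z)"
    by simp
  have "(LINT z:half_space|lebesgue. source z * \<psi> z) =
     (LINT z:half_space|lebesgue. P z + fst z powr \<rho> * w (snd z) * \<psi> z)"
    by (simp add: Pe)
  also have "\<dots> = (LINT z:half_space|lebesgue. P z) + (LINT z:half_space|lebesgue. fst z powr \<rho> * w (snd z) * \<psi> z)"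
    by (intro set_integral_add(2) Pi w\<psi>)
  finally show ?thesis using 1 wt by linarith
qed

end

section \<open>Test functions corrected at the origin\<close>

text \<open>
  The \<open>j\<close>-th derivative of \<open>\<eta> t = flat 0 (s\<^sub>0 (1 - t/T))\<close> up to the sign \<open>(-1)\<^sup>j\<close>. With this sign all
  of them are nonnegative for \<open>t \<ge> 0\<close> once \<open>s\<^sub>0\<close> is small.
\<close>

definition heat_time :: "real \<Rightarrow> real \<Rightarrow> nat \<Rightarrow> real \<Rightarrow> real" where
  "heat_time s\<^sub>0 T j t = (s\<^sub>0 / T) ^ j * flat j (s\<^sub>0 * (1 - t / T))"

lemma heat_time_deriv:
  assumes "T > 0"
  shows "(heat_time s\<^sub>0 T j has_real_derivative - heat_time s\<^sub>0 T (Suc j) t) (at t)"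
proof -
  have "((\<lambda>t. s\<^sub>0 * (1 - t / T)) has_real_derivative - (s\<^sub>0 / T)) (at t)"
    using assms by (auto intro!: derivative_eq_intros)
  from DERIV_cmult[OF DERIV_chain2[OF flat_deriv this], of "(s\<^sub>0 / T) ^ j" j]
  show ?thesis unfolding heat_time_def[abs_def] by (simp add: mult_ac)
qed

lemma smooth_on_affine_compose:
  fixes f :: "real \<Rightarrow> real"
  assumes "smooth_on UNIV f" shows "smooth_on S (\<lambda>t. f (c + d * t))"
  by (intro smooth_on_compose_real[OF open_UNIV assms] smooth_on_add smooth_on_const smooth_on_mult
      smooth_on_ident_real subset_UNIV)

lemma smooth_on_heat_time: "smooth_on UNIV (heat_time s\<^sub>0 T j)"
proof -
  have "smooth_on UNIV (\<lambda>t. (s\<^sub>0 / T) ^ j * flat j (s\<^sub>0 + (- s\<^sub>0 / T) * t))"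
    by (intro smooth_on_mult smooth_on_const smooth_on_affine_compose smooth_on_flat)
  then show ?thesis unfolding heat_time_def[abs_def] by (simp add: algebra_simps)
qed

lemma heat_time_zero: "T > 0 \<Longrightarrow> s\<^sub>0 > 0 \<Longrightarrow> T \<le> t \<Longrightarrow> heat_time s\<^sub>0 T j t = 0"
proof -
  assume "T > 0" "s\<^sub>0 > 0" "T \<le> t"
  then have "s\<^sub>0 * (1 - t / T) \<le> 0" by (intro mult_nonneg_nonpos) auto
  then show ?thesis by (simp add: heat_time_def)
qed

lemma continuous_on_heat_time: "continuous_on S (heat_time s\<^sub>0 T j)"
  unfolding heat_time_def[abs_def] divide_inverse by (intro continuous_intros)

lemma time_profile_heat:
  assumes "T > 0" "s\<^sub>0 > 0"
  shows "time_profile (heat_time s\<^sub>0 T j) (\<lambda>t. - heat_time s\<^sub>0 T (Suc j) t) T"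
  unfolding time_profile_def
  using assms smooth_on_heat_time heat_time_deriv[OF assms(1)] heat_time_zero[OF assms]
  by (auto intro!: continuous_on_minus continuous_on_heat_time)

text \<open>
  Off between the times 0 and 1, on from time 2. It keeps the outer part of the test function away from
  the initial datum.
\<close>

definition switch :: "real \<Rightarrow> real" where "switch t = step (2 - t)"
definition switch' :: "real \<Rightarrow> real" where "switch' t = - step1 (2 - t)"

lemma switch_deriv: "(switch has_real_derivative switch' t) (at t)"
proof -
  have "((\<lambda>t. 2 - t) has_real_derivative - 1) (at t)" for t :: real
    by (auto intro!: derivative_eq_intros)
  from DERIV_chain2[OF step_deriv this, of t] show ?thesis
    unfolding switch_def[abs_def] switch'_def by simp
qed

lemma smooth_on_switch: "smooth_on UNIV switch"
  using smooth_on_affine_compose[OF smooth_on_step, of UNIV 2 "-1"] unfolding switch_def[abs_def] by simp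

lemma continuous_on_switch: "continuous_on S switch" "continuous_on S switch'"
  unfolding switch_def[abs_def] switch'_def[abs_def]
  by (intro continuous_on_minus continuous_on_compose2[OF continuous_on_step(1)[of UNIV]]
    continuous_on_compose2[OF continuous_on_step(2)[of UNIV]] continuous_intros subset_UNIV)+

lemma switch_bounds: "0 \<le> switch t" "switch t \<le> 1"
  using step_bounds by (auto simp: switch_def)

lemma switch_early: "t \<le> 1 \<Longrightarrow> switch t = 0"
  by (simp add: switch_def step_right)

lemma switch_late: "2 \<le> t \<Longrightarrow> switch t = 1" "2 \<le> t \<Longrightarrow> switch' t = 0"
  by (auto simp: switch_def switch'_def step_left)

lemma time_profile_switch:
  assumes "T > 0" "s\<^sub>0 > 0"
  shows "time_profile (\<lambda>t. heat_time s\<^sub>0 T 0 t * switch t)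
    (\<lambda>t. heat_time s\<^sub>0 T 0 t * switch' t - heat_time s\<^sub>0 T 1 t * switch t) T"
proof -
  have "((\<lambda>t. heat_time s\<^sub>0 T 0 t * switch t) has_real_derivative
      heat_time s\<^sub>0 T 0 t * switch' t - heat_time s\<^sub>0 T 1 t * switch t) (at t)" for t
    using DERIV_mult'[OF heat_time_deriv[OF assms(1), of s\<^sub>0 0 t] switch_deriv[of t]] by simp
  moreover have "smooth_on UNIV (\<lambda>t. heat_time s\<^sub>0 T 0 t * switch t)"
    by (intro smooth_on_mult smooth_on_heat_time smooth_on_switch)
  moreover have "continuous_on UNIV (\<lambda>t. heat_time s\<^sub>0 T 0 t * switch' t - heat_time s\<^sub>0 T 1 t * switch t)"
    by (intro continuous_on_diff continuous_on_mult continuous_on_heat_time continuous_on_switch)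
  ultimately show ?thesis
    unfolding time_profile_def using assms heat_time_zero[OF assms] by simp
qed

text \<open>
  With \<open>m = \<sigma>\<^sub>1 + 2\<close> the functions \<open>h\<^sub>j = heat_coeff m N j \<bar>x\<bar>\<^sup>m\<^sup>j\<close> satisfy
  \<open>\<Delta> h\<^sub>j = \<bar>x\<bar>\<^sup>\<sigma> h\<close> with \<open>\<sigma> = \<sigma>\<^sub>1\<close> and \<open>h\<close> the preceding function, which is the recursion for
  a formal solution of the backward equation.
\<close>

primrec heat_coeff :: "real \<Rightarrow> real \<Rightarrow> nat \<Rightarrow> real" where
  "heat_coeff m N 0 = 1"
| "heat_coeff m N (Suc j) = heat_coeff m N j / (m * (real j + 1) * (m * (real j + 1) + N - 2))"

lemma heat_coeff_pos: "m > 0 \<Longrightarrow> N \<ge> 2 \<Longrightarrow> heat_coeff m N j > 0"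
proof (induction j)
  case (Suc j)
  have "m * (real j + 1) > 0" using Suc.prems by (intro mult_pos_pos) auto
  then have "m * (real j + 1) * (m * (real j + 1) + N - 2) > 0" using Suc.prems
    by (intro mult_pos_pos) linarith+
  then show ?case using Suc by simp
qed simp

context weak_solution
begin

abbreviation m :: real where "m \<equiv> \<sigma>\<^sub>1 + 2"
lemma m_pos: "m > 0" using \<sigma>\<^sub>1 by simp

lemma dimn_ge: "dimn \<ge> 2" using dim dimn by simp

abbreviation hcoeff :: "nat \<Rightarrow> real" where "hcoeff \<equiv> heat_coeff m dimn"

text \<open>
  The first \<open>K + 1\<close> terms of the formal solution \<open>\<Sum> (-1)\<^sup>j \<eta>\<^sup>(\<^sup>j\<^sup>) h\<^sub>j\<close> of the backward equation, cut off
  between the radii 1 and \<open>e\<close>. It charges the initial datum, but only in a fixed ball.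
\<close>

definition inner_test :: "real \<Rightarrow> nat \<Rightarrow> real \<Rightarrow> real \<times> (real ^ 'n) \<Rightarrow> real" where
  "inner_test s\<^sub>0 K T z = (\<Sum>j\<le>K. hcoeff j * (heat_time s\<^sub>0 T j (fst z) * pcut (m * real j) 1 1 ((norm (snd z))\<^sup>2)))"

definition inner_adj :: "real \<Rightarrow> nat \<Rightarrow> real \<Rightarrow> real \<times> (real ^ 'n) \<Rightarrow> real" where
  "inner_adj s\<^sub>0 K T z = (\<Sum>j\<le>K. hcoeff j * adjoint (heat_time s\<^sub>0 T j) (\<lambda>t. - heat_time s\<^sub>0 T (Suc j) t)
      (pcut (m * real j) 1 1) (pcut1 (m * real j) 1 1) (pcut2 (m * real j) 1 1) 0 z)"

text \<open>
  The difference of two such functions, with cutoff radii \<open>R\<close> and 1, extends the test function beyond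
  the unit ball; it vanishes near time 0.
\<close>

definition outer_test :: "real \<Rightarrow> real \<Rightarrow> real \<Rightarrow> real \<Rightarrow> real \<times> (real ^ 'n) \<Rightarrow> real" where
  "outer_test s\<^sub>0 R L T z = heat_time s\<^sub>0 T 0 (fst z) * switch (fst z) * pcut 0 R L ((norm (snd z))\<^sup>2)"

definition outer_adj :: "real \<Rightarrow> real \<Rightarrow> real \<Rightarrow> real \<Rightarrow> real \<times> (real ^ 'n) \<Rightarrow> real" where
  "outer_adj s\<^sub>0 R L T z = adjoint (\<lambda>t. heat_time s\<^sub>0 T 0 t * switch t)
    (\<lambda>t. heat_time s\<^sub>0 T 0 t * switch' t - heat_time s\<^sub>0 T 1 t * switch t) (pcut 0 R L) (pcut1 0 R L) (pcut2 0 R L) 0 z"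

lemma weak_test_inner:
  assumes "T > 0" "s\<^sub>0 > 0"
  shows "weak_test (inner_test s\<^sub>0 K T) (inner_adj s\<^sub>0 K T)"
  unfolding inner_test_def[abs_def] inner_adj_def[abs_def]
proof (rule weak_test_sum[OF weak_test_cmult[OF weak_test_radial]])
  fix j
  show "time_profile (heat_time s\<^sub>0 T j) (\<lambda>t. - heat_time s\<^sub>0 T (Suc j) t) T"
    by (rule time_profile_heat[OF assms])
  have "m * real j = 0 \<or> m * 1 \<le> m * real j"
    using m_pos by (cases j) (auto intro!: mult_left_mono)
  then show "radial_profile \<sigma>\<^sub>1 (pcut (m * real j) 1 1) (pcut1 (m * real j) 1 1) (pcut2 (m * real j) 1 1)"
    using \<sigma>\<^sub>1 by (intro radial_profile_pcut) auto
qed simp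

lemma weak_test_outer:
  assumes "T > 0" "s\<^sub>0 > 0" "R > 0" "L > 0"
  shows "weak_test (outer_test s\<^sub>0 R L T) (outer_adj s\<^sub>0 R L T)"
  unfolding outer_test_def[abs_def] outer_adj_def[abs_def]
  using assms \<sigma>\<^sub>1 by (intro weak_test_radial[OF time_profile_switch[OF assms(1,2)]] radial_profile_pcut) auto

definition full_test :: "real \<Rightarrow> nat \<Rightarrow> real \<Rightarrow> real \<Rightarrow> real \<Rightarrow> real \<times> (real ^ 'n) \<Rightarrow> real" where
  "full_test s\<^sub>0 K R L T z = inner_test s\<^sub>0 K T z + (outer_test s\<^sub>0 R L T z + (- 1) * outer_test s\<^sub>0 1 1 T z)"

definition full_adj :: "real \<Rightarrow> nat \<Rightarrow> real \<Rightarrow> real \<Rightarrow> real \<Rightarrow> real \<times> (real ^ 'n) \<Rightarrow> real" where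
  "full_adj s\<^sub>0 K R L T z = inner_adj s\<^sub>0 K T z + (outer_adj s\<^sub>0 R L T z + (- 1) * outer_adj s\<^sub>0 1 1 T z)"

lemma weak_test_full:
  assumes "T > 0" "s\<^sub>0 > 0" "R > 0" "L > 0"
  shows "weak_test (full_test s\<^sub>0 K R L T) (full_adj s\<^sub>0 K R L T)"
  unfolding full_test_def[abs_def] full_adj_def[abs_def]
  using assms by (intro weak_test_add weak_test_cmult weak_test_inner weak_test_outer) auto

lemma pcut_norm:
  "x \<noteq> 0 \<Longrightarrow> pcut q R L ((norm (x :: real ^ 'n))\<^sup>2) = norm x powr q * cut R L ((norm x)\<^sup>2)"
  by (simp add: pcut_def powr_powr flip: powr_numeral)

text \<open>
  Consecutive terms of the formal solution cancel. Apart from the terms in which the cutoff is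
  differentiated, only the last time derivative survives, and it carries the factor \<open>\<bar>x\<bar>\<close> to the power
  \<open>\<sigma>\<^sub>1 + m K\<close>, which is small at the origin.
\<close>

lemma inner_adj_eq:
  assumes x: "snd z \<noteq> 0"
  shows "inner_adj s\<^sub>0 K T z =
    norm (snd z) powr (\<sigma>\<^sub>1 + m * real K) * (hcoeff K * heat_time s\<^sub>0 T (Suc K) (fst z) * cut 1 1 ((norm (snd z))\<^sup>2))
     - (\<Sum>j\<le>K. hcoeff j * heat_time s\<^sub>0 T j (fst z) * pcut_err CARD('n) (m * real j) 1 1 (norm (snd z)))"
proof (induction K)
  define X where "X = norm (snd z)"
  define \<alpha> where "\<alpha> = cut 1 1 (X\<^sup>2)"
  define e where "e j = heat_time s\<^sub>0 T j (fst z)" for j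
  define Q where "Q j = pcut_err CARD('n) (m * real j) 1 1 X" for j
  have X: "X > 0" using x by (simp add: X_def)
  define Y where "Y j = X powr (\<sigma>\<^sub>1 + m * real j)" for j
  have adj: "adjoint (heat_time s\<^sub>0 T j) (\<lambda>t. - heat_time s\<^sub>0 T (Suc j) t)
      (pcut (m * real j) 1 1) (pcut1 (m * real j) 1 1) (pcut2 (m * real j) 1 1) 0 z
    = Y j * (e (Suc j) * \<alpha>) - e j * (m * real j * (m * real j + dimn - 2) * X powr (m * real j - 2) * \<alpha> + Q j)" for j
    unfolding add_0_right pcut_norm[OF x] radial_lap_pcut[OF x zero_less_one] dimn[symmetric]
    unfolding X_def[symmetric] \<alpha>_def[symmetric] e_def[symmetric] Q_def[symmetric] Y_def powr_add by simp
  {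
    case 0
    show ?case unfolding inner_adj_def adj unfolding X_def[symmetric] \<alpha>_def[symmetric] e_def[symmetric] Q_def[symmetric] Y_def[symmetric]
      by simp
  next
    case (Suc K)
    define B where "B = m * (real K + 1) * (m * (real K + 1) + dimn - 2)"
    have mK: "m * (real K + 1) > 0" using m_pos by (intro mult_pos_pos) auto
    then have "m * (real K + 1) + dimn - 2 > 0" using dimn_ge by linarith
    with mK have "B > 0" unfolding B_def by (rule mult_pos_pos)
    then have cB: "hcoeff (Suc K) * B = hcoeff K" unfolding heat_coeff.simps B_def[symmetric] by simp
    have BS: "m * real (Suc K) * (m * real (Suc K) + dimn - 2) = B" by (simp add: B_def add.commute)
    have expo: "m * real (Suc K) - 2 = \<sigma>\<^sub>1 + m * real K" by (simp add: algebra_simps)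
    have "inner_adj s\<^sub>0 (Suc K) T z = inner_adj s\<^sub>0 K T z + hcoeff (Suc K) *
       (Y (Suc K) * (e (Suc (Suc K)) * \<alpha>) - e (Suc K) * (B * Y K * \<alpha> + Q (Suc K)))"
      unfolding inner_adj_def sum.atMost_Suc adj BS expo Y_def by (rule refl)
    also have "\<dots> = inner_adj s\<^sub>0 K T z + Y (Suc K) * (hcoeff (Suc K) * e (Suc (Suc K)) * \<alpha>)
        - (hcoeff (Suc K) * B) * e (Suc K) * Y K * \<alpha> - hcoeff (Suc K) * e (Suc K) * Q (Suc K)"
      by (simp add: algebra_simps del: heat_coeff.simps)
    also have "inner_adj s\<^sub>0 K T z = Y K * (hcoeff K * e (Suc K) * \<alpha>) - (\<Sum>j\<le>K. hcoeff j * e j * Q j)"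
      using Suc.IH unfolding X_def[symmetric] \<alpha>_def[symmetric] e_def[symmetric] Q_def[symmetric] Y_def[symmetric] .
    finally show ?case
      unfolding cB X_def[symmetric] \<alpha>_def[symmetric] e_def[symmetric] Q_def[symmetric] Y_def[symmetric] sum.atMost_Suc
      by (simp add: algebra_simps del: heat_coeff.simps)
  }
qed

lemma outer_adj_eq:
  assumes x: "snd z \<noteq> 0" and L: "L > 0"
  shows "outer_adj s\<^sub>0 R L T z =
    - (norm (snd z) powr \<sigma>\<^sub>1 * ((heat_time s\<^sub>0 T 0 (fst z) * switch' (fst z) - heat_time s\<^sub>0 T 1 (fst z) * switch (fst z))
        * cut R L ((norm (snd z))\<^sup>2)))
    - heat_time s\<^sub>0 T 0 (fst z) * switch (fst z) * pcut_err CARD('n) 0 R L (norm (snd z))"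
  using x unfolding outer_adj_def add_0_right pcut_norm[OF x] radial_lap_pcut[OF x L] by simp

end

section \<open>Size of the residual\<close>

context weak_solution
begin

text \<open>
  The four parts of the residual: the last term of the expansion near the origin, the time derivative
  away from the unit ball, the region where the switch acts, and the outer cutoff.
\<close>

definition weight :: "nat \<Rightarrow> nat \<Rightarrow> nat \<Rightarrow> real \<Rightarrow> real \<times> (real ^ 'n) \<Rightarrow> real" where
  "weight K k n T z =
     indicator {0..T} (fst z) * (1 / T * (indicator (cball 0 (exp 1)) (snd z) * norm (snd z) powr (\<sigma>\<^sub>1 + m * real K)))
   + indicator {0..T} (fst z) * (1 / T * (indicator (annulus 0 (k + n)) (snd z) * norm (snd z) powr \<sigma>\<^sub>1))
   + indicator {0..2} (fst z) * (indicator (annulus 0 (k + n)) (snd z) * norm (snd z) powr \<sigma>\<^sub>1)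
   + indicator {0..T} (fst z) * (1 / real n * (indicator (annulus k (k + n)) (snd z) * norm (snd z) powr (- 2)))"

lemma sum_head: "(\<Sum>j\<le>K. f j) = f 0 + (\<Sum>j\<in>{1..K}. f j)" for f :: "nat \<Rightarrow> real"
  by (simp add: atMost_atLeast0 sum.atLeast_Suc_atMost)

lemma full_test_eq:
  assumes x: "snd z \<noteq> 0"
  shows "full_test s\<^sub>0 K R L T z =
    heat_time s\<^sub>0 T 0 (fst z) * (cut 1 1 ((norm (snd z))\<^sup>2)
       + switch (fst z) * (cut R L ((norm (snd z))\<^sup>2) - cut 1 1 ((norm (snd z))\<^sup>2)))
    + (\<Sum>j\<in>{1..K}. hcoeff j * (heat_time s\<^sub>0 T j (fst z) * (norm (snd z) powr (m * real j) * cut 1 1 ((norm (snd z))\<^sup>2))))"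
  using x unfolding full_test_def inner_test_def outer_test_def pcut_norm[OF x] sum_head[of _ K]
  by (simp add: algebra_simps)

lemma full_adj_eq:
  assumes x: "snd z \<noteq> 0" and L: "L > 0"
  defines "X \<equiv> norm (snd z)" and "t \<equiv> fst z"
  shows "full_adj s\<^sub>0 K R L T z =
    X powr (\<sigma>\<^sub>1 + m * real K) * (hcoeff K * heat_time s\<^sub>0 T (Suc K) t * cut 1 1 (X\<^sup>2))
    - (\<Sum>j\<in>{1..K}. hcoeff j * heat_time s\<^sub>0 T j t * pcut_err CARD('n) (m * real j) 1 1 X)
    - heat_time s\<^sub>0 T 0 t * (1 - switch t) * pcut_err CARD('n) (m * real 0) 1 1 X
    + X powr \<sigma>\<^sub>1 * (heat_time s\<^sub>0 T 1 t * switch t * (cut R L (X\<^sup>2) - cut 1 1 (X\<^sup>2)))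
    - X powr \<sigma>\<^sub>1 * (heat_time s\<^sub>0 T 0 t * switch' t * (cut R L (X\<^sup>2) - cut 1 1 (X\<^sup>2)))
    - heat_time s\<^sub>0 T 0 t * switch t * pcut_err CARD('n) (m * real 0) R L X"
  unfolding full_adj_def inner_adj_eq[OF x] outer_adj_eq[OF x L] outer_adj_eq[OF x zero_less_one] sum_head[of _ K]
  unfolding X_def[symmetric] t_def[symmetric]
  by (simp add: algebra_simps)

text \<open>
  The inner cutoff is supported where the outer one equals 1, which needs \<open>k \<ge> 1\<close>.
\<close>

lemma cut_nested:
  assumes "1 \<le> k" "1 \<le> n" "X > 0"
  defines "\<alpha> \<equiv> cut 1 1 (X\<^sup>2)" and "\<phi> \<equiv> cut (exp (real k)) (real n) (X\<^sup>2)"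
  shows "\<alpha> \<le> \<phi>" and "X \<notin> {1..exp (real (k + n))} \<Longrightarrow> \<phi> - \<alpha> = 0" and "exp 1 < X \<Longrightarrow> \<alpha> = 0"
proof -
  have ek: "exp (1 :: real) \<le> exp (real k)" using assms(1) by simp
  have ekn: "exp (real k) * exp (real n) = exp (real (k + n))" by (simp add: exp_add)
  have en: "exp (real k) \<le> exp (real (k + n))" by simp
  have \<alpha>0: "\<alpha> = 0" if "exp 1 \<le> X" using cut_outer(1)[of 1 1 X] that by (simp add: \<alpha>_def)
  have \<phi>1: "\<phi> = 1" if "X \<le> exp (real k)" using cut_inner(1)[of X "exp (real k)" "real n"] that assms by (simp add: \<phi>_def)
  show "exp 1 < X \<Longrightarrow> \<alpha> = 0" using \<alpha>0 by simp
  show "\<alpha> \<le> \<phi>"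
  proof (cases "X \<le> exp (real k)")
    case True
    then show ?thesis using \<phi>1 cut_bounds(2) by (simp add: \<alpha>_def)
  next
    case False
    then show ?thesis using \<alpha>0 ek cut_bounds(1) by (simp add: \<phi>_def)
  qed
  show "\<phi> - \<alpha> = 0" if "X \<notin> {1..exp (real (k + n))}"
  proof (cases "X < 1")
    case True
    have "1 \<le> exp (real k)" by simp
    then have "X \<le> exp (real k)" using True by linarith
    then show ?thesis using \<phi>1 cut_inner(1)[of X 1 1] True assms(3) by (simp add: \<alpha>_def)
  next
    case False
    then have "exp (real (k + n)) \<le> X" using that by auto
    then have "\<phi> = 0" using cut_outer(1)[of "exp (real k)" "real n" X] assms(2) ekn by (simp add: \<phi>_def)
    moreover have "exp 1 \<le> X" using \<open>exp (real (k + n)) \<le> X\<close> ek en by linarith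
    ultimately show ?thesis using \<alpha>0 by simp
  qed
qed

lemma powr_ge_self: "0 \<le> a \<Longrightarrow> a \<le> 1 \<Longrightarrow> 0 < \<theta> \<Longrightarrow> \<theta> \<le> 1 \<Longrightarrow> a \<le> a powr \<theta>" for a \<theta> :: real
  using powr_mono'[of \<theta> 1 a] by (cases "a = 0") auto

text \<open>
  The test function is at least \<open>\<eta> ((1 - \<mu>) \<alpha> + \<mu> \<phi>)\<close>, where \<open>\<eta>\<close> is the time cutoff, \<open>\<mu>\<close> the switch and
  \<open>\<alpha> \<le> \<phi>\<close> the two spatial cutoffs, because all corrections are nonnegative. Every term of the residual
  contains \<open>\<eta>\<close> together with \<open>\<alpha>\<close> or \<open>\<mu> \<phi>\<close>, possibly differentiated, and a derivative of a cutoff is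
  bounded by a fractional power of it.
\<close>

lemma full_bound:
  fixes K :: nat
  assumes s0: "0 < s\<^sub>0" "s\<^sub>0 \<le> 1"
    and flat_pos: "\<And>j s. j \<le> Suc K \<Longrightarrow> s \<le> s\<^sub>0 \<Longrightarrow> 0 \<le> flat j s"
  obtains C where "C > 0"
    "\<And>k n T z. 1 \<le> k \<Longrightarrow> 1 \<le> n \<Longrightarrow> 1 \<le> T \<Longrightarrow> z \<in> half_space \<Longrightarrow> snd z \<noteq> 0 \<Longrightarrow>
       0 \<le> full_test s\<^sub>0 K (exp (real k)) (real n) T z"
    "\<And>k n T z. 1 \<le> k \<Longrightarrow> 1 \<le> n \<Longrightarrow> 1 \<le> T \<Longrightarrow> z \<in> half_space \<Longrightarrow> snd z \<noteq> 0 \<Longrightarrow>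
       \<bar>full_adj s\<^sub>0 K (exp (real k)) (real n) T z\<bar>
         \<le> C * weight K k n T z * full_test s\<^sub>0 K (exp (real k)) (real n) T z powr (1/p)"
proof -
  define \<theta> where "\<theta> = 1 / p"
  have \<theta>: "0 < \<theta>" "\<theta> < 1" using p by (auto simp: \<theta>_def)
  have "\<forall>j. \<exists>C. C > 0 \<and> (\<forall>s. \<bar>flat j s\<bar> \<le> C * flat 0 s powr \<theta>)"
    using flat_le_powr[OF \<theta>(2)] by metis
  then obtain f where f: "\<And>j. f j > 0" "\<And>j s. \<bar>flat j s\<bar> \<le> f j * flat 0 s powr \<theta>" by metis
  define F where "F = (\<Sum>j\<le>Suc K. f j)"
  have fF: "f j \<le> F" if "j \<le> Suc K" for j
    unfolding F_def using that f(1) by (intro member_le_sum) (auto simp: less_imp_le)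
  have F: "F > 0" using fF[of 0] f(1)[of 0] by simp
  have "\<forall>j. \<exists>C. C > 0 \<and> (\<forall>R L r. R > 0 \<longrightarrow> L \<ge> 1 \<longrightarrow> r > 0 \<longrightarrow>
    \<bar>pcut_err CARD('n) (m * real j) R L r\<bar> \<le> C / L * indicator {R..R * exp L} r * r powr (m * real j - 2) * cut R L (r\<^sup>2) powr \<theta>)"
    using pcut_err_bound[OF less_imp_le[OF \<theta>(1)] \<theta>(2), of "CARD('n)"] by (metis (no_types, lifting))
  then obtain g where g: "\<And>j. g j > 0"
    "\<And>j R L r. R > 0 \<Longrightarrow> L \<ge> 1 \<Longrightarrow> r > 0 \<Longrightarrow>
      \<bar>pcut_err CARD('n) (m * real j) R L r\<bar> \<le> g j / L * indicator {R..R * exp L} r * r powr (m * real j - 2) * cut R L (r\<^sup>2) powr \<theta>"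
    by metis
  obtain Cs where Cs: "Cs > 0" "\<And>y. \<bar>step1 y\<bar> \<le> Cs * step y powr \<theta>"
    using step_deriv_le_powr[of \<theta>] \<theta> by (metis less_imp_le)
  define S where "S = (\<Sum>j\<in>{1..K}. hcoeff j * F * (g j * exp (m * real j)))"
  have cpos: "hcoeff j > 0" for j using heat_coeff_pos[OF m_pos dimn_ge] .
  have S: "S \<ge> 0" unfolding S_def using cpos F g(1) by (intro sum_nonneg mult_nonneg_nonneg) (auto simp: less_imp_le)
  define C where "C = hcoeff K * F + (S + F) + (g 0 + Cs) + g 0"
  have Cparts: "hcoeff K * F > 0" "g 0 > 0" using cpos[of K] F g(1) by auto
  have C: "C > 0" unfolding C_def using Cparts S F Cs(1) by linarith
  have main: "0 \<le> full_test s\<^sub>0 K (exp (real k)) (real n) T z \<and>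
     \<bar>full_adj s\<^sub>0 K (exp (real k)) (real n) T z\<bar>
         \<le> C * weight K k n T z * full_test s\<^sub>0 K (exp (real k)) (real n) T z powr \<theta>"
    if kn: "1 \<le> k" "1 \<le> n" and T: "1 \<le> T" and z: "z \<in> half_space" "snd z \<noteq> 0" for k n T z
  proof -
    define X where "X = norm (snd z)"
    define t where "t = fst z"
    define e where "e j = heat_time s\<^sub>0 T j t" for j
    define \<alpha> where "\<alpha> = cut 1 1 (X\<^sup>2)"
    define \<phi> where "\<phi> = cut (exp (real k)) (real n) (X\<^sup>2)"
    define \<mu> where "\<mu> = switch t"
    define \<psi> where "\<psi> = full_test s\<^sub>0 K (exp (real k)) (real n) T z"
    define P where "P = \<psi> powr \<theta>"
    define E where "E = e 0 powr \<theta>"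
    have X: "X > 0" using z by (simp add: X_def)
    have t: "t > 0" using z by (auto simp: t_def)
    have n: "real n \<ge> 1" using kn by simp
    have arg: "s\<^sub>0 * (1 - t / T) \<le> s\<^sub>0" using s0 t T by (simp add: mult_le_cancel_left1)
    have sT: "0 < s\<^sub>0 / T" "s\<^sub>0 / T \<le> 1" using s0 T by auto
    have e0: "0 \<le> e j" if "j \<le> Suc K" for j
      unfolding e_def heat_time_def using sT flat_pos[OF that arg] by (intro mult_nonneg_nonneg zero_le_power) auto
    have e00: "e 0 = flat 0 (s\<^sub>0 * (1 - t / T))" by (simp add: e_def heat_time_def)
    have e1: "e 0 \<le> 1" unfolding e00 by (rule flat_0_bounds)
    have eE: "e j \<le> F * (1 / T) * E" if "1 \<le> j" "j \<le> Suc K" for j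
    proof -
      have "(s\<^sub>0 / T) ^ j \<le> (s\<^sub>0 / T) ^ 1" using that sT by (intro power_decreasing) auto
      also have "\<dots> \<le> 1 / T" using s0 T by (simp add: divide_right_mono)
      finally have 1: "(s\<^sub>0 / T) ^ j \<le> 1 / T" .
      have "flat j (s\<^sub>0 * (1 - t / T)) \<le> f j * E" using f(2)[of j] unfolding E_def e00 by (meson abs_le_D1)
      also have "\<dots> \<le> F * E" using fF[OF that(2)] by (intro mult_right_mono) (auto simp: E_def)
      finally have 2: "flat j (s\<^sub>0 * (1 - t / T)) \<le> F * E" .
      have "e j \<le> (1 / T) * (F * E)" unfolding e_def heat_time_def
        using 1 2 sT T flat_pos[OF that(2) arg] by (intro mult_mono) auto
      then show ?thesis by (simp add: mult_ac)
    qed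
    have E0: "E \<ge> 0" by (simp add: E_def)
    have e0E: "e 0 \<le> E" unfolding E_def using e0[of 0] e1 \<theta> by (intro powr_ge_self) auto
    have \<alpha>: "0 \<le> \<alpha>" "\<alpha> \<le> 1" and \<phi>: "0 \<le> \<phi>" "\<phi> \<le> 1" and \<mu>: "0 \<le> \<mu>" "\<mu> \<le> 1"
      unfolding \<alpha>_def \<phi>_def \<mu>_def by (rule cut_bounds switch_bounds)+
    note nest = cut_nested[OF kn X, folded \<alpha>_def \<phi>_def]
    define \<kappa> where "\<kappa> = \<alpha> + \<mu> * (\<phi> - \<alpha>)"
    have \<kappa>1: "\<alpha> \<le> \<kappa>" using nest(1) \<mu> by (simp add: \<kappa>_def)
    have \<kappa>2: "\<mu> * \<phi> \<le> \<kappa>"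
    proof -
      have "\<mu> * \<alpha> \<le> 1 * \<alpha>" using \<mu> \<alpha> by (intro mult_right_mono) auto
      then show ?thesis by (simp add: \<kappa>_def algebra_simps)
    qed
    have \<psi>eq: "\<psi> = e 0 * \<kappa> + (\<Sum>j\<in>{1..K}. hcoeff j * (e j * (X powr (m * real j) * \<alpha>)))"
      unfolding \<psi>_def full_test_eq[OF z(2)] X_def[symmetric] t_def[symmetric] e_def \<alpha>_def \<phi>_def \<mu>_def \<kappa>_def by simp
    have "0 \<le> (\<Sum>j\<in>{1..K}. hcoeff j * (e j * (X powr (m * real j) * \<alpha>)))"
      using cpos e0 \<alpha> by (intro sum_nonneg mult_nonneg_nonneg) (auto simp: less_imp_le)
    then have \<psi>\<kappa>: "e 0 * \<kappa> \<le> \<psi>" by (simp add: \<psi>eq)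
    have \<kappa>0: "0 \<le> \<kappa>" using \<kappa>1 \<alpha> by linarith
    have \<psi>0: "0 \<le> \<psi>" using \<psi>\<kappa> e0[of 0] \<kappa>0 by (meson le0 mult_nonneg_nonneg order_trans)
    have Pge: "E * y powr \<theta> \<le> P" if "0 \<le> y" "y \<le> \<kappa>" for y
    proof -
      have "E * y powr \<theta> = (e 0 * y) powr \<theta>" unfolding E_def using e0[of 0] that by (simp add: powr_mult)
      also have "\<dots> \<le> P" unfolding P_def
        using \<theta> e0[of 0] that \<psi>\<kappa> mult_left_mono[OF that(2) e0[of 0]] by (intro powr_mono2) auto
      finally show ?thesis .
    qed
    have P\<alpha>: "E * \<alpha> powr \<theta> \<le> P" and P\<mu>\<phi>: "E * (\<mu> * \<phi>) powr \<theta> \<le> P"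
      using Pge[OF \<alpha>(1) \<kappa>1] Pge[OF _ \<kappa>2] \<mu> \<phi> by auto
    have P0: "P \<ge> 0" by (simp add: P_def)
    define I1 where "I1 = (indicator (cball 0 (exp 1)) (snd z) :: real)"
    define I2 where "I2 = (indicator (annulus 0 (k + n)) (snd z) :: real)"
    define I3 where "I3 = (indicator (annulus k (k + n)) (snd z) :: real)"
    define J where "J = (indicator {0..2} t :: real)"
    have IJ: "0 \<le> I1" "0 \<le> I2" "0 \<le> I3" "0 \<le> J" by (auto simp: I1_def I2_def I3_def J_def)
    have I2e: "indicator {1..1 * exp 1} X \<le> I2"
    proof -
      have "exp (1 :: real) \<le> exp (real (k + n))" using kn by simp
      from order_trans[OF _ this] have "snd z \<in> annulus 0 (k + n)" if "1 \<le> X" "X \<le> exp 1"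
        using that unfolding X_def annulus_def mem_Collect_eq by simp
      then show ?thesis unfolding I2_def by (cases "1 \<le> X \<and> X \<le> exp 1") auto
    qed
    have I3e: "indicator {exp (real k)..exp (real k) * exp (real n)} X = I3"
      unfolding I3_def X_def annulus_def by (auto simp: indicator_def exp_add)
    show ?thesis
    proof (cases "t \<le> T")
      case False
      then have ez: "heat_time s\<^sub>0 T j t = 0" for j using heat_time_zero[of T s\<^sub>0 t j] T s0 by simp
      have "full_adj s\<^sub>0 K (exp (real k)) (real n) T z = 0"
        using n unfolding full_adj_eq[OF z(2), of "real n"] t_def[symmetric] ez by (subst full_adj_eq[OF z(2)]) (auto simp: t_def[symmetric] ez)
      moreover have "0 \<le> weight K k n T z" unfolding weight_def using T by (intro add_nonneg_nonneg mult_nonneg_nonneg) auto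
      ultimately show ?thesis using C \<psi>0 unfolding \<psi>_def by simp
    next
      case tT: True
      define w1 where "w1 = 1 / T * (I1 * X powr (\<sigma>\<^sub>1 + m * real K))"
      define w2 where "w2 = 1 / T * (I2 * X powr \<sigma>\<^sub>1)"
      define w3 where "w3 = J * (I2 * X powr \<sigma>\<^sub>1)"
      define w4 where "w4 = 1 / real n * (I3 * X powr (- 2))"
      have weq: "weight K k n T z = w1 + w2 + w3 + w4"
        using tT t unfolding weight_def w1_def w2_def w3_def w4_def I1_def I2_def I3_def J_def X_def t_def by simp
      have w0: "0 \<le> w1" "0 \<le> w2" "0 \<le> w3" "0 \<le> w4"
        using IJ T unfolding w1_def w2_def w3_def w4_def by auto
      have \<alpha>\<theta>: "\<alpha> \<le> \<alpha> powr \<theta>" using \<alpha> \<theta> by (intro powr_ge_self) auto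
      have X2: "X powr (m * real j - 2) \<le> exp (m * real j) * X powr \<sigma>\<^sub>1" if "1 \<le> X" "X \<le> exp 1" for j
      proof -
        have "X powr (m * real j - m) \<le> X powr (m * real j)"
          using that m_pos by (intro powr_mono) auto
        also have "X powr (m * real j) \<le> exp 1 powr (m * real j)"
          using that m_pos by (intro powr_mono2) auto
        also have "exp 1 powr (m * real j) = exp (m * real j)" by (simp add: powr_def)
        finally have "X powr (m * real j - m) * X powr \<sigma>\<^sub>1 \<le> exp (m * real j) * X powr \<sigma>\<^sub>1"
          by (rule mult_right_mono) simp
        moreover have "X powr (m * real j - 2) = X powr (m * real j - m) * X powr \<sigma>\<^sub>1"
          by (simp flip: powr_add)
        ultimately show ?thesis by simp
      qed
      have Qb: "\<bar>pcut_err CARD('n) (m * real j) 1 1 X\<bar> \<le> g j * exp (m * real j) * (I2 * X powr \<sigma>\<^sub>1) * \<alpha> powr \<theta>" for j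
      proof -
        have "\<bar>pcut_err CARD('n) (m * real j) 1 1 X\<bar> \<le> g j / 1 * indicator {1..1 * exp 1} X * X powr (m * real j - 2) * \<alpha> powr \<theta>"
          using g(2)[of 1 1 X j] X unfolding \<alpha>_def by simp
        also have "\<dots> \<le> g j * (I2 * (exp (m * real j) * X powr \<sigma>\<^sub>1)) * \<alpha> powr \<theta>"
        proof (cases "X \<in> {1..1 * exp 1}")
          case True
          then have "1 \<le> I2" using I2e by simp
          then have "I2 = 1" unfolding I2_def by (cases "snd z \<in> annulus 0 (k + n)") auto
          then show ?thesis using True X2[of j] g(1)[of j]
            by (simp add: mult_right_mono mult_left_mono)
        next
          case False
          then show ?thesis using g(1)[of j] IJ by (simp add: less_imp_le)
        qed
        finally show ?thesis by (simp add: mult_ac)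
      qed
      have b1: "\<bar>X powr (\<sigma>\<^sub>1 + m * real K) * (hcoeff K * e (Suc K) * \<alpha>)\<bar> \<le> hcoeff K * F * (w1 * P)"
      proof (cases "exp 1 < X")
        case True
        then show ?thesis using nest(3) w0 P0 cpos[of K] F by (simp add: less_imp_le)
      next
        case False
        then have I: "I1 = 1" by (simp add: I1_def X_def)
        have "e (Suc K) * \<alpha> \<le> (F * (1 / T) * E) * \<alpha> powr \<theta>"
          using eE[of "Suc K"] e0[of "Suc K"] \<alpha> \<alpha>\<theta> by (intro mult_mono) auto
        also have "\<dots> = F * (1 / T) * (E * \<alpha> powr \<theta>)" by simp
        also have "\<dots> \<le> F * (1 / T) * P" using F T by (intro mult_left_mono P\<alpha>) auto
        finally have "X powr (\<sigma>\<^sub>1 + m * real K) * (hcoeff K * (e (Suc K) * \<alpha>)) \<le> X powr (\<sigma>\<^sub>1 + m * real K) * (hcoeff K * (F * (1 / T) * P))"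
          using cpos[of K] by (intro mult_left_mono) auto
        moreover have "0 \<le> X powr (\<sigma>\<^sub>1 + m * real K) * (hcoeff K * e (Suc K) * \<alpha>)"
          using cpos[of K] e0[of "Suc K"] \<alpha> by (intro mult_nonneg_nonneg) auto
        ultimately show ?thesis unfolding w1_def I by (simp add: mult_ac)
      qed
      have b2: "\<bar>\<Sum>j\<in>{1..K}. hcoeff j * e j * pcut_err CARD('n) (m * real j) 1 1 X\<bar> \<le> S * (w2 * P)"
      proof -
        have "\<bar>\<Sum>j\<in>{1..K}. hcoeff j * e j * pcut_err CARD('n) (m * real j) 1 1 X\<bar>
           \<le> (\<Sum>j\<in>{1..K}. \<bar>hcoeff j * e j * pcut_err CARD('n) (m * real j) 1 1 X\<bar>)" by (rule sum_abs)
        also have "\<dots> \<le> (\<Sum>j\<in>{1..K}. hcoeff j * F * (g j * exp (m * real j)) * (w2 * P))"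
        proof (rule sum_mono)
          fix j assume j: "j \<in> {1..K}"
          have "\<bar>hcoeff j * e j * pcut_err CARD('n) (m * real j) 1 1 X\<bar>
             = hcoeff j * e j * \<bar>pcut_err CARD('n) (m * real j) 1 1 X\<bar>"
            using cpos[of j] e0[of j] j by (simp add: abs_mult)
          also have "\<dots> \<le> hcoeff j * (F * (1 / T) * E) * (g j * exp (m * real j) * (I2 * X powr \<sigma>\<^sub>1) * \<alpha> powr \<theta>)"
            using cpos[of j] e0[of j] j eE[of j] Qb[of j] F T E0 by (intro mult_mono mult_left_mono mult_nonneg_nonneg) auto
          also have "\<dots> = hcoeff j * F * (g j * exp (m * real j)) * (w2 * (E * \<alpha> powr \<theta>))"
            unfolding w2_def by (simp only: mult_ac)
          also have "\<dots> \<le> hcoeff j * F * (g j * exp (m * real j)) * (w2 * P)"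
            using cpos[of j] F g(1)[of j] w0 by (intro mult_left_mono P\<alpha> mult_nonneg_nonneg) auto
          finally show "\<bar>hcoeff j * e j * pcut_err CARD('n) (m * real j) 1 1 X\<bar> \<le> hcoeff j * F * (g j * exp (m * real j)) * (w2 * P)" .
        qed
        also have "\<dots> = S * (w2 * P)" unfolding S_def by (rule sum_distrib_right[symmetric])
        finally show ?thesis .
      qed
      have b3: "\<bar>e 0 * (1 - \<mu>) * pcut_err CARD('n) (m * real 0) 1 1 X\<bar> \<le> g 0 * (w3 * P)"
      proof (cases "t \<le> 2")
        case False
        then have "\<mu> = 1" unfolding \<mu>_def using switch_late(1)[of t] by simp
        then show ?thesis using g(1)[of 0] w0 P0 by (simp add: less_imp_le)
      next
        case True
        then have J1: "J = 1" using t by (simp add: J_def)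
        have "\<bar>e 0 * (1 - \<mu>) * pcut_err CARD('n) (m * real 0) 1 1 X\<bar> = e 0 * (1 - \<mu>) * \<bar>pcut_err CARD('n) (m * real 0) 1 1 X\<bar>"
          using e0[of 0] \<mu> by (simp add: abs_mult)
        also have "\<dots> \<le> E * 1 * (g 0 * exp (m * real 0) * (I2 * X powr \<sigma>\<^sub>1) * \<alpha> powr \<theta>)"
          using e0[of 0] e0E \<mu> Qb[of 0] E0 by (intro mult_mono mult_nonneg_nonneg) auto
        also have "\<dots> = g 0 * (I2 * X powr \<sigma>\<^sub>1) * (E * \<alpha> powr \<theta>)" by simp
        also have "\<dots> \<le> g 0 * (I2 * X powr \<sigma>\<^sub>1) * P"
          using g(1)[of 0] IJ by (intro mult_left_mono P\<alpha>) auto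
        finally show ?thesis unfolding w3_def J1 by simp
      qed
      have diff: "0 \<le> \<phi> - \<alpha>" "\<phi> - \<alpha> \<le> \<phi>" using nest(1) \<alpha> by auto
      have diffI: "\<phi> - \<alpha> \<le> I2 * \<phi>"
      proof (cases "X \<in> {1..exp (real (k + n))}")
        case True
        then have "I2 = 1" unfolding I2_def annulus_def X_def by simp
        then show ?thesis using diff by simp
      next
        case False
        then show ?thesis using nest(2) IJ \<phi> by simp
      qed
      have b4: "\<bar>X powr \<sigma>\<^sub>1 * (e 1 * \<mu> * (\<phi> - \<alpha>))\<bar> \<le> F * (w2 * P)"
      proof -
        have "\<mu> * \<phi> \<le> (\<mu> * \<phi>) powr \<theta>" using \<mu> \<phi> \<theta> by (intro powr_ge_self) (auto simp: mult_le_one)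
        then have "e 1 * (\<mu> * \<phi>) \<le> (F * (1 / T) * E) * (\<mu> * \<phi>) powr \<theta>"
          using eE[of 1] e0[of 1] \<mu> \<phi> by (intro mult_mono) auto
        also have "\<dots> = F * (1 / T) * (E * (\<mu> * \<phi>) powr \<theta>)" by simp
        also have "\<dots> \<le> F * (1 / T) * P" using F T by (intro mult_left_mono P\<mu>\<phi>) auto
        finally have 1: "e 1 * (\<mu> * \<phi>) \<le> F * (1 / T) * P" .
        have "X powr \<sigma>\<^sub>1 * (e 1 * \<mu> * (\<phi> - \<alpha>)) \<le> X powr \<sigma>\<^sub>1 * (e 1 * \<mu> * (I2 * \<phi>))"
          using e0[of 1] \<mu> by (intro mult_left_mono diffI) auto
        also have "\<dots> = X powr \<sigma>\<^sub>1 * I2 * (e 1 * (\<mu> * \<phi>))" by simp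
        also have "\<dots> \<le> X powr \<sigma>\<^sub>1 * I2 * (F * (1 / T) * P)" using IJ by (intro mult_left_mono 1) auto
        also have "\<dots> = F * (w2 * P)" unfolding w2_def by simp
        finally have "X powr \<sigma>\<^sub>1 * (e 1 * \<mu> * (\<phi> - \<alpha>)) \<le> F * (w2 * P)" .
        moreover have "0 \<le> X powr \<sigma>\<^sub>1 * (e 1 * \<mu> * (\<phi> - \<alpha>))"
          using e0[of 1] \<mu> diff by (intro mult_nonneg_nonneg) auto
        ultimately show ?thesis by simp
      qed
      have b5: "\<bar>X powr \<sigma>\<^sub>1 * (e 0 * switch' t * (\<phi> - \<alpha>))\<bar> \<le> Cs * (w3 * P)"
      proof (cases "t \<le> 2")
        case False
        then have "switch' t = 0" using switch_late(2)[of t] by simp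
        then show ?thesis using Cs(1) w0 P0 by (simp add: less_imp_le)
      next
        case True
        then have J1: "J = 1" using t by (simp add: J_def)
        have sw: "\<bar>switch' t\<bar> \<le> Cs * \<mu> powr \<theta>" using Cs(2)[of "2 - t"] by (simp add: switch'_def \<mu>_def switch_def)
        have \<phi>\<theta>: "\<phi> \<le> \<phi> powr \<theta>" using \<phi> \<theta> by (intro powr_ge_self) auto
        have "e 0 * \<bar>switch' t\<bar> * \<phi> \<le> E * (Cs * \<mu> powr \<theta>) * \<phi> powr \<theta>"
          using e0[of 0] e0E sw \<phi> \<phi>\<theta> E0 Cs(1) by (intro mult_mono mult_nonneg_nonneg) auto
        also have "\<dots> = Cs * (E * (\<mu> * \<phi>) powr \<theta>)" using \<mu> \<phi> by (simp add: powr_mult)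
        also have "\<dots> \<le> Cs * P" using Cs(1) by (intro mult_left_mono P\<mu>\<phi>) auto
        finally have 1: "e 0 * \<bar>switch' t\<bar> * \<phi> \<le> Cs * P" .
        have "\<bar>X powr \<sigma>\<^sub>1 * (e 0 * switch' t * (\<phi> - \<alpha>))\<bar> = X powr \<sigma>\<^sub>1 * (e 0 * \<bar>switch' t\<bar> * (\<phi> - \<alpha>))"
          using e0[of 0] diff(1) by (simp add: abs_mult)
        also have "\<dots> \<le> X powr \<sigma>\<^sub>1 * (e 0 * \<bar>switch' t\<bar> * (I2 * \<phi>))"
          using e0[of 0] by (intro mult_left_mono diffI) auto
        also have "\<dots> = X powr \<sigma>\<^sub>1 * I2 * (e 0 * \<bar>switch' t\<bar> * \<phi>)" by simp
        also have "\<dots> \<le> X powr \<sigma>\<^sub>1 * I2 * (Cs * P)" using IJ by (intro mult_left_mono 1) auto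
        also have "\<dots> = Cs * (w3 * P)" unfolding w3_def J1 by simp
        finally show ?thesis .
      qed
      have b6: "\<bar>e 0 * \<mu> * pcut_err CARD('n) (m * real 0) (exp (real k)) (real n) X\<bar> \<le> g 0 * (w4 * P)"
      proof -
        have mt: "\<mu> \<le> \<mu> powr \<theta>" using \<mu> \<theta> by (intro powr_ge_self) auto
        have "\<bar>pcut_err CARD('n) (m * real 0) (exp (real k)) (real n) X\<bar> \<le> g 0 / real n * I3 * X powr (- 2) * \<phi> powr \<theta>"
          using g(2)[of "exp (real k)" "real n" X 0] X n unfolding I3e \<phi>_def by simp
        then have "e 0 * \<mu> * \<bar>pcut_err CARD('n) (m * real 0) (exp (real k)) (real n) X\<bar>
            \<le> E * \<mu> powr \<theta> * (g 0 / real n * I3 * X powr (- 2) * \<phi> powr \<theta>)"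
          using e0[of 0] e0E \<mu> mt E0 by (intro mult_mono mult_nonneg_nonneg) auto
        also have "\<dots> = g 0 * (w4 * (E * (\<mu> * \<phi>) powr \<theta>))" unfolding w4_def using \<mu> \<phi> by (simp add: powr_mult)
        also have "\<dots> \<le> g 0 * (w4 * P)" using g(1)[of 0] w0 by (intro mult_left_mono P\<mu>\<phi>) auto
        finally show ?thesis using e0[of 0] \<mu> by (simp add: abs_mult)
      qed
      have "full_adj s\<^sub>0 K (exp (real k)) (real n) T z =
          X powr (\<sigma>\<^sub>1 + m * real K) * (hcoeff K * e (Suc K) * \<alpha>)
        - (\<Sum>j\<in>{1..K}. hcoeff j * e j * pcut_err CARD('n) (m * real j) 1 1 X)
        - e 0 * (1 - \<mu>) * pcut_err CARD('n) (m * real 0) 1 1 X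
        + X powr \<sigma>\<^sub>1 * (e 1 * \<mu> * (\<phi> - \<alpha>))
        - X powr \<sigma>\<^sub>1 * (e 0 * switch' t * (\<phi> - \<alpha>))
        - e 0 * \<mu> * pcut_err CARD('n) (m * real 0) (exp (real k)) (real n) X"
        unfolding e_def \<alpha>_def \<phi>_def \<mu>_def X_def t_def by (rule full_adj_eq[OF z(2)]) (use n in simp)
      then have "\<bar>full_adj s\<^sub>0 K (exp (real k)) (real n) T z\<bar>
          \<le> hcoeff K * F * (w1 * P) + S * (w2 * P) + g 0 * (w3 * P) + F * (w2 * P) + Cs * (w3 * P) + g 0 * (w4 * P)"
        using b1 b2 b3 b4 b5 b6 by linarith
      also have "\<dots> = hcoeff K * F * (w1 * P) + (S + F) * (w2 * P) + (g 0 + Cs) * (w3 * P) + g 0 * (w4 * P)"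
        by (simp add: algebra_simps)
      also have "\<dots> \<le> C * (w1 * P) + C * (w2 * P) + C * (w3 * P) + C * (w4 * P)"
      proof -
        have "hcoeff K * F \<le> C" "S + F \<le> C" "g 0 + Cs \<le> C" "g 0 \<le> C"
          unfolding C_def using Cparts S F Cs(1) by linarith+
        then show ?thesis using w0 P0 by (intro add_mono[OF add_mono[OF add_mono]] mult_right_mono) auto
      qed
      also have "\<dots> = C * weight K k n T z * P" unfolding weq by (simp add: algebra_simps)
      finally show ?thesis using \<psi>0 unfolding P_def \<psi>_def by simp
    qed
  qed
  show ?thesis
    by (rule that[OF C]) (use main in \<open>auto simp: \<theta>_def\<close>)
qed

end

section \<open>Time integrals\<close>

text \<open>
  Substitution \<open>t = T s\<close>; this is where the factor \<open>T\<^sup>\<rho>\<^sup>+\<^sup>1\<close> in front of the mean of the source comes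
  from.
\<close>

lemma time_integral_scaling:
  fixes g :: "real \<Rightarrow> real"
  assumes \<rho>: "\<rho> > -1" and [measurable]: "g \<in> borel_measurable borel"
    and g: "\<And>s. s > 0 \<Longrightarrow> 0 \<le> g s" "\<And>s. s > 0 \<Longrightarrow> g s \<le> 1" "\<And>s. s \<ge> 1 \<Longrightarrow> g s = 0"
    and T: "T > 0"
  shows "integrable lborel (\<lambda>t. indicator {0<..} t * (t powr \<rho> * g (t / T)))"
    and "(LINT t|lborel. indicator {0<..} t * (t powr \<rho> * g (t / T)))
       = T powr (\<rho> + 1) * (LINT s|lborel. indicator {0<..} s * (s powr \<rho> * g s))"
proof -
  show "integrable lborel (\<lambda>t. indicator {0<..} t * (t powr \<rho> * g (t / T)))"
  proof (rule Bochner_Integration.integrable_bound[OF integrable_powr_from_0[OF \<rho>, of T]])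
    show "AE t in lborel. norm (indicator {0<..} t * (t powr \<rho> * g (t / T))) \<le> norm (indicator {0<..<T} t * t powr \<rho>)"
    proof (rule AE_I2)
      fix t :: real
      show "norm (indicator {0<..} t * (t powr \<rho> * g (t / T))) \<le> norm (indicator {0<..<T} t * t powr \<rho>)"
      proof (cases "0 < t \<and> t < T")
        case True
        then have "\<bar>g (t / T)\<bar> \<le> 1" using g(1,2)[of "t / T"] T by simp
        then have "t powr \<rho> * \<bar>g (t / T)\<bar> \<le> t powr \<rho> * 1" by (intro mult_left_mono) auto
        then show ?thesis using True by (simp add: abs_mult)
      next
        case False
        then have "t \<le> 0 \<or> g (t / T) = 0" using g(3)[of "t / T"] T by (auto simp: le_divide_eq)
        then show ?thesis by auto
      qed
    qed
  qed measurable
  have "(LINT t|lborel. indicator {0<..} t * (t powr \<rho> * g (t / T)))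
     = T * (LINT s|lborel. indicator {0<..} (T * s) * ((T * s) powr \<rho> * g ((T * s) / T)))"
    using lborel_integral_real_affine[of T "\<lambda>t. indicator {0<..} t * (t powr \<rho> * g (t / T))" 0] T by simp
  also have "(\<lambda>s. indicator {0<..} (T * s) * ((T * s) powr \<rho> * g ((T * s) / T)))
     = (\<lambda>s. T powr \<rho> * (indicator {0<..} s * (s powr \<rho> * g s)))"
    using T by (auto simp: indicator_def powr_mult zero_less_mult_iff fun_eq_iff)
  finally show "(LINT t|lborel. indicator {0<..} t * (t powr \<rho> * g (t / T)))
       = T powr (\<rho> + 1) * (LINT s|lborel. indicator {0<..} s * (s powr \<rho> * g s))"
    using T by (simp add: powr_add)
qed

lemma time_integral_pos:
  fixes g :: "real \<Rightarrow> real"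
  assumes \<rho>: "\<rho> > -1" and [measurable]: "g \<in> borel_measurable borel"
    and g: "\<And>s. s > 0 \<Longrightarrow> 0 \<le> g s" "\<And>s. s > 0 \<Longrightarrow> g s \<le> 1" "\<And>s. s \<ge> 1 \<Longrightarrow> g s = 0"
    and c: "c > 0" "\<And>s. 1/4 \<le> s \<Longrightarrow> s \<le> 1/2 \<Longrightarrow> c \<le> g s"
  shows "0 < (LINT s|lborel. indicator {0<..} s * (s powr \<rho> * g s))"
proof -
  define d where "d = (1/4) powr \<bar>\<rho>\<bar> * c"
  have d: "d > 0" using c(1) by (simp add: d_def)
  have i: "integrable lborel (\<lambda>s. indicator {0<..} s * (s powr \<rho> * g s))"
    using time_integral_scaling(1)[OF \<rho> assms(2) g, of 1] by simp
  have j: "integrable lborel (\<lambda>s. d * indicator {1/4..1/2::real} s)"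
    by (intro integrable_mult_right integrable_real_indicator) auto
  have "d * indicator {1/4..1/2} s \<le> indicator {0<..} s * (s powr \<rho> * g s)" for s
  proof (cases "s \<in> {1/4..1/2}")
    case True
    have "(1/4) powr \<bar>\<rho>\<bar> \<le> s powr \<bar>\<rho>\<bar>" using True by (intro powr_mono2) auto
    also have "\<dots> \<le> s powr \<rho>" using True by (intro powr_mono') auto
    finally have "d \<le> s powr \<rho> * g s" unfolding d_def using True c by (intro mult_mono) auto
    then show ?thesis using True by simp
  next
    case False
    then show ?thesis using g(1)[of s] by (auto simp: indicator_def)
  qed
  then have "(LINT s|lborel. d * indicator {1/4..1/2::real} s) \<le> (LINT s|lborel. indicator {0<..} s * (s powr \<rho> * g s))"
    by (intro integral_mono i j)
  moreover have "(LINT s|lborel. d * indicator {1/4..1/2::real} s) = d * (1/4)" by simp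
  ultimately show ?thesis using d by linarith
qed

lemma powr_sum4_le:
  fixes a b c d q :: real
  assumes "a \<ge> 0" "b \<ge> 0" "c \<ge> 0" "d \<ge> 0" "q > 0"
  shows "(a + b + c + d) powr q \<le> 4 powr q * (a powr q + b powr q + c powr q + d powr q)"
proof -
  define M where "M = max (max a b) (max c d)"
  have M: "a \<le> M" "b \<le> M" "c \<le> M" "d \<le> M" by (auto simp: M_def)
  have "(a + b + c + d) powr q \<le> (4 * M) powr q" using assms M by (intro powr_mono2) auto
  also have "\<dots> = 4 powr q * M powr q" by (rule powr_mult)
  finally have "(a + b + c + d) powr q \<le> 4 powr q * M powr q" .
  also have "\<dots> \<le> 4 powr q * (a powr q + b powr q + c powr q + d powr q)"
  proof (intro mult_left_mono)
    have "M = a \<or> M = b \<or> M = c \<or> M = d" by (auto simp: M_def max_def)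
    moreover have "0 \<le> a powr q" "0 \<le> b powr q" "0 \<le> c powr q" "0 \<le> d powr q" by simp_all
    ultimately show "M powr q \<le> a powr q + b powr q + c powr q + d powr q" by (elim disjE) simp_all
  qed simp
  finally show ?thesis .
qed

lemma integral_sum4:
  fixes f\<^sub>1 f\<^sub>2 f\<^sub>3 f\<^sub>4 :: "'a \<Rightarrow> real"
  assumes "integrable M f\<^sub>1" "integrable M f\<^sub>2" "integrable M f\<^sub>3" "integrable M f\<^sub>4"
  shows "(LINT z|M. c * (f\<^sub>1 z + f\<^sub>2 z + f\<^sub>3 z + f\<^sub>4 z))
    = c * (integral\<^sup>L M f\<^sub>1 + integral\<^sup>L M f\<^sub>2 + integral\<^sup>L M f\<^sub>3 + integral\<^sup>L M f\<^sub>4)"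
  using assms by simp

lemma weighted_power:
  fixes X c s g q :: real
  assumes X: "X > 0" and c: "c \<ge> 0" and a: "a \<in> {0, 1::real}" and b: "b \<in> {0, 1::real}" and q: "q > 0"
  shows "X powr (- s) * (a * (c * (b * X powr g))) powr q = a * (c powr q * (b * X powr (g * q - s)))"
proof (cases "a = 1 \<and> b = 1")
  case True
  have "X powr (- s) * (c * X powr g) powr q = c powr q * (X powr (g * q) * X powr (- s))"
    using X c by (simp add: powr_mult powr_powr)
  also have "X powr (g * q) * X powr (- s) = X powr (g * q - s)" by (simp flip: powr_add)
  finally show ?thesis using True by simp
next
  case False
  then show ?thesis using a b q by auto
qed

context weak_solution
begin

abbreviation p' :: real where "p' \<equiv> p / (p - 1)"
abbreviation \<gamma>\<^sub>1 :: "nat \<Rightarrow> real" where "\<gamma>\<^sub>1 K \<equiv> (\<sigma>\<^sub>1 + m * real K) * p' - \<sigma>\<^sub>2 / (p - 1)"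
abbreviation \<gamma>\<^sub>2 :: real where "\<gamma>\<^sub>2 \<equiv> \<sigma>\<^sub>1 * p' - \<sigma>\<^sub>2 / (p - 1)"
abbreviation \<gamma>\<^sub>3 :: real where "\<gamma>\<^sub>3 \<equiv> - 2 * p' - \<sigma>\<^sub>2 / (p - 1)"

text \<open>
  Up to a constant, the integral of \<open>\<bar>x\<bar>\<^sup>g\<close> over \<open>annulus k l\<close>.
\<close>

abbreviation shell_sum :: "nat \<Rightarrow> nat \<Rightarrow> real \<Rightarrow> real" where
  "shell_sum k l g \<equiv> (\<Sum>j\<in>{k..<l}. exp (real j * (dimn + g)))"

text \<open>
  The mean of the source under the cutoff with radii \<open>exp k\<close> and \<open>exp (k + n)\<close>. It tends to the
  integral of \<open>w\<close> and therefore has to become positive.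
\<close>

definition mean_w :: "nat \<Rightarrow> nat \<Rightarrow> real" where
  "mean_w k n = (LINT x|lborel. w x * pcut 0 (exp (real k)) (real n) ((norm x)\<^sup>2))"

lemma p'_gt: "p' > 1" using p by (simp add: field_simps)

lemma bounded_w_integrable:
  assumes [measurable]: "h \<in> borel_measurable borel" and B: "\<And>x. \<bar>h x\<bar> \<le> B"
  shows "integrable lborel (\<lambda>x. w x * h x)" and "\<bar>LINT x|lborel. w x * h x\<bar> \<le> B * (LINT x|lborel. \<bar>w x\<bar>)"
proof -
  have i: "integrable lborel (\<lambda>x. B * \<bar>w x\<bar>)" using w_lborel by simp
  have le: "\<bar>w x * h x\<bar> \<le> B * \<bar>w x\<bar>" for x
    using mult_left_mono[OF B[of x], of "\<bar>w x\<bar>"] by (simp add: abs_mult mult.commute)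
  then show j: "integrable lborel (\<lambda>x. w x * h x)"
    by (intro Bochner_Integration.integrable_bound[OF i]) (auto intro: order_trans[OF _ abs_ge_self])
  have "\<bar>LINT x|lborel. w x * h x\<bar> \<le> (LINT x|lborel. \<bar>w x * h x\<bar>)" by (rule integral_abs_bound)
  also have "\<dots> \<le> (LINT x|lborel. B * \<bar>w x\<bar>)" by (intro integral_mono integrable_abs i j le)
  finally show "\<bar>LINT x|lborel. w x * h x\<bar> \<le> B * (LINT x|lborel. \<bar>w x\<bar>)" by simp
qed

lemma pcut_unit_bound:
  assumes "q \<ge> 0"
  shows "0 \<le> pcut q 1 1 ((norm (x :: real ^ 'n))\<^sup>2)" "pcut q 1 1 ((norm x)\<^sup>2) \<le> exp q"
    "x \<notin> ball 0 3 \<Longrightarrow> pcut q 1 1 ((norm x)\<^sup>2) = 0"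
proof -
  show "0 \<le> pcut q 1 1 ((norm x)\<^sup>2)" unfolding pcut_def using cut_bounds by simp
  have out: "pcut q 1 1 ((norm x)\<^sup>2) = 0" if "exp 1 \<le> norm x" using pcut_outer(1)[of 1 1 "norm x" q] that by simp
  show "x \<notin> ball 0 3 \<Longrightarrow> pcut q 1 1 ((norm x)\<^sup>2) = 0" using out exp_le by auto
  show "pcut q 1 1 ((norm x)\<^sup>2) \<le> exp q"
  proof (cases "x = 0 \<or> exp 1 \<le> norm x")
    case True
    then show ?thesis using out by (auto simp: pcut_def)
  next
    case False
    have "norm x powr q * cut 1 1 ((norm x)\<^sup>2) \<le> exp 1 powr q * 1"
      using False assms cut_bounds by (intro mult_mono powr_mono2) auto
    then show ?thesis using False by (simp add: pcut_norm powr_def)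
  qed
qed

lemma pcut_0_bound: "0 \<le> pcut 0 R L s" "pcut 0 R L s \<le> 1"
  using cut_bounds[of R L s] by (auto simp: pcut_def)

lemma set_integral_product:
  fixes h :: "real \<Rightarrow> real" and v :: "real ^ 'n \<Rightarrow> real"
  assumes h: "integrable lborel (\<lambda>t. indicator {0<..} t * (t powr \<rho> * h t))"
    and v: "integrable lborel (\<lambda>x. w x * v x)"
  shows "set_integrable lebesgue half_space (\<lambda>z. fst z powr \<rho> * w (snd z) * (h (fst z) * v (snd z)))"
    and "(LINT z:half_space|lebesgue. fst z powr \<rho> * w (snd z) * (h (fst z) * v (snd z)))
       = (LINT t|lborel. indicator {0<..} t * (t powr \<rho> * h t)) * (LINT x|lborel. w x * v x)"
proof -
  define f where "f z = (indicator {0<..} (fst z) * (fst z powr \<rho> * h (fst z))) * (w (snd z) * v (snd z))" for z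
  have f: "integrable lborel f" "integral\<^sup>L lborel f
     = (LINT t|lborel. indicator {0<..} t * (t powr \<rho> * h t)) * (LINT x|lborel. w x * v x)"
    unfolding f_def[abs_def] using lborel_integral_product[OF h v] by auto
  have [measurable]: "f \<in> borel_measurable borel" using borel_measurable_integrable[OF f(1)] by simp
  have e: "(\<lambda>z. indicator half_space z *\<^sub>R (fst z powr \<rho> * w (snd z) * (h (fst z) * v (snd z)))) = f"
    by (auto simp: f_def fun_eq_iff indicator_def)
  show "set_integrable lebesgue half_space (\<lambda>z. fst z powr \<rho> * w (snd z) * (h (fst z) * v (snd z)))"
    unfolding set_integrable_def e using f by (simp add: lebesgue_lborel_integral)
  show "(LINT z:half_space|lebesgue. fst z powr \<rho> * w (snd z) * (h (fst z) * v (snd z)))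
       = (LINT t|lborel. indicator {0<..} t * (t powr \<rho> * h t)) * (LINT x|lborel. w x * v x)"
    unfolding set_lebesgue_integral_def e using f by (simp add: lebesgue_lborel_integral)
qed

lemma integrable_time_space:
  fixes v :: "real ^ 'n \<Rightarrow> real"
  assumes "integrable lborel v" "0 \<le> T"
  shows "integrable lborel (\<lambda>z. indicator {0..T} (fst z) * (c * v (snd z)))"
    and "(LINT z|lborel. indicator {0..T} (fst z) * (c * v (snd z))) = T * (c * (LINT x|lborel. v x))"
proof -
  have h: "integrable lborel (indicator {0..T} :: real \<Rightarrow> real)"
    by (intro integrable_real_indicator) (auto simp: emeasure_lborel_Icc_eq)
  have v: "integrable lborel (\<lambda>x. c * v x)" using assms by simp
  show "integrable lborel (\<lambda>z. indicator {0..T} (fst z) * (c * v (snd z)))"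
    by (rule lborel_integral_product(1)[OF h v])
  have "(LINT t|lborel. indicator {0..T} t) = T" using assms(2) by simp
  then show "(LINT z|lborel. indicator {0..T} (fst z) * (c * v (snd z))) = T * (c * (LINT x|lborel. v x))"
    using lborel_integral_product(2)[OF h v] by simp
qed

text \<open>
  Each part of the residual is a product of a time interval and a power of \<open>\<bar>x\<bar>\<close> on a ball or an annulus,
  so its contribution factorises. The hypothesis on \<open>K\<close> makes the power at the origin integrable.
  Factors \<open>T\<close> to the power \<open>1 - p'\<close> are bounded by 1.
\<close>

lemma weight_integral:
  assumes K: "\<gamma>\<^sub>1 K > - dimn" and C: "C \<ge> 0"
  obtains W D where "D > 0" "\<And>k n T z. 0 \<le> W k n T z"
    "\<And>k n T z. 1 \<le> T \<Longrightarrow> snd z \<noteq> 0 \<Longrightarrow>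
        norm (snd z) powr (- (\<sigma>\<^sub>2 / (p - 1))) * (C * weight K k n T z) powr p' \<le> W k n T z"
    "\<And>k n T. 1 \<le> k \<Longrightarrow> 1 \<le> n \<Longrightarrow> 1 \<le> T \<Longrightarrow> integrable lborel (W k n T)"
    "\<And>k n T. 1 \<le> k \<Longrightarrow> 1 \<le> n \<Longrightarrow> 1 \<le> T \<Longrightarrow> (LINT z|lborel. W k n T z) \<le>
        D * (1 + (shell_sum 0 (k + n) \<gamma>\<^sub>2)
          + T * (1 / real n) powr p' * (shell_sum k (k + n) \<gamma>\<^sub>3))"
proof -
  define v1 where "v1 = (\<lambda>x :: real ^ 'n. indicator (cball 0 (exp 1)) x * norm x powr \<gamma>\<^sub>1 K)"
  define v2 where "v2 l = (\<lambda>x :: real ^ 'n. indicator (annulus 0 l) x * norm x powr \<gamma>\<^sub>2)" for l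
  define v3 where "v3 k l = (\<lambda>x :: real ^ 'n. indicator (annulus k l) x * norm x powr \<gamma>\<^sub>3)" for k l
  obtain A1 where A1: "A1 > 0" "integrable lborel v1" "integral\<^sup>L lborel v1 \<le> A1"
  proof -
    have K': "\<gamma>\<^sub>1 K > - real CARD('n)" using K by (simp only: dimn)
    obtain A where A: "A > 0"
      "\<And>r. r > 0 \<Longrightarrow> integrable lborel (\<lambda>x :: real ^ 'n. indicator (cball 0 r) x * norm x powr \<gamma>\<^sub>1 K)"
      "\<And>r. r > 0 \<Longrightarrow> (LINT x|lborel. indicator (cball (0 :: real ^ 'n) r) x * norm x powr \<gamma>\<^sub>1 K) \<le> A * r powr (real CARD('n) + \<gamma>\<^sub>1 K)"
      by (rule integral_powr_ball[OF K']) (rule that; assumption)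
    show ?thesis
    proof (rule that[of "A * exp 1 powr (real CARD('n) + \<gamma>\<^sub>1 K)"])
      show "0 < A * exp 1 powr (real CARD('n) + \<gamma>\<^sub>1 K)" using A(1) by simp
      show "integrable lborel v1" unfolding v1_def by (rule A(2)) simp
      show "integral\<^sup>L lborel v1 \<le> A * exp 1 powr (real CARD('n) + \<gamma>\<^sub>1 K)" unfolding v1_def by (rule A(3)) simp
    qed
  qed
  obtain A2 where A2': "A2 > 0"
    "\<And>k l. k < l \<Longrightarrow> integrable lborel (\<lambda>x :: real ^ 'n. indicator (annulus k l) x * norm x powr \<gamma>\<^sub>2)"
    "\<And>k l. k < l \<Longrightarrow> (LINT x|lborel. indicator (annulus k l) x * norm (x :: real ^ 'n) powr \<gamma>\<^sub>2)
       \<le> A2 * (shell_sum k l \<gamma>\<^sub>2)"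
    by (rule integral_powr_annulus[where 'n='n and g=\<gamma>\<^sub>2, folded dimn]) (rule that; assumption)
  note A2 = A2'(1) A2'(2)[of 0, folded v2_def] A2'(3)[of 0, folded v2_def]
  obtain A3 where A3': "A3 > 0"
    "\<And>k l. k < l \<Longrightarrow> integrable lborel (\<lambda>x :: real ^ 'n. indicator (annulus k l) x * norm x powr \<gamma>\<^sub>3)"
    "\<And>k l. k < l \<Longrightarrow> (LINT x|lborel. indicator (annulus k l) x * norm (x :: real ^ 'n) powr \<gamma>\<^sub>3)
       \<le> A3 * (shell_sum k l \<gamma>\<^sub>3)"
    by (rule integral_powr_annulus[where 'n='n and g=\<gamma>\<^sub>3, folded dimn]) (rule that; assumption)
  note A3 = A3'(1) A3'(2)[folded v3_def] A3'(3)[folded v3_def]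
  define c where "c = C powr p' * 4 powr p'"
  have c: "c \<ge> 0" by (simp add: c_def)
  define W where "W k n T z = c * (indicator {0..T} (fst z) * ((1 / T) powr p' * v1 (snd z))
     + indicator {0..T} (fst z) * ((1 / T) powr p' * v2 (k + n) (snd z))
     + indicator {0..2} (fst z) * (1 * v2 (k + n) (snd z))
     + indicator {0..T} (fst z) * ((1 / real n) powr p' * v3 k (k + n) (snd z)))"
    for k n T and z :: "real \<times> (real ^ 'n)"
  have v0: "0 \<le> v1 x" "0 \<le> v2 l x" "0 \<le> v3 k l x" for x k l by (auto simp: v1_def v2_def v3_def)
  have W0: "0 \<le> W k n T z" for k n T z
    unfolding W_def using c v0 by (intro mult_nonneg_nonneg add_nonneg_nonneg) auto
  have Wge: "norm (snd z) powr (- (\<sigma>\<^sub>2 / (p - 1))) * (C * weight K k n T z) powr p' \<le> W k n T z"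
    if T: "1 \<le> T" and x: "snd z \<noteq> 0" for k n T z
  proof -
    define X where "X = norm (snd z)"
    have X: "X > 0" using x by (simp add: X_def)
    have q: "p' > 0" using p'_gt by simp
    define a1 where "a1 = indicator {0..T} (fst z) * (1 / T * (indicator (cball 0 (exp 1)) (snd z) * X powr (\<sigma>\<^sub>1 + m * real K)))"
    define a2 where "a2 = indicator {0..T} (fst z) * (1 / T * (indicator (annulus 0 (k + n)) (snd z) * X powr \<sigma>\<^sub>1))"
    define a3 where "a3 = indicator {0..2} (fst z) * (1 * (indicator (annulus 0 (k + n)) (snd z) * X powr \<sigma>\<^sub>1))"
    define a4 where "a4 = indicator {0..T} (fst z) * (1 / real n * (indicator (annulus k (k + n)) (snd z) * X powr (- 2)))"
    have a: "0 \<le> a1" "0 \<le> a2" "0 \<le> a3" "0 \<le> a4" using T by (auto simp: a1_def a2_def a3_def a4_def)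
    have we: "weight K k n T z = a1 + a2 + a3 + a4"
      unfolding weight_def a1_def a2_def a3_def a4_def X_def by simp
    have ind': "indicator S y \<in> {0, 1::real}" for S and y :: real by (auto simp: indicator_def)
    have ind'': "indicator S y \<in> {0, 1::real}" for S and y :: "real ^ 'n" by (auto simp: indicator_def)
    have pw1: "X powr (- (\<sigma>\<^sub>2 / (p - 1))) * a1 powr p' = indicator {0..T} (fst z) * ((1 / T) powr p' * v1 (snd z))"
      unfolding a1_def v1_def X_def[symmetric]
      by (subst weighted_power[OF X _ ind' ind'' q]) (use T in simp_all)
    have pw2: "X powr (- (\<sigma>\<^sub>2 / (p - 1))) * a2 powr p' = indicator {0..T} (fst z) * ((1 / T) powr p' * v2 (k + n) (snd z))"
      unfolding a2_def v2_def X_def[symmetric]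
      by (subst weighted_power[OF X _ ind' ind'' q]) (use T in simp_all)
    have pw3: "X powr (- (\<sigma>\<^sub>2 / (p - 1))) * a3 powr p' = indicator {0..2} (fst z) * (1 * v2 (k + n) (snd z))"
      unfolding a3_def v2_def X_def[symmetric]
      by (subst weighted_power[OF X _ ind' ind'' q]) (use T in simp_all)
    have pw4: "X powr (- (\<sigma>\<^sub>2 / (p - 1))) * a4 powr p' = indicator {0..T} (fst z) * ((1 / real n) powr p' * v3 k (k + n) (snd z))"
      unfolding a4_def v3_def X_def[symmetric]
      by (subst weighted_power[OF X _ ind' ind'' q]) (use T in simp_all)
    have "(C * weight K k n T z) powr p' = C powr p' * (a1 + a2 + a3 + a4) powr p'"
      unfolding we by (rule powr_mult)
    also have "\<dots> \<le> C powr p' * (4 powr p' * (a1 powr p' + a2 powr p' + a3 powr p' + a4 powr p'))"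
      using a q by (intro mult_left_mono powr_sum4_le) auto
    finally have "X powr (- (\<sigma>\<^sub>2 / (p - 1))) * (C * weight K k n T z) powr p'
       \<le> X powr (- (\<sigma>\<^sub>2 / (p - 1))) * (C powr p' * (4 powr p' * (a1 powr p' + a2 powr p' + a3 powr p' + a4 powr p')))"
      by (rule mult_left_mono) simp
    also have "\<dots> = c * (X powr (- (\<sigma>\<^sub>2 / (p - 1))) * a1 powr p' + X powr (- (\<sigma>\<^sub>2 / (p - 1))) * a2 powr p'
        + X powr (- (\<sigma>\<^sub>2 / (p - 1))) * a3 powr p' + X powr (- (\<sigma>\<^sub>2 / (p - 1))) * a4 powr p')"
      unfolding c_def by (simp add: algebra_simps)
    also have "\<dots> = W k n T z" unfolding pw1 pw2 pw3 pw4 W_def by (rule refl)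
    finally show ?thesis unfolding X_def .
  qed
  define D where "D = c * A1 + 3 * (c * A2) + c * A3 + 1"
  have AA: "0 \<le> c * A1" "0 \<le> c * A2" "0 \<le> c * A3" using c A1(1) A2(1) A3(1) by auto
  have D: "D > 0" and Dge: "c * A1 \<le> D" "3 * (c * A2) \<le> D" "c * A3 \<le> D"
    unfolding D_def using AA by linarith+
  have WI: "integrable lborel (W k n T) \<and> (LINT z|lborel. W k n T z) \<le>
        D * (1 + (shell_sum 0 (k + n) \<gamma>\<^sub>2)
          + T * (1 / real n) powr p' * (shell_sum k (k + n) \<gamma>\<^sub>3))"
    if kn: "1 \<le> k" "1 \<le> n" and T: "1 \<le> T" for k n T
  proof -
    define S2 where "S2 = (shell_sum 0 (k + n) \<gamma>\<^sub>2)"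
    define S3 where "S3 = (shell_sum k (k + n) \<gamma>\<^sub>3)"
    have S: "0 \<le> S2" "0 \<le> S3" unfolding S2_def S3_def by (intro sum_nonneg; simp)+
    have i2: "integrable lborel (v2 (k + n))" and i3: "integrable lborel (v3 k (k + n))"
      using A2(2)[of "k + n"] A3(2)[of k "k + n"] kn by auto
    have T0: "0 \<le> T" "(0::real) \<le> 2" using T by auto
    note t1 = integrable_time_space[OF A1(2) T0(1), of "(1 / T) powr p'"]
    note t2 = integrable_time_space[OF i2 T0(1), of "(1 / T) powr p'"]
    note t3 = integrable_time_space[OF i2 T0(2), of 1]
    note t4 = integrable_time_space[OF i3 T0(1), of "(1 / real n) powr p'"]
    have i: "integrable lborel (W k n T)" unfolding W_def[abs_def]
      by (intro integrable_mult_right Bochner_Integration.integrable_add t1(1) t2(1) t3(1) t4(1))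
    have "(LINT z|lborel. W k n T z) = c * (T * ((1 / T) powr p' * integral\<^sup>L lborel v1)
        + T * ((1 / T) powr p' * integral\<^sup>L lborel (v2 (k + n))) + 2 * (1 * integral\<^sup>L lborel (v2 (k + n)))
        + T * ((1 / real n) powr p' * integral\<^sup>L lborel (v3 k (k + n))))"
      unfolding W_def[abs_def] t1(2)[symmetric] t2(2)[symmetric] t3(2)[symmetric] t4(2)[symmetric]
      by (rule integral_sum4[OF t1(1) t2(1) t3(1) t4(1)])
    also have "\<dots> \<le> c * (A1 + A2 * S2 + 2 * (A2 * S2) + T * (1 / real n) powr p' * (A3 * S3))"
    proof -
      have "T * (1 / T) powr p' \<le> T * (1 / T) powr 1"
        using T p'_gt by (intro mult_left_mono powr_mono') auto
      then have 1: "T * (1 / T) powr p' \<le> 1" using T by simp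
      have "(T * (1 / T) powr p') * integral\<^sup>L lborel v1 \<le> 1 * A1"
        using 1 A1 T v0 by (intro mult_mono Bochner_Integration.integral_nonneg) auto
      then have e1: "T * ((1 / T) powr p' * integral\<^sup>L lborel v1) \<le> A1" by simp
      have b2: "integral\<^sup>L lborel (v2 (k + n)) \<le> A2 * S2" unfolding S2_def using kn by (intro A2(3)) auto
      have "(T * (1 / T) powr p') * integral\<^sup>L lborel (v2 (k + n)) \<le> 1 * (A2 * S2)"
        using 1 b2 T v0 by (intro mult_mono Bochner_Integration.integral_nonneg) auto
      then have e2: "T * ((1 / T) powr p' * integral\<^sup>L lborel (v2 (k + n))) \<le> A2 * S2" by simp
      have b3: "integral\<^sup>L lborel (v3 k (k + n)) \<le> A3 * S3" unfolding S3_def using kn by (intro A3(3)) auto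
      have "T * (1 / real n) powr p' * integral\<^sup>L lborel (v3 k (k + n)) \<le> T * (1 / real n) powr p' * (A3 * S3)"
        using T by (intro mult_left_mono b3) auto
      then have e3: "T * ((1 / real n) powr p' * integral\<^sup>L lborel (v3 k (k + n))) \<le> T * (1 / real n) powr p' * (A3 * S3)"
        by simp
      show ?thesis using e1 e2 b2 e3 by (intro mult_left_mono[OF _ c]) linarith
    qed
    also have "\<dots> = (c * A1) * 1 + (3 * (c * A2)) * S2 + (c * A3) * (T * (1 / real n) powr p' * S3)"
      by (simp add: algebra_simps)
    also have "\<dots> \<le> D * 1 + D * S2 + D * (T * (1 / real n) powr p' * S3)"
      using T S by (intro add_mono mult_right_mono Dge mult_nonneg_nonneg) auto
    also have "\<dots> = D * (1 + S2 + T * (1 / real n) powr p' * S3)" by (simp add: algebra_simps)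
    finally show ?thesis using i unfolding S2_def S3_def by blast
  qed
  show ?thesis
    by (rule that[of D W, OF D W0 Wge conjunct1[OF WI] conjunct2[OF WI]])
qed

end

section \<open>The inequality for the corrected test function\<close>

context weak_solution
begin

lemma set_integral_sum:
  fixes f :: "nat \<Rightarrow> 'a \<Rightarrow> real"
  assumes "\<And>i. i \<in> I \<Longrightarrow> set_integrable M A (f i)"
  shows "set_integrable M A (\<lambda>z. \<Sum>i\<in>I. f i z)"
    and "(LINT z:A|M. (\<Sum>i\<in>I. f i z)) = (\<Sum>i\<in>I. (LINT z:A|M. f i z))"
proof -
  have e: "(\<lambda>z. indicator A z *\<^sub>R (\<Sum>i\<in>I. f i z)) = (\<lambda>z. \<Sum>i\<in>I. indicator A z *\<^sub>R f i z)"
    by (simp add: sum_distrib_left)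
  show "set_integrable M A (\<lambda>z. \<Sum>i\<in>I. f i z)"
    using assms unfolding set_integrable_def e by (rule Bochner_Integration.integrable_sum)
  show "(LINT z:A|M. (\<Sum>i\<in>I. f i z)) = (\<Sum>i\<in>I. (LINT z:A|M. f i z))"
    using assms unfolding set_lebesgue_integral_def e set_integrable_def
    by (rule Bochner_Integration.integral_sum)
qed

text \<open>
  The value is \<open>1 / (\<rho> + 1)\<close>.
\<close>

definition \<kappa>\<^sub>1 :: real where
  "\<kappa>\<^sub>1 = (LINT s|lborel. indicator {0<..} s * (s powr \<rho> * indicator {..<1} s))"

lemma \<kappa>\<^sub>1_nonneg: "\<kappa>\<^sub>1 \<ge> 0"
  unfolding \<kappa>\<^sub>1_def by (intro Bochner_Integration.integral_nonneg) auto

lemma time_integral_bound: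
  assumes [measurable]: "h \<in> borel_measurable borel" and T: "T > 0"
    and h: "\<And>t. t > 0 \<Longrightarrow> \<bar>h t\<bar> \<le> B" "\<And>t. t \<ge> T \<Longrightarrow> h t = 0"
  shows "integrable lborel (\<lambda>t. indicator {0<..} t * (t powr \<rho> * h t))"
    and "\<bar>LINT t|lborel. indicator {0<..} t * (t powr \<rho> * h t)\<bar> \<le> B * (T powr (\<rho> + 1) * \<kappa>\<^sub>1)"
proof -
  define g where "g = (indicator {..<1} :: real \<Rightarrow> real)"
  have gm: "g \<in> borel_measurable borel" by (simp add: g_def)
  have g: "0 \<le> g s" "g s \<le> 1" "1 \<le> s \<Longrightarrow> g s = 0" for s by (auto simp: g_def indicator_def)
  note sc = time_integral_scaling[where g=g, OF \<rho> gm g T]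
  have i: "integrable lborel (\<lambda>t. B * (indicator {0<..} t * (t powr \<rho> * g (t / T))))"
    using sc(1) by simp
  have le: "\<bar>indicator {0<..} t * (t powr \<rho> * h t)\<bar> \<le> B * (indicator {0<..} t * (t powr \<rho> * g (t / T)))" for t
  proof (cases "0 < t \<and> t < T")
    case True
    then have "t powr \<rho> * \<bar>h t\<bar> \<le> t powr \<rho> * B" using h(1)[of t] by (intro mult_left_mono) auto
    then show ?thesis using True T by (simp add: abs_mult g_def mult.commute)
  next
    case False
    then have "t \<le> 0 \<or> h t = 0" using h(2)[of t] by auto
    moreover have "0 \<le> B" using h(1)[of 1] by linarith
    ultimately show ?thesis using g(1) by (auto simp: indicator_def)
  qed
  show j: "integrable lborel (\<lambda>t. indicator {0<..} t * (t powr \<rho> * h t))"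
    by (rule Bochner_Integration.integrable_bound[OF i]) (use le in \<open>auto intro: order_trans[OF _ abs_ge_self]\<close>)
  have "\<bar>LINT t|lborel. indicator {0<..} t * (t powr \<rho> * h t)\<bar> \<le> (LINT t|lborel. \<bar>indicator {0<..} t * (t powr \<rho> * h t)\<bar>)"
    by (rule integral_abs_bound)
  also have "\<dots> \<le> (LINT t|lborel. B * (indicator {0<..} t * (t powr \<rho> * g (t / T))))"
    by (intro integral_mono integrable_abs i j le)
  also have "\<dots> = B * (T powr (\<rho> + 1) * \<kappa>\<^sub>1)" using sc(2) by (simp add: \<kappa>\<^sub>1_def g_def)
  finally show "\<bar>LINT t|lborel. indicator {0<..} t * (t powr \<rho> * h t)\<bar> \<le> B * (T powr (\<rho> + 1) * \<kappa>\<^sub>1)" .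
qed

lemma heat_time_bound:
  fixes K :: nat
  assumes s0: "0 < s\<^sub>0" "s\<^sub>0 \<le> 1"
    and flat_pos: "\<And>j s. j \<le> Suc K \<Longrightarrow> s \<le> s\<^sub>0 \<Longrightarrow> 0 \<le> flat j s"
  obtains F where "F > 0" "\<And>j T t. j \<le> K \<Longrightarrow> 1 \<le> T \<Longrightarrow> 0 \<le> t \<Longrightarrow> \<bar>heat_time s\<^sub>0 T j t\<bar> \<le> F"
    "\<And>j T t. 1 \<le> j \<Longrightarrow> j \<le> K \<Longrightarrow> 1 \<le> T \<Longrightarrow> 0 \<le> t \<Longrightarrow> \<bar>heat_time s\<^sub>0 T j t\<bar> \<le> F / T"
proof -
  have "\<exists>C>0. \<forall>s. \<bar>flat j s\<bar> \<le> C" for j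
  proof -
    \<comment> \<open>Exponent 0 turns the fractional bound into boundedness.\<close>
    obtain C where C: "C > 0" "\<And>s. \<bar>flat j s\<bar> \<le> C * flat 0 s powr 0"
      by (rule flat_le_powr[of 0 j]) auto
    have "\<bar>flat j s\<bar> \<le> C" for s using C(2)[of s] C(1) by (cases "flat 0 s = 0") auto
    then show ?thesis using C(1) by blast
  qed
  then obtain f where f: "\<And>j. f j > 0" "\<And>j s. \<bar>flat j s\<bar> \<le> f j" by metis
  define F where "F = (\<Sum>j\<le>K. f j)"
  have fF: "f j \<le> F" if "j \<le> K" for j
    unfolding F_def using that f(1) by (intro member_le_sum) (auto simp: less_imp_le)
  have F: "F > 0" using fF[of 0] f(1)[of 0] by simp
  have 1: "\<bar>heat_time s\<^sub>0 T j t\<bar> \<le> (s\<^sub>0 / T) ^ j * F" if "j \<le> K" "1 \<le> T" for j T t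
  proof -
    have "\<bar>flat j (s\<^sub>0 * (1 - t / T))\<bar> \<le> F" using f(2) fF[OF that(1)] order_trans by blast
    then show ?thesis unfolding heat_time_def abs_mult using s0 that by (simp add: mult_left_mono)
  qed
  have sT: "0 < s\<^sub>0 / T" "s\<^sub>0 / T \<le> 1" "s\<^sub>0 / T \<le> 1 / T" if "1 \<le> T" for T
    using s0 that by (auto intro: divide_right_mono)
  show ?thesis
  proof (rule that[OF F])
    fix j T t assume a: "j \<le> K" "(1::real) \<le> T" "(0::real) \<le> t"
    have "(s\<^sub>0 / T) ^ j \<le> 1" using sT[OF a(2)] by (intro power_le_one) auto
    then have "(s\<^sub>0 / T) ^ j * F \<le> 1 * F" using F by (intro mult_right_mono) auto
    then show "\<bar>heat_time s\<^sub>0 T j t\<bar> \<le> F" using 1[OF a(1,2), of t] by simp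
  next
    fix j T t assume a: "1 \<le> j" "j \<le> K" "(1::real) \<le> T" "(0::real) \<le> t"
    have "(s\<^sub>0 / T) ^ j \<le> (s\<^sub>0 / T) ^ 1" using sT[OF a(3)] a(1) by (intro power_decreasing) auto
    then have "(s\<^sub>0 / T) ^ j \<le> 1 / T" using sT[OF a(3)] by simp
    then have "(s\<^sub>0 / T) ^ j * F \<le> 1 / T * F" using F by (intro mult_right_mono) auto
    then show "\<bar>heat_time s\<^sub>0 T j t\<bar> \<le> F / T" using 1[OF a(2,3), of t] by simp
  qed
qed

lemma measurable_time [measurable]: "heat_time s\<^sub>0 T j \<in> borel_measurable borel" "switch \<in> borel_measurable borel"
  by (intro borel_measurable_continuous_onI continuous_on_heat_time continuous_on_switch)+

text \<open>
  Insert the corrected test function into \<open>weak_test_estimate\<close>. The source term is \<open>T\<^sup>\<rho>\<^sup>+\<^sup>1\<close> times the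
  mean of \<open>w\<close>, up to errors of order 1 from the switch and of order \<open>T\<^sup>\<rho>\<close> from the corrections, whose
  time factors are derivatives. The initial datum contributes a constant, since near time 0 the test
  function lives in a fixed ball. None of the constants depends on the radii.
\<close>

lemma main_inequality:
  obtains \<kappa> C where "\<kappa> > 0" "C > 0"
    "\<And>k n T. 1 \<le> k \<Longrightarrow> 1 \<le> n \<Longrightarrow> 1 \<le> T \<Longrightarrow> \<kappa> * (T powr (\<rho> + 1) * mean_w k n) \<le>
       C * (1 + T powr \<rho> + (shell_sum 0 (k + n) \<gamma>\<^sub>2)
          + T * (1 / real n) powr p' * (shell_sum k (k + n) \<gamma>\<^sub>3))"
proof -
  have mp: "m * p' > 0" using m_pos p'_gt by (intro mult_pos_pos) linarith+
  obtain K :: nat where K: "(- dimn - \<gamma>\<^sub>2) / (m * p') < real K" using reals_Archimedean2 by blast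
  have "\<gamma>\<^sub>1 K > - dimn"
  proof -
    have "- dimn - \<gamma>\<^sub>2 < real K * (m * p')" using K by (simp only: pos_divide_less_eq[OF mp])
    moreover have "(\<sigma>\<^sub>1 + m * real K) * P - s = \<sigma>\<^sub>1 * P - s + real K * (m * P)" for P s
      by (simp add: algebra_simps)
    then have "\<gamma>\<^sub>1 K = \<gamma>\<^sub>2 + real K * (m * p')" .
    ultimately show ?thesis by linarith
  qed
  note K = this
  obtain s1 where s1: "0 < s1" "\<And>j s. j \<le> Suc K \<Longrightarrow> s \<le> s1 \<Longrightarrow> 0 \<le> flat j s"
    by (rule flat_nonneg_near_0[of "Suc K"]) (rule that; assumption)
  \<comment> \<open>\<open>s\<^sub>0 \<le> 1\<close> makes \<open>(s\<^sub>0 / T)\<^sup>j \<le> 1 / T\<close> for \<open>j \<ge> 1\<close>.\<close>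
  define s\<^sub>0 where "s\<^sub>0 = min s1 1"
  have s0: "0 < s\<^sub>0" "s\<^sub>0 \<le> 1" using s1(1) by (auto simp: s\<^sub>0_def)
  have fp: "0 \<le> flat j s" if "j \<le> Suc K" "s \<le> s\<^sub>0" for j s
    using s1(2)[OF that(1), of s] that(2) by (simp add: s\<^sub>0_def)
  obtain Cb where Cb: "Cb > 0"
    "\<And>k n T z. 1 \<le> k \<Longrightarrow> 1 \<le> n \<Longrightarrow> 1 \<le> T \<Longrightarrow> z \<in> half_space \<Longrightarrow> snd z \<noteq> 0 \<Longrightarrow>
       0 \<le> full_test s\<^sub>0 K (exp (real k)) (real n) T z"
    "\<And>k n T z. 1 \<le> k \<Longrightarrow> 1 \<le> n \<Longrightarrow> 1 \<le> T \<Longrightarrow> z \<in> half_space \<Longrightarrow> snd z \<noteq> 0 \<Longrightarrow>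
       \<bar>full_adj s\<^sub>0 K (exp (real k)) (real n) T z\<bar>
         \<le> Cb * weight K k n T z * full_test s\<^sub>0 K (exp (real k)) (real n) T z powr (1/p)"
    by (rule full_bound[where K=K, OF s0 fp]) (assumption, assumption, (rule that; assumption))
  obtain W D where W: "D > 0" "\<And>k n T z. 0 \<le> W k n T z"
    "\<And>k n T z. 1 \<le> T \<Longrightarrow> snd z \<noteq> 0 \<Longrightarrow>
        norm (snd z) powr (- (\<sigma>\<^sub>2 / (p - 1))) * (Cb * weight K k n T z) powr p' \<le> W k n T z"
    "\<And>k n T. 1 \<le> k \<Longrightarrow> 1 \<le> n \<Longrightarrow> 1 \<le> T \<Longrightarrow> integrable lborel (W k n T)"
    "\<And>k n T. 1 \<le> k \<Longrightarrow> 1 \<le> n \<Longrightarrow> 1 \<le> T \<Longrightarrow> (LINT z|lborel. W k n T z) \<le>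
        D * (1 + (shell_sum 0 (k + n) \<gamma>\<^sub>2)
          + T * (1 / real n) powr p' * (shell_sum k (k + n) \<gamma>\<^sub>3))"
    by (rule weight_integral[OF K less_imp_le[OF Cb(1)]]) (rule that; assumption)
  obtain F where F: "F > 0" "\<And>j T t. j \<le> K \<Longrightarrow> 1 \<le> T \<Longrightarrow> 0 \<le> t \<Longrightarrow> \<bar>heat_time s\<^sub>0 T j t\<bar> \<le> F"
    "\<And>j T t. 1 \<le> j \<Longrightarrow> j \<le> K \<Longrightarrow> 1 \<le> T \<Longrightarrow> 0 \<le> t \<Longrightarrow> \<bar>heat_time s\<^sub>0 T j t\<bar> \<le> F / T"
    by (rule heat_time_bound[where K=K, OF s0 fp]) (assumption, assumption, (rule that; assumption))
  define g where "g s = flat 0 (s\<^sub>0 * (1 - s))" for s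
  have [measurable]: "g \<in> borel_measurable borel" unfolding g_def[abs_def] by measurable
  have g: "0 \<le> g s" "g s \<le> 1" for s unfolding g_def by (rule flat_0_bounds)+
  have g1: "g s = 0" if "1 \<le> s" for s
    unfolding g_def using s0 that by (intro flat_nonpos mult_nonneg_nonpos) auto
  have g2: "flat 0 (s\<^sub>0 * (1/2)) \<le> g s" if "1/4 \<le> s" "s \<le> 1/2" for s
    unfolding g_def using s0 that by (intro flat_0_mono mult_left_mono) auto
  define \<kappa> where "\<kappa> = (LINT s|lborel. indicator {0<..} s * (s powr \<rho> * g s))"
  have \<kappa>: "\<kappa> > 0" unfolding \<kappa>_def
    by (rule time_integral_pos[OF \<rho> _ g g1 _ g2]) (use s0 in \<open>auto intro!: flat_0_bounds(3)\<close>)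
  have heat0: "heat_time s\<^sub>0 T 0 t = g (t / T)" for T t by (simp add: heat_time_def g_def)
  define W1 where "W1 = (LINT x|lborel. \<bar>w x\<bar>)"
  have W1: "W1 \<ge> 0" unfolding W1_def by (intro Bochner_Integration.integral_nonneg) auto
  define I0 where "I0 = (LINT x|lebesgue. \<bar>indicator (ball 0 3) x * (norm x powr \<sigma>\<^sub>1 * u\<^sub>0 x)\<bar>)"
  have I0: "I0 \<ge> 0" unfolding I0_def by (intro Bochner_Integration.integral_nonneg) auto
  have cpos: "hcoeff j > 0" for j using heat_coeff_pos[OF m_pos dimn_ge] .
  define P0 where "P0 = (\<Sum>j\<le>K. hcoeff j * (F * exp (m * real j)))"
  have P0: "P0 \<ge> 0" unfolding P0_def using cpos F(1) by (intro sum_nonneg) (auto simp: less_imp_le)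
  define Q0 where "Q0 = (\<Sum>j\<in>{1..K}. hcoeff j * (F * \<kappa>\<^sub>1 * (exp (m * real j) * W1)))"
  have Q0: "Q0 \<ge> 0" unfolding Q0_def using cpos F(1) W1 \<kappa>\<^sub>1_nonneg by (intro sum_nonneg) (auto simp: less_imp_le)
  define R0 where "R0 = (2 powr (\<rho> + 1) * \<kappa>\<^sub>1) * (2 * W1)"
  have R0: "R0 \<ge> 0" unfolding R0_def using W1 \<kappa>\<^sub>1_nonneg by simp
  define C where "C = D + P0 * I0 + R0 + Q0"
  have C: "C > 0" unfolding C_def using W(1) P0 I0 R0 Q0 mult_nonneg_nonneg[OF P0 I0] by linarith
  have main: "\<kappa> * (T powr (\<rho> + 1) * mean_w k n) \<le>
       C * (1 + T powr \<rho> + (shell_sum 0 (k + n) \<gamma>\<^sub>2)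
          + T * (1 / real n) powr p' * (shell_sum k (k + n) \<gamma>\<^sub>3))"
    if kn: "1 \<le> k" "1 \<le> n" and T: "1 \<le> T" for k n T
  proof -
    define R where "R = exp (real k)"
    define L where "L = real n"
    have RL: "R > 0" "L > 0" using kn by (auto simp: R_def L_def)
    have T0: "T > 0" using T by simp
    define \<psi> where "\<psi> = full_test s\<^sub>0 K R L T"
    define H where "H j x = pcut (m * real j) 1 1 ((norm x)\<^sup>2)" for j and x :: "real ^ 'n"
    define \<Phi> where "\<Phi> x = pcut 0 R L ((norm x)\<^sup>2)" for x :: "real ^ 'n"
    define h where "h = heat_time s\<^sub>0 T"
    define b where "b t = h 0 t * switch t" for t
    have [measurable]: "H j \<in> borel_measurable borel" "\<Phi> \<in> borel_measurable borel" "h j \<in> borel_measurable borel"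
      "b \<in> borel_measurable borel" for j
      unfolding H_def[abs_def] \<Phi>_def[abs_def] h_def b_def[abs_def] by measurable
    define \<tau> where "\<tau> j = (LINT t|lborel. indicator {0<..} t * (t powr \<rho> * h j t))" for j
    define \<beta> where "\<beta> = (LINT t|lborel. indicator {0<..} t * (t powr \<rho> * b t))"
    define \<omega> where "\<omega> j = (LINT x|lborel. w x * H j x)" for j
    define \<omega>\<^sub>\<Phi> where "\<omega>\<^sub>\<Phi> = (LINT x|lborel. w x * \<Phi> x)"
    have mean: "mean_w k n = \<omega>\<^sub>\<Phi>" unfolding mean_w_def \<omega>\<^sub>\<Phi>_def \<Phi>_def R_def L_def by (rule refl)
    have h0: "h 0 t = g (t / T)" for t by (simp add: h_def heat0)
    have hz: "h j t = 0" if "T \<le> t" for j t unfolding h_def using heat_time_zero T0 s0 that by simp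
    have hF: "\<bar>h j t\<bar> \<le> F" if "j \<le> K" "t > 0" for j t unfolding h_def using F(2)[OF that(1) T] that(2) by simp
    have hFT: "\<bar>h j t\<bar> \<le> F / T" if "1 \<le> j" "j \<le> K" "t > 0" for j t unfolding h_def using F(3)[OF that(1,2) T] that(3) by simp
    have bb: "\<bar>b t\<bar> \<le> 1" for t
      unfolding b_def h0 abs_mult using g[of "t / T"] switch_bounds[of t] by (simp add: mult_le_one)
    have hi: "integrable lborel (\<lambda>t. indicator {0<..} t * (t powr \<rho> * h j t))" if "j \<le> K" for j
      by (rule time_integral_bound(1)[where T=T and B=F]) (use T0 hF[OF that] hz in auto)
    have bi: "integrable lborel (\<lambda>t. indicator {0<..} t * (t powr \<rho> * b t))"
      by (rule time_integral_bound(1)[where T=T and B=1]) (use T0 bb hz in \<open>auto simp: b_def\<close>)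
    have \<tau>0: "\<tau> 0 = T powr (\<rho> + 1) * \<kappa>"
      unfolding \<tau>_def h0 \<kappa>_def by (rule time_integral_scaling(2)[OF \<rho> _ g g1 T0]) auto
    have \<tau>j: "\<bar>\<tau> j\<bar> \<le> F * \<kappa>\<^sub>1 * T powr \<rho>" if "1 \<le> j" "j \<le> K" for j
    proof -
      have "\<bar>\<tau> j\<bar> \<le> F / T * (T powr (\<rho> + 1) * \<kappa>\<^sub>1)"
        unfolding \<tau>_def by (rule time_integral_bound(2)) (use T0 hFT[OF that] hz in auto)
      also have "\<dots> = F * \<kappa>\<^sub>1 * T powr \<rho>" using T0 by (simp add: powr_add)
      finally show ?thesis .
    qed
    have \<tau>\<beta>: "\<bar>\<tau> 0 - \<beta>\<bar> \<le> 2 powr (\<rho> + 1) * \<kappa>\<^sub>1"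
    proof -
      have "\<tau> 0 - \<beta> = (LINT t|lborel. indicator {0<..} t * (t powr \<rho> * h 0 t) - indicator {0<..} t * (t powr \<rho> * b t))"
        unfolding \<tau>_def \<beta>_def by (rule Bochner_Integration.integral_diff[symmetric]) (use hi[of 0] bi in auto)
      also have "\<dots> = (LINT t|lborel. indicator {0<..} t * (t powr \<rho> * (h 0 t * (1 - switch t))))"
        by (simp add: b_def algebra_simps)
      finally have "\<tau> 0 - \<beta> = (LINT t|lborel. indicator {0<..} t * (t powr \<rho> * (h 0 t * (1 - switch t))))" .
      moreover have "\<bar>LINT t|lborel. indicator {0<..} t * (t powr \<rho> * (h 0 t * (1 - switch t)))\<bar> \<le> 1 * (2 powr (\<rho> + 1) * \<kappa>\<^sub>1)"
      proof (rule time_integral_bound(2))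
        show "\<bar>h 0 t * (1 - switch t)\<bar> \<le> 1" for t
          unfolding h0 abs_mult using g[of "t / T"] switch_bounds[of t] by (simp add: mult_le_one)
        show "h 0 t * (1 - switch t) = 0" if "2 \<le> t" for t using switch_late(1)[OF that] by simp
      qed auto
      ultimately show ?thesis by simp
    qed
    have mj: "m * real j \<ge> 0" for j using m_pos by simp
    have Hb: "\<bar>H j x\<bar> \<le> exp (m * real j)" for j x
      unfolding H_def using pcut_unit_bound(1,2)[OF mj, of j x] by simp
    have \<Phi>b: "\<bar>\<Phi> x\<bar> \<le> 1" for x unfolding \<Phi>_def using pcut_0_bound[of R L "(norm x)\<^sup>2"] by simp
    have Hi: "integrable lborel (\<lambda>x. w x * H j x)" and \<omega>j: "\<bar>\<omega> j\<bar> \<le> exp (m * real j) * W1" for j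
      unfolding \<omega>_def W1_def using bounded_w_integrable[OF _ Hb[of j]] by auto
    have \<Phi>i: "integrable lborel (\<lambda>x. w x * \<Phi> x)" and \<omega>\<Phi>b: "\<bar>\<omega>\<^sub>\<Phi>\<bar> \<le> 1 * W1"
      unfolding \<omega>\<^sub>\<Phi>_def W1_def using bounded_w_integrable[OF _ \<Phi>b] by auto
    have \<psi>z: "\<psi> z = (\<Sum>j\<le>K. hcoeff j * (h j (fst z) * H j (snd z))) + (b (fst z) * \<Phi> (snd z) + (- 1) * (b (fst z) * H 0 (snd z)))" for z
      unfolding \<psi>_def full_test_def inner_test_def outer_test_def b_def h_def H_def \<Phi>_def by simp
    define v where "v z = fst z powr \<rho> * w (snd z)" for z :: "real \<times> (real ^ 'n)"
    have pj: "set_integrable lebesgue half_space (\<lambda>z. v z * (h j (fst z) * H j (snd z)))"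
      "(LINT z:half_space|lebesgue. v z * (h j (fst z) * H j (snd z))) = \<tau> j * \<omega> j" if "j \<le> K" for j
      unfolding v_def \<tau>_def \<omega>_def by (rule set_integral_product[OF hi[OF that] Hi])+
    have p\<Phi>: "set_integrable lebesgue half_space (\<lambda>z. v z * (b (fst z) * \<Phi> (snd z)))"
      "(LINT z:half_space|lebesgue. v z * (b (fst z) * \<Phi> (snd z))) = \<beta> * \<omega>\<^sub>\<Phi>"
      unfolding v_def \<beta>_def \<omega>\<^sub>\<Phi>_def by (rule set_integral_product[OF bi \<Phi>i])+
    have pH: "set_integrable lebesgue half_space (\<lambda>z. v z * (b (fst z) * H 0 (snd z)))"
      "(LINT z:half_space|lebesgue. v z * (b (fst z) * H 0 (snd z))) = \<beta> * \<omega> 0"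
      unfolding v_def \<beta>_def \<omega>_def by (rule set_integral_product[OF bi Hi])+
    have v\<psi>: "v z * \<psi> z = (\<Sum>j\<le>K. hcoeff j * (v z * (h j (fst z) * H j (snd z))))
        + (v z * (b (fst z) * \<Phi> (snd z)) + (- 1) * (v z * (b (fst z) * H 0 (snd z))))" for z
      unfolding \<psi>z by (simp add: distrib_left right_diff_distrib sum_distrib_left mult.left_commute)
    have sj: "set_integrable lebesgue half_space (\<lambda>z. hcoeff j * (v z * (h j (fst z) * H j (snd z))))" if "j \<le> K" for j
      by (rule set_integrable_mult_right[OF pj(1)[OF that]])
    have sm: "set_integrable lebesgue half_space (\<lambda>z. \<Sum>j\<le>K. hcoeff j * (v z * (h j (fst z) * H j (snd z))))"
      by (rule set_integral_sum(1)) (use sj in auto)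
    have so: "set_integrable lebesgue half_space (\<lambda>z. (- 1) * (v z * (b (fst z) * H 0 (snd z))))"
      by (rule set_integrable_mult_right[OF pH(1)])
    have vi: "set_integrable lebesgue half_space (\<lambda>z. v z * \<psi> z)"
      unfolding v\<psi> by (intro set_integral_add(1) sm p\<Phi>(1) so)
    have J: "(LINT z:half_space|lebesgue. v z * \<psi> z) = (\<Sum>j\<le>K. hcoeff j * (\<tau> j * \<omega> j)) + (\<beta> * \<omega>\<^sub>\<Phi> - \<beta> * \<omega> 0)"
    proof -
      have "(LINT z:half_space|lebesgue. v z * \<psi> z)
         = (LINT z:half_space|lebesgue. (\<Sum>j\<le>K. hcoeff j * (v z * (h j (fst z) * H j (snd z)))))
         + (LINT z:half_space|lebesgue. v z * (b (fst z) * \<Phi> (snd z)) + (- 1) * (v z * (b (fst z) * H 0 (snd z))))"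
        unfolding v\<psi> by (intro set_integral_add(2) set_integral_add(1) sm p\<Phi>(1) so)
      also have "(LINT z:half_space|lebesgue. (\<Sum>j\<le>K. hcoeff j * (v z * (h j (fst z) * H j (snd z)))))
         = (\<Sum>j\<le>K. (LINT z:half_space|lebesgue. hcoeff j * (v z * (h j (fst z) * H j (snd z)))))"
        by (rule set_integral_sum(2)) (use sj in auto)
      also have "\<dots> = (\<Sum>j\<le>K. hcoeff j * (\<tau> j * \<omega> j))"
        by (intro sum.cong refl) (simp only: set_integral_mult_right pj(2) atMost_iff)
      also have "(LINT z:half_space|lebesgue. v z * (b (fst z) * \<Phi> (snd z)) + (- 1) * (v z * (b (fst z) * H 0 (snd z))))
        = \<beta> * \<omega>\<^sub>\<Phi> + (- 1) * (\<beta> * \<omega> 0)"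
        unfolding set_integral_add(2)[OF p\<Phi>(1) so] set_integral_mult_right p\<Phi>(2) pH(2) by (rule refl)
      finally show ?thesis by simp
    qed
    have wt: "weak_test \<psi> (full_adj s\<^sub>0 K R L T)"
      unfolding \<psi>_def by (rule weak_test_full[OF T0 s0(1) RL])
    have est: "(LINT z:half_space|lebesgue. v z * \<psi> z) + (LINT x|lebesgue. norm x powr \<sigma>\<^sub>1 * u\<^sub>0 x * \<psi> (0, x))
       \<le> (LINT z|lborel. W k n T z)"
      unfolding v_def
    proof (rule weak_test_estimate[OF wt, where G="\<lambda>z. Cb * weight K k n T z"])
      show "0 \<le> Cb * weight K k n T z" for z
        using Cb(1) T unfolding weight_def by (intro mult_nonneg_nonneg add_nonneg_nonneg) auto
      show "set_integrable lebesgue half_space (\<lambda>z. fst z powr \<rho> * w (snd z) * \<psi> z)"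
        using vi unfolding v_def .
    qed (use Cb(2,3) W kn T in \<open>auto simp: \<psi>_def R_def L_def\<close>)
    have init: "\<bar>LINT x|lebesgue. norm x powr \<sigma>\<^sub>1 * u\<^sub>0 x * \<psi> (0, x)\<bar> \<le> P0 * I0"
    proof -
      define f where "f x = indicator (ball 0 3) x * (norm x powr \<sigma>\<^sub>1 * u\<^sub>0 x)" for x :: "real ^ 'n"
      have fi: "integrable lebesgue f"
        using integrable_initial[OF zero_less_one, of 3] unfolding set_integrable_def f_def[abs_def] by simp
      have i: "integrable lebesgue (\<lambda>x. norm x powr \<sigma>\<^sub>1 * u\<^sub>0 x * \<psi> (0, x))" using wt unfolding weak_test_def by blast
      have le: "\<bar>norm x powr \<sigma>\<^sub>1 * u\<^sub>0 x * \<psi> (0, x)\<bar> \<le> P0 * \<bar>f x\<bar>" for x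
      proof -
        have e: "\<psi> (0, x) = (\<Sum>j\<le>K. hcoeff j * (h j 0 * H j x))"
          unfolding \<psi>z by (simp add: b_def switch_early)
        show ?thesis
        proof (cases "x \<in> ball 0 3")
          case False
          then have "H j x = 0" for j unfolding H_def using pcut_unit_bound(3)[OF mj, of x j] by simp
          then have "\<psi> (0, x) = 0" unfolding e by simp
          then show ?thesis using P0 by simp
        next
          case True
          have "\<bar>\<psi> (0, x)\<bar> \<le> (\<Sum>j\<le>K. \<bar>hcoeff j * (h j 0 * H j x)\<bar>)" unfolding e by (rule sum_abs)
          also have "\<dots> \<le> P0" unfolding P0_def
          proof (rule sum_mono)
            fix j assume j: "j \<in> {..K}"
            have "\<bar>h j 0\<bar> * \<bar>H j x\<bar> \<le> F * exp (m * real j)"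
              using F(2)[of j T 0] T j Hb[of j x] F(1) unfolding h_def by (intro mult_mono) auto
            then show "\<bar>hcoeff j * (h j 0 * H j x)\<bar> \<le> hcoeff j * (F * exp (m * real j))"
              using cpos[of j] by (simp add: abs_mult)
          qed
          finally have "\<bar>norm x powr \<sigma>\<^sub>1 * u\<^sub>0 x\<bar> * \<bar>\<psi> (0, x)\<bar> \<le> \<bar>norm x powr \<sigma>\<^sub>1 * u\<^sub>0 x\<bar> * P0"
            by (intro mult_left_mono) auto
          then show ?thesis using True by (simp add: f_def abs_mult mult_ac)
        qed
      qed
      have "\<bar>LINT x|lebesgue. norm x powr \<sigma>\<^sub>1 * u\<^sub>0 x * \<psi> (0, x)\<bar> \<le> (LINT x|lebesgue. \<bar>norm x powr \<sigma>\<^sub>1 * u\<^sub>0 x * \<psi> (0, x)\<bar>)"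
        by (rule integral_abs_bound)
      also have "\<dots> \<le> (LINT x|lebesgue. P0 * \<bar>f x\<bar>)"
        by (rule integral_mono) (use i fi le in auto)
      also have "\<dots> = P0 * I0" by (simp add: I0_def f_def)
      finally show ?thesis .
    qed
    define S2 where "S2 = (shell_sum 0 (k + n) \<gamma>\<^sub>2)"
    define S3 where "S3 = T * (1 / real n) powr p' * (shell_sum k (k + n) \<gamma>\<^sub>3)"
    have S: "S2 \<ge> 0" "S3 \<ge> 0" unfolding S2_def S3_def using T by (auto intro!: sum_nonneg mult_nonneg_nonneg)
    have WD: "(LINT z|lborel. W k n T z) \<le> D * (1 + S2 + S3)"
      using W(5)[OF kn T] unfolding S2_def S3_def .
    \<comment> \<open>The source term of a test function that is switched on from the beginning, minus what the switch
      removes, plus the corrections.\<close>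
    have Jeq: "\<tau> 0 * \<omega>\<^sub>\<Phi> = (LINT z:half_space|lebesgue. v z * \<psi> z)
       + (\<tau> 0 - \<beta>) * (\<omega>\<^sub>\<Phi> - \<omega> 0) - (\<Sum>j\<in>{1..K}. hcoeff j * (\<tau> j * \<omega> j))"
      unfolding J sum_head[of _ K] by (simp add: algebra_simps)
    have t1: "(\<tau> 0 - \<beta>) * (\<omega>\<^sub>\<Phi> - \<omega> 0) \<le> R0"
    proof -
      have "\<bar>\<omega>\<^sub>\<Phi> - \<omega> 0\<bar> \<le> 2 * W1" using \<omega>\<Phi>b \<omega>j[of 0] by simp
      then have "\<bar>\<tau> 0 - \<beta>\<bar> * \<bar>\<omega>\<^sub>\<Phi> - \<omega> 0\<bar> \<le> R0" unfolding R0_def using \<tau>\<beta> \<kappa>\<^sub>1_nonneg by (intro mult_mono) auto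
      then show ?thesis by (metis abs_ge_self abs_mult order_trans)
    qed
    have t2: "- (\<Sum>j\<in>{1..K}. hcoeff j * (\<tau> j * \<omega> j)) \<le> Q0 * T powr \<rho>"
    proof -
      have "- (\<Sum>j\<in>{1..K}. hcoeff j * (\<tau> j * \<omega> j)) \<le> (\<Sum>j\<in>{1..K}. \<bar>hcoeff j * (\<tau> j * \<omega> j)\<bar>)"
        by (rule order_trans[OF abs_ge_minus_self sum_abs])
      also have "\<dots> \<le> (\<Sum>j\<in>{1..K}. hcoeff j * (F * \<kappa>\<^sub>1 * (exp (m * real j) * W1)) * T powr \<rho>)"
      proof (rule sum_mono)
        fix j assume j: "j \<in> {1..K}"
        have "\<bar>\<tau> j\<bar> * \<bar>\<omega> j\<bar> \<le> (F * \<kappa>\<^sub>1 * T powr \<rho>) * (exp (m * real j) * W1)"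
          using \<tau>j[of j] \<omega>j[of j] j F(1) \<kappa>\<^sub>1_nonneg by (intro mult_mono) auto
        then have "hcoeff j * (\<bar>\<tau> j\<bar> * \<bar>\<omega> j\<bar>) \<le> hcoeff j * ((F * \<kappa>\<^sub>1 * T powr \<rho>) * (exp (m * real j) * W1))"
          using cpos[of j] by (intro mult_left_mono) auto
        then show "\<bar>hcoeff j * (\<tau> j * \<omega> j)\<bar> \<le> hcoeff j * (F * \<kappa>\<^sub>1 * (exp (m * real j) * W1)) * T powr \<rho>"
          using cpos[of j] by (simp add: abs_mult mult_ac)
      qed
      also have "\<dots> = Q0 * T powr \<rho>" unfolding Q0_def by (rule sum_distrib_right[symmetric])
      finally show ?thesis .
    qed
    have "\<kappa> * (T powr (\<rho> + 1) * mean_w k n) = \<tau> 0 * \<omega>\<^sub>\<Phi>" unfolding \<tau>0 mean by simp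
    also have "\<dots> \<le> D * (1 + S2 + S3) + P0 * I0 + R0 + Q0 * T powr \<rho>"
      using Jeq est WD init t1 t2 by linarith
    also have "\<dots> \<le> C * (1 + T powr \<rho> + S2 + S3)"
    proof -
      define Y where "Y = T powr \<rho>"
      have Y: "Y \<ge> 0" by (simp add: Y_def)
      define A where "A = P0 * I0"
      have A: "A \<ge> 0" unfolding A_def using P0 I0 by simp
      have "C * (1 + Y + S2 + S3) = D * (1 + S2 + S3) + A + R0 + Q0 * Y + (D * Y + A * (Y + S2 + S3) + R0 * (Y + S2 + S3) + Q0 * (1 + S2 + S3))"
        unfolding C_def A_def[symmetric] by (simp add: algebra_simps)
      moreover have "0 \<le> D * Y + A * (Y + S2 + S3) + R0 * (Y + S2 + S3) + Q0 * (1 + S2 + S3)"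
        using W(1) Y A R0 Q0 S by (intro add_nonneg_nonneg mult_nonneg_nonneg) auto
      ultimately show ?thesis unfolding Y_def A_def by linarith
    qed
    finally show ?thesis unfolding S2_def S3_def .
  qed
  show ?thesis by (rule that[of \<kappa> C, OF \<kappa> C main])
qed

end

section \<open>A test function supported away from the initial time\<close>

text \<open>
  A time cutoff that vanishes at both ends. It avoids the initial datum altogether, at the price that no
  correction at the origin is possible.
\<close>

definition bump :: "real \<Rightarrow> real" where "bump s = flat 0 s * flat 0 (1 - s)"
definition bump' :: "real \<Rightarrow> real" where "bump' s = flat 1 s * flat 0 (1 - s) - flat 0 s * flat 1 (1 - s)"

lemma bump_deriv: "(bump has_real_derivative bump' s) (at s)"
proof -
  have "((\<lambda>s. 1 - s) has_real_derivative - 1) (at s)" for s :: real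
    by (auto intro!: derivative_eq_intros)
  from DERIV_mult[OF flat_deriv_01(1) DERIV_chain2[OF flat_deriv_01(1) this], of s]
  show ?thesis unfolding bump_def[abs_def] bump'_def by (rule DERIV_cong) simp
qed

lemma bump_bounds: "0 \<le> bump s" "bump s \<le> 1"
  using flat_0_bounds[of s] flat_0_bounds[of "1 - s"] by (auto simp: bump_def mult_le_one)

lemma bump_zero: "s \<le> 0 \<or> 1 \<le> s \<Longrightarrow> bump s = 0" "s \<le> 0 \<or> 1 \<le> s \<Longrightarrow> bump' s = 0"
  by (auto simp: bump_def bump'_def)

lemma continuous_on_bump: "continuous_on S bump" "continuous_on S bump'"
  unfolding bump_def[abs_def] bump'_def[abs_def] by (intro continuous_intros)+

lemma measurable_bump [measurable]: "bump \<in> borel_measurable borel"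
  by (intro borel_measurable_continuous_onI continuous_on_bump)

lemma time_profile_bump:
  assumes T: "T > 0"
  shows "time_profile (\<lambda>t. bump (t / T)) (\<lambda>t. bump' (t / T) / T) T"
proof -
  have "((\<lambda>t. t / T) has_real_derivative 1 / T) (at t)" for t
    using T by (auto intro!: derivative_eq_intros)
  from DERIV_chain2[OF bump_deriv this]
  have d: "((\<lambda>t. bump (t / T)) has_real_derivative bump' (t / T) / T) (at t)" for t by simp
  have "smooth_on UNIV (\<lambda>t. flat 0 (0 + (1 / T) * t) * flat 0 (1 + (- 1 / T) * t))"
    by (intro smooth_on_mult smooth_on_affine_compose smooth_on_flat)
  then have s: "smooth_on UNIV (\<lambda>t. bump (t / T))" by (simp add: bump_def)
  have "continuous_on UNIV (\<lambda>t. t / T)" using T by (intro continuous_intros) auto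
  then have "continuous_on UNIV (\<lambda>t. bump' (t / T))"
    by (rule continuous_on_compose2[OF continuous_on_bump(2) _ subset_UNIV])
  then have c: "continuous_on UNIV (\<lambda>t. bump' (t / T) / T)" using T by (intro continuous_intros) auto
  show ?thesis unfolding time_profile_def using T d s c bump_zero by (simp add: le_divide_eq)
qed

context weak_solution
begin

text \<open>
  If \<open>\<bar>x\<bar>\<close> to the power \<open>\<gamma>\<^sub>2\<close> is integrable at the origin, a plain product of cutoffs suffices. The gain
  over \<open>main_inequality\<close> is the factor \<open>T\<close> to the power \<open>1 - p'\<close> in front of the contribution of the
  time derivative, which then grows with the radius.
\<close>

lemma bump_inequality:
  assumes E: "dimn + \<gamma>\<^sub>2 > 0"
  obtains \<kappa> C where "\<kappa> > 0" "C > 0"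
    "\<And>k T. 1 \<le> k \<Longrightarrow> 1 \<le> T \<Longrightarrow> \<kappa> * (T powr (\<rho> + 1) * mean_w k 1) \<le>
       C * (T * (1 / T) powr p' * exp ((real k + 1) * (dimn + \<gamma>\<^sub>2)) + T * exp (real k * (dimn + \<gamma>\<^sub>3)))"
proof -
  define \<theta> where "\<theta> = 1 / p"
  have \<theta>: "0 < \<theta>" "\<theta> < 1" using p by (auto simp: \<theta>_def)
  obtain F where F: "F > 0" "\<And>s. \<bar>flat 1 s\<bar> \<le> F * flat 0 s powr \<theta>"
    by (rule flat_le_powr[OF \<theta>(2), where n=1]) (rule that; assumption)
  have bump': "\<bar>bump' s\<bar> \<le> 2 * F * bump s powr \<theta>" for s
  proof -
    have le: "flat 0 s \<le> flat 0 s powr \<theta>" for s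
      using flat_0_bounds(1,2)[of s] \<theta> by (intro powr_ge_self) auto
    have 1: "\<bar>flat 1 s * flat 0 r\<bar> \<le> F * (flat 0 s powr \<theta> * flat 0 r powr \<theta>)" for s r
    proof -
      have "\<bar>flat 1 s\<bar> * \<bar>flat 0 r\<bar> \<le> (F * flat 0 s powr \<theta>) * flat 0 r powr \<theta>"
        using F le[of r] flat_0_bounds(1)[of r] by (intro mult_mono) auto
      then show ?thesis by (simp add: abs_mult mult.assoc)
    qed
    have "\<bar>bump' s\<bar> \<le> \<bar>flat 1 s * flat 0 (1 - s)\<bar> + \<bar>flat 1 (1 - s) * flat 0 s\<bar>"
      unfolding bump'_def by (rule order_trans[OF abs_triangle_ineq4]) (simp add: mult.commute)
    also have "\<dots> \<le> F * (flat 0 s powr \<theta> * flat 0 (1 - s) powr \<theta>) + F * (flat 0 (1 - s) powr \<theta> * flat 0 s powr \<theta>)"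
      by (intro add_mono 1)
    also have "\<dots> = 2 * F * bump s powr \<theta>" unfolding bump_def powr_mult by simp
    finally show ?thesis .
  qed
  obtain Q where Q: "Q > 0" "\<And>R L r. R > 0 \<Longrightarrow> L \<ge> 1 \<Longrightarrow> r > 0 \<Longrightarrow>
      \<bar>pcut_err CARD('n) 0 R L r\<bar> \<le> Q / L * indicator {R..R * exp L} r * r powr (0 - 2) * cut R L (r\<^sup>2) powr \<theta>"
    by (rule pcut_err_bound[OF less_imp_le[OF \<theta>(1)] \<theta>(2), where N="CARD('n)" and q=0]) (rule that; assumption)
  define Cb where "Cb = 2 * F + Q"
  have Cb: "Cb > 0" using F(1) Q(1) by (simp add: Cb_def)
  have E': "\<gamma>\<^sub>2 > - real CARD('n)" using E by (simp only: dimn)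
  obtain A1 where A1: "A1 > 0"
    "\<And>r. r > 0 \<Longrightarrow> integrable lborel (\<lambda>x :: real ^ 'n. indicator (cball 0 r) x * norm x powr \<gamma>\<^sub>2)"
    "\<And>r. r > 0 \<Longrightarrow> (LINT x|lborel. indicator (cball (0 :: real ^ 'n) r) x * norm x powr \<gamma>\<^sub>2) \<le> A1 * r powr (dimn + \<gamma>\<^sub>2)"
    by (rule integral_powr_ball[OF E', folded dimn]) (rule that; assumption)
  obtain A3 where A3: "A3 > 0"
    "\<And>k l. k < l \<Longrightarrow> integrable lborel (\<lambda>x :: real ^ 'n. indicator (annulus k l) x * norm x powr \<gamma>\<^sub>3)"
    "\<And>k l. k < l \<Longrightarrow> (LINT x|lborel. indicator (annulus k l) x * norm (x :: real ^ 'n) powr \<gamma>\<^sub>3)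
       \<le> A3 * (shell_sum k l \<gamma>\<^sub>3)"
    by (rule integral_powr_annulus[where 'n='n and g=\<gamma>\<^sub>3, folded dimn]) (rule that; assumption)
  define \<kappa> where "\<kappa> = (LINT s|lborel. indicator {0<..} s * (s powr \<rho> * bump s))"
  have b2: "flat 0 (1/4) * flat 0 (1/2) \<le> bump s" if "1/4 \<le> s" "s \<le> 1/2" for s
    unfolding bump_def using that flat_0_bounds(1) by (intro mult_mono flat_0_mono) auto
  have \<kappa>: "\<kappa> > 0" unfolding \<kappa>_def
    by (rule time_integral_pos[OF \<rho> measurable_bump bump_bounds _ _ b2])
       (use flat_0_bounds(3)[of "1/4"] flat_0_bounds(3)[of "1/2"] in \<open>auto simp: bump_zero\<close>)
  define c where "c = Cb powr p' * 4 powr p'"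
  have c: "c > 0" using Cb by (simp add: c_def)
  define C where "C = c * A1 + c * A3"
  have CA: "0 < c * A1" "0 < c * A3" using c A1(1) A3(1) by auto
  have C: "C > 0" using CA by (simp add: C_def)
  have main: "\<kappa> * (T powr (\<rho> + 1) * mean_w k 1) \<le>
       C * (T * (1 / T) powr p' * exp ((real k + 1) * (dimn + \<gamma>\<^sub>2)) + T * exp (real k * (dimn + \<gamma>\<^sub>3)))"
    if k: "1 \<le> k" and T: "1 \<le> T" for k T
  proof -
    have T0: "T > 0" using T by simp
    define R where "R = exp (real k)"
    define R' where "R' = exp (real k + 1)"
    have R: "R > 0" "R' > 0" "R * exp 1 = R'" by (auto simp: R_def R'_def exp_add)
    define \<psi> where "\<psi> z = bump (fst z / T) * pcut 0 R 1 ((norm (snd z))\<^sup>2)" for z :: "real \<times> (real ^ 'n)"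
    define L where "L z = adjoint (\<lambda>t. bump (t / T)) (\<lambda>t. bump' (t / T) / T) (pcut 0 R 1) (pcut1 0 R 1) (pcut2 0 R 1) 0 z" for z
    have wt: "weak_test \<psi> L"
      unfolding \<psi>_def[abs_def] L_def[abs_def]
      using R \<sigma>\<^sub>1 by (intro weak_test_radial[OF time_profile_bump[OF T0]] radial_profile_pcut) auto
    define v1 where "v1 = (\<lambda>x :: real ^ 'n. indicator (cball 0 R') x * norm x powr \<gamma>\<^sub>2)"
    define v3 where "v3 = (\<lambda>x :: real ^ 'n. indicator (annulus k (k + 1)) x * norm x powr \<gamma>\<^sub>3)"
    define a1 where "a1 z = indicator {0..T} (fst z) * (1 / T * (indicator (cball 0 R') (snd z) * norm (snd z) powr \<sigma>\<^sub>1))" for z :: "real \<times> (real ^ 'n)"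
    define a3 where "a3 z = indicator {0..T} (fst z) * (1 * (indicator (annulus k (k + 1)) (snd z) * norm (snd z) powr (- 2)))" for z :: "real \<times> (real ^ 'n)"
    define W where "W z = c * (indicator {0..T} (fst z) * ((1 / T) powr p' * v1 (snd z))
       + indicator {0..T} (fst z) * (1 * v3 (snd z)) + 0 + 0)" for z
    have q: "p' > 0" using p'_gt by simp
    have a0: "0 \<le> a1 z" "0 \<le> a3 z" for z using T0 by (auto simp: a1_def a3_def)
    have v1i: "integrable lborel v1" and v1b: "integral\<^sup>L lborel v1 \<le> A1 * exp ((real k + 1) * (dimn + \<gamma>\<^sub>2))"
      unfolding v1_def using A1(2)[OF R(2)] A1(3)[OF R(2)] by (simp_all add: R'_def powr_def mult.commute)
    have v3i: "integrable lborel v3" and v3b: "integral\<^sup>L lborel v3 \<le> A3 * exp (real k * (dimn + \<gamma>\<^sub>3))"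
      unfolding v3_def using A3(2)[of k "k + 1"] A3(3)[of k "k + 1"] by simp_all
    note t1 = integrable_time_space[OF v1i less_imp_le[OF T0], of "(1 / T) powr p'"]
    note t3 = integrable_time_space[OF v3i less_imp_le[OF T0], of 1]
    have Wi: "integrable lborel W" unfolding W_def[abs_def]
      by (intro integrable_mult_right Bochner_Integration.integrable_add t1(1) t3(1)) auto
    have "integral\<^sup>L lborel W = c * (T * ((1 / T) powr p' * integral\<^sup>L lborel v1) + T * (1 * integral\<^sup>L lborel v3)
        + (LINT z|(lborel :: (real \<times> (real ^ 'n)) measure). 0) + (LINT z|(lborel :: (real \<times> (real ^ 'n)) measure). 0))"
      unfolding W_def[abs_def] t1(2)[symmetric] t3(2)[symmetric]
      by (rule integral_sum4[OF t1(1) t3(1)]) auto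
    also have "\<dots> = c * (T * (1 / T) powr p' * integral\<^sup>L lborel v1 + T * integral\<^sup>L lborel v3)" by simp
    also have "\<dots> \<le> c * (T * (1 / T) powr p' * (A1 * exp ((real k + 1) * (dimn + \<gamma>\<^sub>2))) + T * (A3 * exp (real k * (dimn + \<gamma>\<^sub>3))))"
      using c T0 by (intro mult_left_mono add_mono v1b v3b) auto
    also have "\<dots> = (c * A1) * (T * (1 / T) powr p' * exp ((real k + 1) * (dimn + \<gamma>\<^sub>2))) + (c * A3) * (T * exp (real k * (dimn + \<gamma>\<^sub>3)))"
      by (simp only: distrib_left mult_ac)
    also have "\<dots> \<le> C * (T * (1 / T) powr p' * exp ((real k + 1) * (dimn + \<gamma>\<^sub>2))) + C * (T * exp (real k * (dimn + \<gamma>\<^sub>3)))"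
      using CA T0 unfolding C_def by (intro add_mono mult_right_mono) auto
    finally have Wb: "integral\<^sup>L lborel W \<le> C * (T * (1 / T) powr p' * exp ((real k + 1) * (dimn + \<gamma>\<^sub>2)) + T * exp (real k * (dimn + \<gamma>\<^sub>3)))"
      by (simp only: distrib_left)
    have hi: "integrable lborel (\<lambda>t. indicator {0<..} t * (t powr \<rho> * bump (t / T)))"
      and \<tau>: "(LINT t|lborel. indicator {0<..} t * (t powr \<rho> * bump (t / T))) = T powr (\<rho> + 1) * \<kappa>"
      unfolding \<kappa>_def by (rule time_integral_scaling[OF \<rho> measurable_bump bump_bounds _ T0]; simp add: bump_zero)+
    have \<Phi>b: "\<bar>pcut 0 R 1 ((norm x)\<^sup>2)\<bar> \<le> 1" for x :: "real ^ 'n" using pcut_0_bound[of R 1 "(norm x)\<^sup>2"] by simp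
    have \<Phi>i: "integrable lborel (\<lambda>x. w x * pcut 0 R 1 ((norm x)\<^sup>2))"
      by (rule bounded_w_integrable(1)[OF _ \<Phi>b]) measurable
    note pr = set_integral_product[OF hi \<Phi>i]
    have mean: "(LINT x|lborel. w x * pcut 0 R 1 ((norm x)\<^sup>2)) = mean_w k 1" unfolding mean_w_def R_def by simp
    have est: "(LINT z:half_space|lebesgue. fst z powr \<rho> * w (snd z) * \<psi> z) + (LINT x|lebesgue. norm x powr \<sigma>\<^sub>1 * u\<^sub>0 x * \<psi> (0, x))
       \<le> integral\<^sup>L lborel W"
    proof (rule weak_test_estimate[OF wt, where G="\<lambda>z. Cb * (a1 z + a3 z + 0 + 0)"])
      show "0 \<le> \<psi> z" for z unfolding \<psi>_def using bump_bounds pcut_0_bound by simp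
      show "0 \<le> Cb * (a1 z + a3 z + 0 + 0)" for z using Cb a0 by simp
      show "integrable lborel W" by (rule Wi)
      show "0 \<le> W z" for z unfolding W_def v1_def v3_def using c by simp
      show "set_integrable lebesgue half_space (\<lambda>z. fst z powr \<rho> * w (snd z) * \<psi> z)"
        unfolding \<psi>_def by (rule pr(1))
      fix z assume z: "z \<in> half_space" "snd z \<noteq> 0"
      define X where "X = norm (snd z)"
      define t where "t = fst z"
      have X: "X > 0" using z by (simp add: X_def)
      have t: "t > 0" using z by (auto simp: t_def)
      have ind: "indicator S y \<in> {0, 1::real}" for S and y :: real by (auto simp: indicator_def)
      have ind': "indicator S y \<in> {0, 1::real}" for S and y :: "real ^ 'n" by (auto simp: indicator_def)
      have pw1: "X powr (- (\<sigma>\<^sub>2 / (p - 1))) * a1 z powr p' = indicator {0..T} (fst z) * ((1 / T) powr p' * v1 (snd z))"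
        unfolding a1_def v1_def X_def[symmetric] by (subst weighted_power[OF X _ ind ind' q]) (use T in simp_all)
      have pw3: "X powr (- (\<sigma>\<^sub>2 / (p - 1))) * a3 z powr p' = indicator {0..T} (fst z) * (1 * v3 (snd z))"
        unfolding a3_def v3_def X_def[symmetric] by (subst weighted_power[OF X _ ind ind' q]) (use T in simp_all)
      have "(Cb * (a1 z + a3 z + 0 + 0)) powr p' = Cb powr p' * (a1 z + a3 z + 0 + 0) powr p'" by (rule powr_mult)
      also have "\<dots> \<le> Cb powr p' * (4 powr p' * (a1 z powr p' + a3 z powr p' + 0 powr p' + 0 powr p'))"
        using a0 q by (intro mult_left_mono powr_sum4_le) auto
      finally have "X powr (- (\<sigma>\<^sub>2 / (p - 1))) * (Cb * (a1 z + a3 z + 0 + 0)) powr p'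
        \<le> X powr (- (\<sigma>\<^sub>2 / (p - 1))) * (Cb powr p' * (4 powr p' * (a1 z powr p' + a3 z powr p' + 0 powr p' + 0 powr p')))"
        by (rule mult_left_mono) simp
      also have "\<dots> = c * (X powr (- (\<sigma>\<^sub>2 / (p - 1))) * a1 z powr p' + X powr (- (\<sigma>\<^sub>2 / (p - 1))) * a3 z powr p' + 0 + 0)"
        unfolding c_def using q by (simp add: algebra_simps)
      also have "\<dots> = W z" unfolding pw1 pw3 W_def by (rule refl)
      finally show "norm (snd z) powr (- (\<sigma>\<^sub>2 / (p - 1))) * (Cb * (a1 z + a3 z + 0 + 0)) powr p' \<le> W z"
        unfolding X_def .
      define B where "B = bump (t / T)"
      define \<phi> where "\<phi> = cut R 1 (X\<^sup>2)"
      have B: "0 \<le> B" "B \<le> 1" and \<phi>: "0 \<le> \<phi>" "\<phi> \<le> 1" unfolding B_def \<phi>_def by (rule bump_bounds cut_bounds)+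
      have \<phi>\<theta>: "\<phi> \<le> \<phi> powr \<theta>" and B\<theta>: "B \<le> B powr \<theta>" using \<phi> B \<theta> by (intro powr_ge_self; simp)+
      have P: "\<psi> z powr (1/p) = B powr \<theta> * \<phi> powr \<theta>"
        unfolding \<psi>_def pcut_norm[OF z(2)] unfolding X_def[symmetric] \<theta>_def[symmetric] B_def \<phi>_def t_def using X
        by (simp add: powr_mult)
      have Leq: "L z = - (X powr \<sigma>\<^sub>1 * (bump' (t / T) / T * \<phi>)) - B * pcut_err CARD('n) 0 R 1 X"
        unfolding L_def add_0_right pcut_norm[OF z(2)] radial_lap_pcut[OF z(2) zero_less_one]
        unfolding X_def[symmetric] \<phi>_def B_def t_def using X by simp
      show "\<bar>L z\<bar> \<le> Cb * (a1 z + a3 z + 0 + 0) * \<psi> z powr (1/p)"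
      proof (cases "t \<le> T")
        case False
        then have "1 \<le> t / T" using T0 by (simp add: le_divide_eq)
        then have "L z = 0" unfolding Leq B_def using bump_zero by simp
        then show ?thesis using Cb a0[of z] by simp
      next
        case True
        have c1: "\<bar>X powr \<sigma>\<^sub>1 * (bump' (t / T) / T * \<phi>)\<bar> \<le> 2 * F * (a1 z * (B powr \<theta> * \<phi> powr \<theta>))"
        proof (cases "X \<le> R'")
          case True
          have "\<bar>bump' (t / T)\<bar> * \<phi> \<le> (2 * F * B powr \<theta>) * \<phi> powr \<theta>"
            using bump'[of "t / T"] \<phi> \<phi>\<theta> F(1) unfolding B_def by (intro mult_mono) auto
          then have "X powr \<sigma>\<^sub>1 / T * (\<bar>bump' (t / T)\<bar> * \<phi>) \<le> X powr \<sigma>\<^sub>1 / T * ((2 * F * B powr \<theta>) * \<phi> powr \<theta>)"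
            using T0 by (intro mult_left_mono) auto
          moreover have "a1 z = X powr \<sigma>\<^sub>1 / T" unfolding a1_def using True \<open>t \<le> T\<close> t by (simp add: X_def t_def)
          ultimately show ?thesis using T0 \<phi> by (simp add: abs_mult mult_ac)
        next
          case False
          then have "\<phi> = 0" using cut_outer(1)[of R 1 X] R unfolding \<phi>_def by simp
          then show ?thesis using F(1) a0[of z] by simp
        qed
        have c3: "\<bar>B * pcut_err CARD('n) 0 R 1 X\<bar> \<le> Q * (a3 z * (B powr \<theta> * \<phi> powr \<theta>))"
        proof -
          have "indicator {R..R * exp 1} X = (indicator (annulus k (k + 1)) (snd z) :: real)"
            unfolding R(3) R_def R'_def annulus_def X_def by (auto simp: indicator_def add.commute[of _ 1] exp_add mult.commute)
          then have a3e: "a3 z = indicator {R..R * exp 1} X * X powr (- 2)"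
            unfolding a3_def using \<open>t \<le> T\<close> t by (simp add: X_def t_def)
          have "\<bar>pcut_err CARD('n) 0 R 1 X\<bar> \<le> Q * (a3 z * \<phi> powr \<theta>)"
            using Q(2)[of R 1 X] R X unfolding a3e \<phi>_def by (simp add: mult_ac)
          then have "B * \<bar>pcut_err CARD('n) 0 R 1 X\<bar> \<le> B powr \<theta> * (Q * (a3 z * \<phi> powr \<theta>))"
            using B B\<theta> by (intro mult_mono) auto
          then show ?thesis using B by (simp add: abs_mult mult_ac)
        qed
        have pos: "0 \<le> a1 z * (B powr \<theta> * \<phi> powr \<theta>)" "0 \<le> a3 z * (B powr \<theta> * \<phi> powr \<theta>)" using a0[of z] by auto
        have "\<bar>L z\<bar> \<le> 2 * F * (a1 z * (B powr \<theta> * \<phi> powr \<theta>)) + Q * (a3 z * (B powr \<theta> * \<phi> powr \<theta>))"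
          unfolding Leq using c1 c3 by linarith
        also have "\<dots> \<le> Cb * (a1 z * (B powr \<theta> * \<phi> powr \<theta>)) + Cb * (a3 z * (B powr \<theta> * \<phi> powr \<theta>))"
          unfolding Cb_def using pos F(1) Q(1) by (intro add_mono mult_right_mono) auto
        also have "\<dots> = Cb * (a1 z + a3 z + 0 + 0) * \<psi> z powr (1/p)" unfolding P by (simp add: algebra_simps)
        finally show ?thesis .
      qed
    qed
    have "\<psi> (0, x) = 0" for x unfolding \<psi>_def using bump_zero by simp
    then have "(LINT z:half_space|lebesgue. fst z powr \<rho> * w (snd z) * \<psi> z) \<le> integral\<^sup>L lborel W"
      using est by simp
    moreover have "(LINT z:half_space|lebesgue. fst z powr \<rho> * w (snd z) * \<psi> z) = T powr (\<rho> + 1) * \<kappa> * mean_w k 1"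
      unfolding \<psi>_def pr(2) \<tau> mean by (rule refl)
    ultimately show ?thesis using Wb by (simp add: mult_ac)
  qed
  show ?thesis by (rule that[of \<kappa> C, OF \<kappa> C main])
qed

end

section \<open>Nonexistence\<close>

context weak_solution
begin

lemma mean_w_tendsto:
  assumes "\<And>i. 1 \<le> n i"
  shows "(\<lambda>i. mean_w (Suc i) (n i)) \<longlonglongrightarrow> (LINT x|lborel. w x)"
  unfolding mean_w_def
proof (rule integral_dominated_convergence)
  show "integrable lborel (\<lambda>x. \<bar>w x\<bar>)" using w_lborel by simp
  show "AE x in lborel. (\<lambda>i. w x * pcut 0 (exp (real (Suc i))) (real (n i)) ((norm x)\<^sup>2)) \<longlonglongrightarrow> w x"
    using AE_lborel_singleton[of "0 :: real ^ 'n"]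
  proof eventually_elim
    case (elim x)
    have "w x * pcut 0 (exp (real (Suc i))) (real (n i)) ((norm x)\<^sup>2) = w x" if "nat \<lceil>norm x\<rceil> \<le> i" for i
    proof -
      have "norm x \<le> real i" using that by linarith
      also have "real i \<le> exp (real (Suc i))" using exp_ge_add_one_self[of "real (Suc i)"] by simp
      finally have "cut (exp (real (Suc i))) (real (n i)) ((norm x)\<^sup>2) = 1"
        using elim assms[of i] by (intro cut_inner(1)) auto
      then show ?thesis using elim by (simp add: pcut_norm)
    qed
    then have "\<forall>\<^sub>F i in sequentially. w x * pcut 0 (exp (real (Suc i))) (real (n i)) ((norm x)\<^sup>2) = w x"
      unfolding eventually_sequentially by blast
    then show ?case by (rule tendsto_eventually)
  qed
  show "AE x in lborel. norm (w x * pcut 0 (exp (real (Suc i))) (real (n i)) ((norm x)\<^sup>2)) \<le> \<bar>w x\<bar>" for i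
  proof (rule AE_I2)
    fix x :: "real ^ 'n"
    show "norm (w x * pcut 0 (exp (real (Suc i))) (real (n i)) ((norm x)\<^sup>2)) \<le> \<bar>w x\<bar>"
      using pcut_0_bound[of "exp (real (Suc i))" "real (n i)" "(norm x)\<^sup>2"]
      by (simp add: abs_mult mult_left_le)
  qed
qed measurable

lemma exponent_gap: "dimn + \<gamma>\<^sub>2 = (dimn + \<gamma>\<^sub>3) + m * p'"
proof -
  have "dimn + (\<sigma>\<^sub>1 * P - s) = (dimn + (- 2 * P - s)) + m * P" for P s by (simp add: algebra_simps)
  then show ?thesis .
qed

text \<open>
  For a growing source the radii can stay fixed: the source term is of order \<open>T\<^sup>\<rho>\<^sup>+\<^sup>1\<close>, every other
  term of lower order in \<open>T\<close>.
\<close>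

lemma nonexistence_growing:
  assumes "\<rho> > 0"
  shows "(LINT x|lborel. w x) \<le> 0"
proof (rule LIMSEQ_le_const2[OF mean_w_tendsto[of "\<lambda>_. 1"]])
  have "mean_w k 1 \<le> 0" if k: "1 \<le> k" for k
  proof -
    obtain \<kappa> C where kC: "\<kappa> > 0" "C > 0"
      "\<And>k n T. 1 \<le> k \<Longrightarrow> 1 \<le> n \<Longrightarrow> 1 \<le> T \<Longrightarrow> \<kappa> * (T powr (\<rho> + 1) * mean_w k n) \<le>
       C * (1 + T powr \<rho> + (shell_sum 0 (k + n) \<gamma>\<^sub>2)
          + T * (1 / real n) powr p' * (shell_sum k (k + n) \<gamma>\<^sub>3))"
      by (rule main_inequality) (rule that; assumption)
    define A where "A = 1 + (shell_sum 0 (k + 1) \<gamma>\<^sub>2)"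
    define B where "B = (shell_sum k (k + 1) \<gamma>\<^sub>3)"
    have le: "\<kappa> * mean_w k 1 \<le> C * (A * T powr (- (\<rho> + 1)) + 1 / T + B * T powr (- \<rho>))" if T: "1 \<le> T" for T :: real
    proof -
      have "\<kappa> * (T powr (\<rho> + 1) * mean_w k 1) \<le> C * (A + T powr \<rho> + T * B)"
        using kC(3)[OF k _ T, of 1] unfolding A_def B_def by (simp add: algebra_simps)
      then have "T powr (- (\<rho> + 1)) * (\<kappa> * (T powr (\<rho> + 1) * mean_w k 1)) \<le> T powr (- (\<rho> + 1)) * (C * (A + T powr \<rho> + T * B))"
        by (rule mult_left_mono) simp
      moreover have "T powr (- (\<rho> + 1)) * T powr (\<rho> + 1) = 1" using T by (simp flip: powr_add)
      moreover have "T powr (- (\<rho> + 1)) * T powr \<rho> = 1 / T" using T by (simp add: powr_minus_divide flip: powr_add)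
      moreover have "T powr (- (\<rho> + 1)) * T = T powr (- \<rho>)"
        using T powr_add[of T "- (\<rho> + 1)" 1] by simp
      ultimately show ?thesis by (simp add: algebra_simps)
    qed
    have "(\<lambda>i. C * (A * real (Suc i) powr (- (\<rho> + 1)) + 1 / real (Suc i) + B * real (Suc i) powr (- \<rho>))) \<longlonglongrightarrow> C * (A * 0 + 0 + B * 0)"
    proof -
      have l: "filterlim (\<lambda>i. real (Suc i)) at_top sequentially"
        by (rule filterlim_compose[OF filterlim_real_sequentially filterlim_Suc])
      have "(\<lambda>i. real (Suc i) powr (- s)) \<longlonglongrightarrow> 0" if "s > 0" for s
        using that by (intro tendsto_neg_powr l) auto
      from this[of "\<rho> + 1"] this[of \<rho>]
      have p1: "(\<lambda>i. real (Suc i) powr (- (\<rho> + 1))) \<longlonglongrightarrow> 0" and p2: "(\<lambda>i. real (Suc i) powr (- \<rho>)) \<longlonglongrightarrow> 0"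
        using assms by simp_all
      have p3: "(\<lambda>i. 1 / real (Suc i)) \<longlonglongrightarrow> 0" using LIMSEQ_inverse_real_of_nat by (simp add: inverse_eq_divide)
      show ?thesis by (intro tendsto_add tendsto_mult tendsto_const p1 p2 p3)
    qed
    from LIMSEQ_le_const[OF this, of "\<kappa> * mean_w k 1"] have "\<kappa> * mean_w k 1 \<le> 0"
      using le by auto
    then show ?thesis using kC(1) by (simp add: mult_le_0_iff)
  qed
  then show "\<exists>N. \<forall>i\<ge>N. mean_w (Suc i) 1 \<le> 0" by simp
qed simp

text \<open>
  Let \<open>T\<close> tend to infinity first. What is left is \<open>n\<close> to the power \<open>- p'\<close> times a sum of \<open>n\<close> terms, each at
  most 1 even in the equality case, so the logarithmic cutoff wins the factor \<open>n\<close> to the power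
  \<open>1 - p'\<close>, which tends to 0.
\<close>

lemma nonexistence_stationary:
  assumes \<rho>0: "\<rho> = 0" and e: "dimn + \<gamma>\<^sub>3 \<le> 0"
  shows "(LINT x|lborel. w x) \<le> 0"
proof -
  obtain \<kappa> C where kC: "\<kappa> > 0" "C > 0"
      "\<And>k n T. 1 \<le> k \<Longrightarrow> 1 \<le> n \<Longrightarrow> 1 \<le> T \<Longrightarrow> \<kappa> * (T powr (\<rho> + 1) * mean_w k n) \<le>
       C * (1 + T powr \<rho> + (shell_sum 0 (k + n) \<gamma>\<^sub>2)
          + T * (1 / real n) powr p' * (shell_sum k (k + n) \<gamma>\<^sub>3))"
    by (rule main_inequality) (rule that; assumption)
  have le: "\<kappa> * mean_w n n \<le> C * real n powr (1 - p')" if n: "1 \<le> n" for n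
  proof -
    define A where "A = 2 + (shell_sum 0 (n + n) \<gamma>\<^sub>2)"
    define B where "B = (1 / real n) powr p' * (shell_sum n (n + n) \<gamma>\<^sub>3)"
    have "(shell_sum n (n + n) \<gamma>\<^sub>3) \<le> (\<Sum>j\<in>{n..<n + n}. 1)"
      using e by (intro sum_mono) (simp add: mult_nonneg_nonpos)
    then have "B \<le> (1 / real n) powr p' * real n" unfolding B_def by (intro mult_left_mono) auto
    also have "\<dots> = real n powr (1 - p')" using n by (simp add: powr_diff powr_divide)
    finally have B: "B \<le> real n powr (1 - p')" .
    have leT: "\<kappa> * mean_w n n \<le> C * (A * (1 / real (Suc i)) + B)" for i
    proof -
      define T where "T = real (Suc i)"
      have T: "1 \<le> T" by (simp add: T_def)
      have "\<kappa> * (T * mean_w n n) \<le> C * (A + T * B)"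
        using kC(3)[OF n n T] T unfolding A_def B_def \<rho>0 by (simp add: algebra_simps)
      also have "\<dots> = T * (C * (A * (1 / T) + B))" using T by (simp add: field_simps)
      finally have "T * (\<kappa> * mean_w n n) \<le> T * (C * (A * (1 / T) + B))" by (simp add: mult.left_commute)
      then show ?thesis using T unfolding T_def by (simp add: mult_le_cancel_left_pos)
    qed
    have "(\<lambda>i. C * (A * (1 / real (Suc i)) + B)) \<longlonglongrightarrow> C * (A * 0 + B)"
      using LIMSEQ_inverse_real_of_nat by (intro tendsto_intros) (simp add: inverse_eq_divide)
    from LIMSEQ_le_const[OF this, of "\<kappa> * mean_w n n"] have "\<kappa> * mean_w n n \<le> C * B" using leT by auto
    also have "\<dots> \<le> C * real n powr (1 - p')" using B kC(2) by simp
    finally show ?thesis .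
  qed
  have l: "filterlim (\<lambda>i. real (Suc i)) at_top sequentially"
    by (rule filterlim_compose[OF filterlim_real_sequentially filterlim_Suc])
  have l1: "(\<lambda>i. C * real (Suc i) powr (1 - p')) \<longlonglongrightarrow> C * 0"
    using p'_gt by (intro tendsto_intros tendsto_neg_powr l) auto
  have l2: "(\<lambda>i. \<kappa> * mean_w (Suc i) (Suc i)) \<longlonglongrightarrow> \<kappa> * (LINT x|lborel. w x)"
    by (intro tendsto_intros mean_w_tendsto) auto
  have "\<kappa> * (LINT x|lborel. w x) \<le> C * 0"
    by (rule LIMSEQ_le[OF l2 l1]) (intro exI allI impI le, simp)
  then show ?thesis using kC(1) by (simp add: mult_le_0_iff)
qed

lemma tendsto_exp_neg:
  assumes "a < 0" shows "(\<lambda>i. exp (real (Suc i) * a)) \<longlonglongrightarrow> 0"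
proof -
  have "(\<lambda>i. exp a ^ Suc i) \<longlonglongrightarrow> 0" using assms by (intro LIMSEQ_Suc LIMSEQ_power_zero) simp
  then show ?thesis by (simp only: exp_of_nat_mult)
qed

lemma tendsto_nat_exp_neg:
  assumes "a < 0" shows "(\<lambda>i. real (Suc i) * exp (real (Suc i) * a)) \<longlonglongrightarrow> 0"
proof -
  have "(\<lambda>i. real i * exp a ^ i) \<longlonglongrightarrow> 0" using assms by (intro powser_times_n_limit_0) simp
  then have "(\<lambda>i. real (Suc i) * exp a ^ Suc i) \<longlonglongrightarrow> 0" by (rule LIMSEQ_Suc)
  then show ?thesis by (simp only: exp_of_nat_mult)
qed

text \<open>
  Use the parabolic scaling \<open>T = R\<^sup>m\<close> with \<open>R = exp k\<close>. The hypothesis says that the Laplacian term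
  \<open>T R\<close> to the power \<open>N + \<gamma>\<^sub>3\<close> is smaller than \<open>T\<^sup>\<rho>\<^sup>+\<^sup>1\<close>. For the time derivative there are two cases: if
  \<open>N + \<gamma>\<^sub>2 > 0\<close>, the plain cutoff gives a term of the same size as the Laplacian term; otherwise the
  corrected test function gives a term that grows at most linearly in \<open>k\<close>, hence logarithmically in
  \<open>R\<close>.
\<close>

lemma nonexistence_decaying:
  assumes \<rho>0: "\<rho> < 0" and e: "dimn + \<gamma>\<^sub>3 < m * \<rho>"
  shows "(LINT x|lborel. w x) \<le> 0"
proof -
  define a where "a = dimn + \<gamma>\<^sub>3 - m * \<rho>"
  have a: "a < 0" using e by (simp add: a_def)
  have pw: "exp (real k * m) powr s = exp (real k * (m * s))" for k s
    by (simp add: powr_def mult_ac)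
  have "\<exists>\<kappa> f. \<kappa> > 0 \<and> f \<longlonglongrightarrow> 0 \<and> (\<forall>i. \<kappa> * mean_w (Suc i) 1 \<le> f i)"
  proof (cases "dimn + \<gamma>\<^sub>2 > 0")
    case True
    obtain \<kappa> C where kC: "\<kappa> > 0" "C > 0"
      "\<And>k T. 1 \<le> k \<Longrightarrow> 1 \<le> T \<Longrightarrow> \<kappa> * (T powr (\<rho> + 1) * mean_w k 1) \<le>
       C * (T * (1 / T) powr p' * exp ((real k + 1) * (dimn + \<gamma>\<^sub>2)) + T * exp (real k * (dimn + \<gamma>\<^sub>3)))"
      by (rule bump_inequality[OF True]) (rule that; assumption)
    have "\<kappa> * mean_w (Suc i) 1 \<le> C * (exp (dimn + \<gamma>\<^sub>2) + 1) * exp (real (Suc i) * a)" for i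
    proof -
      define k where "k = Suc i"
      define T where "T = exp (real k * m)"
      have T: "1 \<le> T" unfolding T_def using m_pos by simp
      have k: "1 \<le> k" by (simp add: k_def)
      have e1: "T powr (\<rho> + 1) = exp (real k * (m * (\<rho> + 1)))" unfolding T_def pw ..
      have e2: "T * (1 / T) powr p' = exp (real k * m - real k * (m * p'))"
        unfolding T_def powr_divide pw by (simp add: exp_diff)
      have "T * (1 / T) powr p' * exp ((real k + 1) * (dimn + \<gamma>\<^sub>2)) = exp (dimn + \<gamma>\<^sub>2) * exp (real k * (m + (dimn + \<gamma>\<^sub>3)))"
      proof -
        have "real k * m - real k * Q + (real k + 1) * (A + Q) = (A + Q) + real k * (m + A)" for A Q
          by (simp add: algebra_simps)
        then show ?thesis unfolding e2 exponent_gap exp_add[symmetric] by (simp only:)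
      qed
      moreover have "T * exp (real k * (dimn + \<gamma>\<^sub>3)) = exp (real k * (m + (dimn + \<gamma>\<^sub>3)))"
        unfolding T_def exp_add[symmetric] by (simp only: distrib_left)
      ultimately have "\<kappa> * (exp (real k * (m * (\<rho> + 1))) * mean_w k 1) \<le> C * ((exp (dimn + \<gamma>\<^sub>2) + 1) * exp (real k * (m + (dimn + \<gamma>\<^sub>3))))"
        using kC(3)[OF k T] unfolding e1 by (simp only: distrib_right mult_1)
      also have "m + (dimn + \<gamma>\<^sub>3) = m * (\<rho> + 1) + a" by (simp add: a_def algebra_simps)
      also have "exp (real k * (m * (\<rho> + 1) + a)) = exp (real k * (m * (\<rho> + 1))) * exp (real k * a)"
        by (simp only: distrib_left exp_add)
      finally have "exp (real k * (m * (\<rho> + 1))) * (\<kappa> * mean_w k 1)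
         \<le> exp (real k * (m * (\<rho> + 1))) * (C * (exp (dimn + \<gamma>\<^sub>2) + 1) * exp (real k * a))"
        by (simp only: mult_ac)
      then show ?thesis unfolding k_def by (simp only: mult_le_cancel_left_pos exp_gt_zero)
    qed
    moreover have "(\<lambda>i. C * (exp (dimn + \<gamma>\<^sub>2) + 1) * exp (real (Suc i) * a)) \<longlonglongrightarrow> C * (exp (dimn + \<gamma>\<^sub>2) + 1) * 0"
      by (intro tendsto_intros tendsto_exp_neg a)
    ultimately show ?thesis using kC(1) by (metis (no_types, lifting) mult_zero_right)
  next
    case False
    obtain \<kappa> C where kC: "\<kappa> > 0" "C > 0"
      "\<And>k n T. 1 \<le> k \<Longrightarrow> 1 \<le> n \<Longrightarrow> 1 \<le> T \<Longrightarrow> \<kappa> * (T powr (\<rho> + 1) * mean_w k n) \<le>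
       C * (1 + T powr \<rho> + (shell_sum 0 (k + n) \<gamma>\<^sub>2)
          + T * (1 / real n) powr p' * (shell_sum k (k + n) \<gamma>\<^sub>3))"
      by (rule main_inequality) (rule that; assumption)
    define b where "b = - (m * (\<rho> + 1))"
    have b: "b < 0" unfolding b_def using m_pos \<rho> by simp
    have "\<kappa> * mean_w (Suc i) 1 \<le> C * (2 * exp (real (Suc i) * b) + exp (real (Suc i) * (- m)) + real (Suc i) * exp (real (Suc i) * b) + exp (real (Suc i) * a))" for i
    proof -
      define k where "k = Suc i"
      define T where "T = exp (real k * m)"
      have T: "1 \<le> T" unfolding T_def using m_pos by simp
      have k: "1 \<le> k" by (simp add: k_def)
      define S where "S = (shell_sum 0 (k + 1) \<gamma>\<^sub>2)"
      have "S \<le> (\<Sum>j\<in>{0..<k + 1}. 1)" unfolding S_def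
        using False by (intro sum_mono) (simp add: mult_nonneg_nonpos)
      then have S: "S \<le> 1 + real k" by simp
      have S3: "(shell_sum k (k + 1) \<gamma>\<^sub>3) = exp (real k * (dimn + \<gamma>\<^sub>3))" by simp
      \<comment> \<open>The size of the source term; the inequality is divided by it.\<close>
      define X where "X = exp (real k * (m * (\<rho> + 1)))"
      have X: "X > 0" by (simp add: X_def)
      have e0: "X * exp (real k * b) = 1" unfolding X_def b_def by (simp add: exp_minus)
      have e2: "T powr \<rho> = X * exp (real k * (- m))" unfolding T_def pw X_def exp_add[symmetric] by (simp add: algebra_simps)
      have e3: "T * exp (real k * (dimn + \<gamma>\<^sub>3)) = X * exp (real k * a)"
      proof -
        have "real k * m + real k * (dimn + \<gamma>\<^sub>3) = real k * (m * (\<rho> + 1)) + real k * a" unfolding a_def by (simp add: algebra_simps)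
        then show ?thesis unfolding T_def X_def exp_add[symmetric] by simp
      qed
      have "T powr (\<rho> + 1) = X" unfolding T_def pw X_def ..
      then have "\<kappa> * (X * mean_w k 1) \<le> C * (1 + T powr \<rho> + S + T * exp (real k * (dimn + \<gamma>\<^sub>3)))"
        using kC(3)[OF k order_refl T] unfolding S_def S3 by simp
      also have "\<dots> \<le> C * (1 + T powr \<rho> + (1 + real k) + T * exp (real k * (dimn + \<gamma>\<^sub>3)))"
        using S kC(2) by (intro mult_left_mono) auto
      also have "1 + T powr \<rho> + (1 + real k) + T * exp (real k * (dimn + \<gamma>\<^sub>3))
         = X * (2 * exp (real k * b) + exp (real k * (- m)) + real k * exp (real k * b) + exp (real k * a))"
      proof -
        have "X * (2 * exp (real k * b) + exp (real k * (- m)) + real k * exp (real k * b) + exp (real k * a))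
          = 2 * (X * exp (real k * b)) + X * exp (real k * (- m)) + real k * (X * exp (real k * b)) + X * exp (real k * a)"
          by (simp only: distrib_left mult_ac)
        then show ?thesis unfolding e0 e2 e3 by simp
      qed
      finally have "X * (\<kappa> * mean_w k 1)
         \<le> X * (C * (2 * exp (real k * b) + exp (real k * (- m)) + real k * exp (real k * b) + exp (real k * a)))"
        by (simp only: mult_ac)
      then show ?thesis using X unfolding k_def by (simp only: mult_le_cancel_left_pos)
    qed
    moreover have "(\<lambda>i. C * (2 * exp (real (Suc i) * b) + exp (real (Suc i) * (- m)) + real (Suc i) * exp (real (Suc i) * b) + exp (real (Suc i) * a)))
       \<longlonglongrightarrow> C * (2 * 0 + 0 + 0 + 0)"
      using m_pos by (intro tendsto_intros tendsto_exp_neg tendsto_nat_exp_neg a b) simp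
    ultimately show ?thesis using kC(1) by (metis (no_types, lifting) add_0 mult_zero_right)
  qed
  then obtain \<kappa> f where f: "\<kappa> > 0" "f \<longlonglongrightarrow> 0" "\<And>i. \<kappa> * mean_w (Suc i) 1 \<le> f i" by blast
  have "(\<lambda>i. \<kappa> * mean_w (Suc i) 1) \<longlonglongrightarrow> \<kappa> * (LINT x|lborel. w x)"
    by (intro tendsto_intros mean_w_tendsto) auto
  from LIMSEQ_le[OF this f(2)] have "\<kappa> * (LINT x|lborel. w x) \<le> 0" using f(3) by blast
  then show ?thesis using f(1) by (simp add: mult_le_0_iff)
qed

end

theorem theorem1p1:
  fixes \<sigma>\<^sub>1 \<sigma>\<^sub>2 p \<rho> :: real
    and u\<^sub>0 w :: "real ^ 'n \<Rightarrow> real"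
    and N :: nat
  assumes "N = CARD('n)" and "N \<ge> 2"
    and "\<sigma>\<^sub>1 > -2" and "\<sigma>\<^sub>2 > -2" and "p > 1"
    and "L1_loc UNIV u\<^sub>0"
    and "continuous_on UNIV w" and "integrable lebesgue w"
    and "(LINT x|lebesgue. w x) > 0"
  shows "(\<rho> > 0 \<longrightarrow> \<not> (\<exists>u. weak_global_solution \<sigma>\<^sub>1 \<sigma>\<^sub>2 p \<rho> w u\<^sub>0 u)) \<and>
         (-1 < \<rho> \<and> \<rho> < 0 \<and>
            p < (real N + \<sigma>\<^sub>2 - \<rho> * (2 + \<sigma>\<^sub>1)) / (real N - 2 - \<rho> * (2 + \<sigma>\<^sub>1)) \<longrightarrow>
            \<not> (\<exists>u. weak_global_solution \<sigma>\<^sub>1 \<sigma>\<^sub>2 p \<rho> w u\<^sub>0 u)) \<and>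
         (\<rho> = 0 \<and> ereal p \<le> stationary_exponent N \<sigma>\<^sub>2 \<longrightarrow>
            \<not> (\<exists>u. weak_global_solution \<sigma>\<^sub>1 \<sigma>\<^sub>2 p \<rho> w u\<^sub>0 u))"
proof -
  have pos: "(LINT x|lborel. w x) > 0"
    using assms(9) lebesgue_lborel_integral(2)[OF borel_measurable_continuous_onI[OF assms(7)]] by simp
  have loc: "weak_solution \<sigma>\<^sub>1 \<sigma>\<^sub>2 p \<rho> w u\<^sub>0 u (real N)"
    if "weak_global_solution \<sigma>\<^sub>1 \<sigma>\<^sub>2 p \<rho> w u\<^sub>0 u" "\<rho> > -1" for u
    using that assms by unfold_locales auto
  have scale: "real N + (- 2 * (p / (p - 1)) - \<sigma>\<^sub>2 / (p - 1)) < s \<longleftrightarrow> p * (real N - 2 - s) < real N + \<sigma>\<^sub>2 - s"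
    "real N + (- 2 * (p / (p - 1)) - \<sigma>\<^sub>2 / (p - 1)) \<le> s \<longleftrightarrow> p * (real N - 2 - s) \<le> real N + \<sigma>\<^sub>2 - s" for s
  proof -
    have "real N + (- 2 * (p / (p - 1)) - \<sigma>\<^sub>2 / (p - 1)) - s = (p * (real N - 2 - s) - (real N + \<sigma>\<^sub>2 - s)) / (p - 1)"
    proof -
      define d where "d = p - 1"
      have "d > 0" "p = d + 1" using assms(5) by (simp_all add: d_def)
      then show ?thesis by (simp add: field_simps)
    qed
    moreover have "p - 1 > 0" using assms(5) by simp
    ultimately show "real N + (- 2 * (p / (p - 1)) - \<sigma>\<^sub>2 / (p - 1)) < s \<longleftrightarrow> p * (real N - 2 - s) < real N + \<sigma>\<^sub>2 - s"
      "real N + (- 2 * (p / (p - 1)) - \<sigma>\<^sub>2 / (p - 1)) \<le> s \<longleftrightarrow> p * (real N - 2 - s) \<le> real N + \<sigma>\<^sub>2 - s"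
      using divide_less_0_iff[of "p * (real N - 2 - s) - (real N + \<sigma>\<^sub>2 - s)" "p - 1"]
        divide_le_0_iff[of "p * (real N - 2 - s) - (real N + \<sigma>\<^sub>2 - s)" "p - 1"] by linarith+
  qed
  show ?thesis
  proof (intro conjI impI notI)
    assume "\<rho> > 0" "\<exists>u. weak_global_solution \<sigma>\<^sub>1 \<sigma>\<^sub>2 p \<rho> w u\<^sub>0 u"
    then obtain u where "weak_global_solution \<sigma>\<^sub>1 \<sigma>\<^sub>2 p \<rho> w u\<^sub>0 u" by blast
    from weak_solution.nonexistence_growing[OF loc[OF this]] \<open>\<rho> > 0\<close> pos show False by simp
  next
    assume a: "-1 < \<rho> \<and> \<rho> < 0 \<and>
            p < (real N + \<sigma>\<^sub>2 - \<rho> * (2 + \<sigma>\<^sub>1)) / (real N - 2 - \<rho> * (2 + \<sigma>\<^sub>1))"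
      and "\<exists>u. weak_global_solution \<sigma>\<^sub>1 \<sigma>\<^sub>2 p \<rho> w u\<^sub>0 u"
    then obtain u where u: "weak_global_solution \<sigma>\<^sub>1 \<sigma>\<^sub>2 p \<rho> w u\<^sub>0 u" by blast
    have "\<rho> * (2 + \<sigma>\<^sub>1) < 0" using a assms(3) by (intro mult_neg_pos) auto
    then have "real N - 2 - \<rho> * (2 + \<sigma>\<^sub>1) > 0" using assms(2) by simp
    then have "p * (real N - 2 - \<rho> * (2 + \<sigma>\<^sub>1)) < real N + \<sigma>\<^sub>2 - \<rho> * (2 + \<sigma>\<^sub>1)"
      using a by (simp only: pos_less_divide_eq)
    then have "real N + (- 2 * (p / (p - 1)) - \<sigma>\<^sub>2 / (p - 1)) < (\<sigma>\<^sub>1 + 2) * \<rho>"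
      unfolding scale by (simp only: mult.commute[of \<rho>] add.commute[of 2])
    from weak_solution.nonexistence_decaying[OF loc[OF u] _ this] a pos show False by simp
  next
    assume a: "\<rho> = 0 \<and> ereal p \<le> stationary_exponent N \<sigma>\<^sub>2"
      and "\<exists>u. weak_global_solution \<sigma>\<^sub>1 \<sigma>\<^sub>2 p \<rho> w u\<^sub>0 u"
    then obtain u where u: "weak_global_solution \<sigma>\<^sub>1 \<sigma>\<^sub>2 p \<rho> w u\<^sub>0 u" by blast
    have "p * (real N - 2 - 0) \<le> real N + \<sigma>\<^sub>2 - 0"
    proof (cases "N = 2")
      case True then show ?thesis using assms(4) by simp
    next
      case False
      then have N: "real N - 2 > 0" using assms(2) by simp
      then have "p \<le> (real N + \<sigma>\<^sub>2) / (real N - 2)" using a False by (simp add: stationary_exponent_def)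
      then show ?thesis using N by (simp add: pos_le_divide_eq)
    qed
    then have "real N + (- 2 * (p / (p - 1)) - \<sigma>\<^sub>2 / (p - 1)) \<le> 0" unfolding scale .
    from weak_solution.nonexistence_stationary[OF loc[OF u] _ this] a pos show False by simp
  qed
qed

end
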